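(* Let $a,b,c:[0,1]\to\mathbb R$ belong to $L^1([0,1])$. For every $n\in\mathbb N$, let $\varphi_1,\ldots,\varphi_n$ be the hat-functions on the uniform mesh $x_i=\frac{i}{n+1}$, $i=0,\ldots,n+1$ (defined in the context), and let $A_n\in\mathbb R^{n\times n}$ be the linear finite element stiffness matrix associated with the problem $-(a(x)u'(x))'+b(x)u'(x)+c(x)u(x)=f(x)$ on $(0,1)$, $u(0)=u(1)=0$, i.e., $$(A_n)_{ij}=\int_0^1a(x)\varphi_j'(x)\varphi_i'(x)\,dx+\int_0^1b(x)\varphi_j'(x)\varphi_i(x)\,dx+\int_0^1c(x)\varphi_j(x)\varphi_i(x)\,dx,\qquad i,j=1,\ldots,n.$$ Then $$\Bigl\{\frac1{n+1}A_n\Bigr\}_n\sim_{\rm GLT}a(x)(2-2\cos\theta)$$ and $$\Bigl\{\frac1{n+1}A_n\Bigr\}_n\sim_{\sigma,\lambda}a(x)(2-2\cos\theta),$$ where $(x,\theta)\in[0,1]\times[-\pi,\pi]$.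
   Context: Hat-functions: with $x_i=\frac{i}{n+1}$, for $i=1,\ldots,n$, $\varphi_i(x)=\frac{x-x_{i-1}}{x_i-x_{i-1}}$ for $x\in[x_{i-1},x_i)$, $\varphi_i(x)=\frac{x_{i+1}-x}{x_{i+1}-x_i}$ for $x\in[x_i,x_{i+1})$, and $\varphi_i(x)=0$ otherwise; $\varphi_i'$ is the derivative, defined a.e. Matrix-sequences and distributions. A matrix-sequence is a sequence $\{A_n\}_n$ with $A_n\in\mathbb C^{n\times n}$, $n\in\mathbb N=\{1,2,\ldots\}$. All measure-theoretic notions refer to Lebesgue measure; $\mu_k$ is Lebesgue measure in $\mathbb R^k$. $C_c(\mathbb R)$ (resp. $C_c(\mathbb C)$) is the space of continuous complex-valued functions with bounded support on $\mathbb R$ (resp. $\mathbb C$). $\sigma_i(A)$ and $\lambda_i(A)$ are the singular values and the eigenvalues (with multiplicity) of $A$. For a measurable $f:D\subset\mathbb R^k\to\mathbb C$ with $0<\mu_k(D)<\infty$: $\{A_n\}_n\sim_\sigma f$ means $\lim_{n\to\infty}\frac1n\sum_{i=1}^nF(\sigma_i(A_n))=\frac1{\mu_k(D)}\int_DF(|f(\mathbf x)|)\,d\mathbf x$ for all $F\in C_c(\mathbb R)$; $\{A_n\}_n\sim_\lambda f$ means $\lim_{n\to\infty}\frac1n\sum_{i=1}^nF(\lambda_i(A_n))=\frac1{\mu_k(D)}\int_DF(f(\mathbf x))\,d\mathbf x$ for all $F\in C_c(\mathbb C)$; $\{A_n\}_n\sim_{\sigma,\lambda}f$ means both. GLT sequences.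 For $a:[0,1]\to\mathbb C$, $D_n(a)=\mathrm{diag}_{i=1,\ldots,n}\,a(i/n)$. For $f\in L^1([-\pi,\pi])$, $T_n(f)=[f_{i-j}]_{i,j=1}^n$ with $f_k=\frac1{2\pi}\int_{-\pi}^{\pi}f(\theta)e^{-\mathrm ik\theta}\,d\theta$. A sequence (in $m$) of matrix-sequences $\{B_{n,m}\}_n$ is an approximating class of sequences (a.c.s.) for $\{A_n\}_n$ if for every $m$ there is $n_m$ such that for all $n\ge n_m$ one can write $A_n=B_{n,m}+R_{n,m}+N_{n,m}$ with $\mathrm{rank}(R_{n,m})\le c(m)n$ and $\|N_{n,m}\|\le\omega(m)$ (spectral norm), where $n_m,c(m),\omega(m)$ depend only on $m$ and $c(m),\omega(m)\to0$ as $m\to\infty$. For a measurable $\kappa:[0,1]\times[-\pi,\pi]\to\mathbb C$, $\{A_n\}_n\sim_{\rm GLT}\kappa$ means that there exist functions $a_{i,m},f_{i,m}$, $i=1,\ldots,N_m$, $m\in\mathbb N$, such that each $a_{i,m}:[0,1]\to\mathbb C$ is continuous a.e. and $f_{i,m}\in L^1([-\pi,\pi])$; $\sum_{i=1}^{N_m}a_{i,m}(x)f_{i,m}(\theta)\to\kappa(x,\theta)$ in measure on $[0,1]\times[-\pi,\pi]$ as $m\to\infty$; and $\bigl\{\sum_{i=1}^{N_m}D_n(a_{i,m})T_n(f_{i,m})\bigr\}_n$ is an a.c.s. for $\{A_n\}_n$. *)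

theory Defs
  imports
    "HOL-Analysis.Analysis"
    "Jordan_Normal_Form.Schur_Decomposition"
    "Jordan_Normal_Form.DL_Rank"
begin

unbundle no vec_syntax

section \<open>Matrix-sequences\<close>

text \<open>A matrix-sequence is indexed by \<open>n = 1, 2, \<dots>\<close>; its value at \<open>n = 0\<close> is irrelevant.
  Matrix indices start at \<open>0\<close>, so the entry \<open>$$ (i, j)\<close> is the mathematical entry
  \<open>(i + 1, j + 1)\<close>.\<close>

definition matrix_seq :: "(nat \<Rightarrow> complex mat) \<Rightarrow> bool" where
  "matrix_seq A \<longleftrightarrow> (\<forall>n\<ge>1. A n \<in> carrier_mat n n)"

definition eigenvalues :: "complex mat \<Rightarrow> complex multiset" where
  "eigenvalues A = proots (char_poly A)"

text \<open>The eigenvalues of \<open>A\<^sup>*A\<close> are real and nonnegative, so \<^const>\<open>Re\<close> only changes the type.\<close>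

definition singular_values :: "complex mat \<Rightarrow> real multiset" where
  "singular_values A = image_mset (\<lambda>z. sqrt (Re z)) (eigenvalues (mat_adjoint A * A))"

definition l2_norm :: "complex Matrix.vec \<Rightarrow> real" where
  "l2_norm v = L2_set (\<lambda>i. cmod (v $ i)) {..<dim_vec v}"

definition spectral_norm :: "complex mat \<Rightarrow> real" where
  "spectral_norm A =
     (SUP v\<in>{v \<in> carrier_vec (dim_col A). l2_norm v \<le> 1}. l2_norm (A *\<^sub>v v))"


section \<open>Singular value and eigenvalue distributions\<close>

definition Cc :: "('a::real_normed_vector \<Rightarrow> complex) set" where
  "Cc = {F. continuous_on UNIV F \<and> bounded {x. F x \<noteq> 0}}"

definition symbol_on :: "'a::euclidean_space set \<Rightarrow> ('a \<Rightarrow> complex) \<Rightarrow> bool" where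
  "symbol_on D f \<longleftrightarrow>
     D \<in> sets lebesgue \<and> 0 < emeasure lebesgue D \<and> emeasure lebesgue D < \<infinity> \<and>
     f \<in> borel_measurable (lebesgue_on D)"

definition singular_value_distribution ::
    "(nat \<Rightarrow> complex mat) \<Rightarrow> 'a::euclidean_space set \<Rightarrow> ('a \<Rightarrow> complex) \<Rightarrow> bool" where
  "singular_value_distribution A D f \<longleftrightarrow>
     matrix_seq A \<and> symbol_on D f \<and>
     (\<forall>F::real \<Rightarrow> complex. F \<in> Cc \<longrightarrow>
        (\<lambda>n. (\<Sum>s\<in>#singular_values (A n). F s) / of_nat n)
          \<longlonglongrightarrow> (LINT x|lebesgue_on D. F (cmod (f x))) / of_real (measure lebesgue D))"

definition eigenvalue_distribution ::
    "(nat \<Rightarrow> complex mat) \<Rightarrow> 'a::euclidean_space set \<Rightarrow> ('a \<Rightarrow> complex) \<Rightarrow> bool" where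
  "eigenvalue_distribution A D f \<longleftrightarrow>
     matrix_seq A \<and> symbol_on D f \<and>
     (\<forall>F::complex \<Rightarrow> complex. F \<in> Cc \<longrightarrow>
        (\<lambda>n. (\<Sum>z\<in>#eigenvalues (A n). F z) / of_nat n)
          \<longlonglongrightarrow> (LINT x|lebesgue_on D. F (f x)) / of_real (measure lebesgue D))"


section \<open>Generalized locally Toeplitz sequences\<close>

definition diag_sampling :: "nat \<Rightarrow> (real \<Rightarrow> complex) \<Rightarrow> complex mat" where
  "diag_sampling n a = mat_diag n (\<lambda>i. a (real (i + 1) / real n))"

definition fourier_coeff :: "(real \<Rightarrow> complex) \<Rightarrow> int \<Rightarrow> complex" where
  "fourier_coeff f k =
     (LINT \<theta>|lebesgue_on {-pi..pi}. f \<theta> * exp (- \<i> * of_int k * of_real \<theta>)) / of_real (2 * pi)"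

definition toeplitz :: "nat \<Rightarrow> (real \<Rightarrow> complex) \<Rightarrow> complex mat" where
  "toeplitz n f = Matrix.mat n n (\<lambda>(i, j). fourier_coeff f (int i - int j))"

text \<open>\<open>B m n\<close> is the matrix \<open>B\<^bsub>n,m\<^esub>\<close>; the index \<open>m\<close> also starts at \<open>1\<close>.\<close>

definition acs :: "(nat \<Rightarrow> nat \<Rightarrow> complex mat) \<Rightarrow> (nat \<Rightarrow> complex mat) \<Rightarrow> bool" where
  "acs B A \<longleftrightarrow>
     matrix_seq A \<and> (\<forall>m\<ge>1. matrix_seq (B m)) \<and>
     (\<exists>(n0 :: nat \<Rightarrow> nat) (c :: nat \<Rightarrow> real) (\<omega> :: nat \<Rightarrow> real).
        c \<longlonglongrightarrow> 0 \<and> \<omega> \<longlonglongrightarrow> 0 \<and>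
        (\<forall>m\<ge>1. \<forall>n\<ge>1. n \<ge> n0 m \<longrightarrow>
          (\<exists>R\<in>carrier_mat n n. \<exists>N\<in>carrier_mat n n.
             A n = B m n + R + N \<and>
             real (vec_space.rank n R) \<le> c m * real n \<and>
             spectral_norm N \<le> \<omega> m)))"

definition tendsto_in_measure_on ::
    "'a::euclidean_space set \<Rightarrow> (nat \<Rightarrow> 'a \<Rightarrow> complex) \<Rightarrow> ('a \<Rightarrow> complex) \<Rightarrow> bool" where
  "tendsto_in_measure_on D g \<kappa> \<longleftrightarrow>
     (\<forall>m\<ge>1. g m \<in> borel_measurable (lebesgue_on D)) \<and>
     \<kappa> \<in> borel_measurable (lebesgue_on D) \<and>
     (\<forall>\<epsilon>>0. (\<lambda>m. emeasure lebesgue {p \<in> D. cmod (g m p - \<kappa> p) > \<epsilon>}) \<longlonglongrightarrow> 0)"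

text \<open>The functions \<open>a\<^bsub>i,m\<^esub>\<close> and \<open>f\<^bsub>i,m\<^esub>\<close> are \<open>a i m\<close> and \<open>f i m\<close>. The matrix sum over \<open>i\<close> is
  written entrywise because matrices of varying size form no additive monoid.\<close>

definition GLT :: "(nat \<Rightarrow> complex mat) \<Rightarrow> (real \<times> real \<Rightarrow> complex) \<Rightarrow> bool" where
  "GLT A \<kappa> \<longleftrightarrow>
     matrix_seq A \<and> \<kappa> \<in> borel_measurable (lebesgue_on ({0..1} \<times> {-pi..pi})) \<and>
     (\<exists>(N :: nat \<Rightarrow> nat)
        (a :: nat \<Rightarrow> nat \<Rightarrow> real \<Rightarrow> complex) (f :: nat \<Rightarrow> nat \<Rightarrow> real \<Rightarrow> complex).
        (\<forall>m\<ge>1. \<forall>i\<in>{1..N m}.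
           (AE x in lebesgue_on {0..1}. continuous (at x within {0..1}) (a i m)) \<and>
           integrable (lebesgue_on {-pi..pi}) (f i m)) \<and>
        tendsto_in_measure_on ({0..1} \<times> {-pi..pi})
          (\<lambda>m (x, \<theta>). \<Sum>i=1..N m. a i m x * f i m \<theta>) \<kappa> \<and>
        acs (\<lambda>m n. Matrix.mat n n (\<lambda>rs.
               \<Sum>i=1..N m. (diag_sampling n (a i m) * toeplitz n (f i m)) $$ rs)) A)"


section \<open>Linear finite element stiffness matrices\<close>

definition mesh_point :: "nat \<Rightarrow> nat \<Rightarrow> real" where
  "mesh_point n i = real i / real (n + 1)"

text \<open>Meant for \<open>1 \<le> i \<le> n\<close>, where the subtraction \<open>i - 1\<close> does not truncate.\<close>

definition hat :: "nat \<Rightarrow> nat \<Rightarrow> real \<Rightarrow> real" where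
  "hat n i x =
     (if x \<in> {mesh_point n (i - 1)..<mesh_point n i} then
        (x - mesh_point n (i - 1)) / (mesh_point n i - mesh_point n (i - 1))
      else if x \<in> {mesh_point n i..<mesh_point n (i + 1)} then
        (mesh_point n (i + 1) - x) / (mesh_point n (i + 1) - mesh_point n i)
      else 0)"

text \<open>\<^const>\<open>deriv\<close> is unspecified at the three nodes where \<open>hat n i\<close> is not differentiable; this
  null set does not affect the integrals.\<close>

definition stiffness_matrix ::
    "(real \<Rightarrow> real) \<Rightarrow> (real \<Rightarrow> real) \<Rightarrow> (real \<Rightarrow> real) \<Rightarrow> nat \<Rightarrow> real mat" where
  "stiffness_matrix a b c n = Matrix.mat n n (\<lambda>(i', j').
     let i = i' + 1; j = j' + 1 in
       (LINT x|lebesgue_on {0..1}. a x * deriv (hat n j) x * deriv (hat n i) x) +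
       (LINT x|lebesgue_on {0..1}. b x * deriv (hat n j) x * hat n i x) +
       (LINT x|lebesgue_on {0..1}. c x * hat n j x * hat n i x))"

end

(*
  Resolvents replace the general theory of spectral distributions. If all entries of A - X add up
  to o(n) in modulus, the identity (A - z)^-1 - (X - z)^-1 = (A - z)^-1 (X - A) (X - z)^-1 shows that
  the traces of the resolvents of A and X agree up to o(n) for z far from the real axis; a similar
  identity compares the resolvents of A^H A and X^H X. By Stone-Weierstrass the functions 1/(t - z)
  determine the distribution of real points. The eigenvalues of A_n are not real, but by the Schur
  decomposition their imaginary parts add up to at most the entrywise norm of (A_n - A_n^H)/2, which
  stays bounded because only the advection term is not symmetric.

  In the entrywise l1-norm the advection and reaction terms are O(1) after division by n + 1, and
  replacing a by a continuous function alpha costs O(n ||a - alpha||_1). For continuous alpha the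
  matrix is Hermitian and tridiagonal, and its p-th power is close to the matrix with entries
  alpha(x_i)^p t_p(i - j), where t_p are the Fourier coefficients of (2 - 2 cos theta)^p; this gives
  the moments of its spectrum. The approximating class of sequences needs only that deleting the few
  columns with a large sum from a tridiagonal matrix of small entrywise norm leaves a small
  spectral norm.
*)

theory Submission
  imports Defs
begin

text \<open>The obstacle is that \<open>a\<close> is merely integrable: moments of the limit may be
  infinite and the spectral norms of the matrices may grow with \<open>n\<close>. Moments are
  therefore taken only for continuous coefficients, whose spectra stay in a fixed interval, and the
  transfer to \<open>a\<close> uses functions with a bound independent of the size of the matrix:
  resolvents. The entrywise norm fits both ends. At every point the hats, and their slopes up to the
  factor \<open>n + 1\<close>, have bounded absolute sums, so L1 norms of the coefficients control
  it; and it is dual to the largest entry, so it controls traces of products with bounded matrices.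
  The missing normality is paid for by keeping \<open>z\<close> away from the real axis: the
  resolvent bound uses the numerical range, which lies in a strip of width independent of
  \<open>n\<close>. Resolvents with poles at height at least \<open>M\<close> still determine
  distributions on the line because the Cayley transform with poles at plus or minus
  \<open>i M\<close> carries the line to a circle, where Stone-Weierstrass applies. For singular
  values the Gram matrix is Hermitian and the strip degenerates to the real axis.\<close>

section \<open>Unitary triangularisation\<close>

lemma mat_adjoint_carrier [simp, intro]:
  "A \<in> carrier_mat n m \<Longrightarrow> mat_adjoint A \<in> carrier_mat m n"
  by (auto simp: mat_adjoint_def)

lemma mat_adjoint_index [simp]:
  "i < dim_col A \<Longrightarrow> j < dim_row A \<Longrightarrow> mat_adjoint A $$ (i, j) = conjugate (A $$ (j, i))"
  by (simp add: mat_adjoint_def mat_of_rows_def)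

lemma mat_adjoint_dim [simp]: "dim_row (mat_adjoint A) = dim_col A" "dim_col (mat_adjoint A) = dim_row A"
  by (auto simp: mat_adjoint_def)

lemma mult_mat_index_sum:
  fixes A B :: "'a::semiring_0 mat"
  assumes "A \<in> carrier_mat n m" "B \<in> carrier_mat m l" "i < n" "j < l"
  shows "(A * B) $$ (i, j) = (\<Sum>k<m. A $$ (i, k) * B $$ (k, j))"
  using assms by (auto simp: scalar_prod_def lessThan_atLeast0 intro!: sum.cong)

lemma mult_mat_vec_index_sum:
  fixes A :: "'a::semiring_0 mat"
  assumes "A \<in> carrier_mat n m" "v \<in> carrier_vec m" "i < n"
  shows "(A *\<^sub>v v) $ i = (\<Sum>k<m. A $$ (i, k) * v $ k)"
  using assms by (auto simp: scalar_prod_def lessThan_atLeast0 intro!: sum.cong)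

lemma cscalar_prod_sum:
  fixes u v :: "complex Matrix.vec"
  assumes "v \<in> carrier_vec n"
  shows "u \<bullet>c v = (\<Sum>i<n. u $ i * cnj (v $ i))"
  using assms by (auto simp: scalar_prod_def lessThan_atLeast0 intro!: sum.cong)

lemma l2_norm_sq:
  assumes "v \<in> carrier_vec n"
  shows "(l2_norm v)\<^sup>2 = (\<Sum>i<n. (cmod (v $ i))\<^sup>2)"
  using assms by (auto simp: l2_norm_def L2_set_def sum_nonneg)

lemma l2_norm_nonneg [simp]: "0 \<le> l2_norm v"
  by (simp add: l2_norm_def)

lemma cscalar_prod_self:
  assumes "v \<in> carrier_vec n"
  shows "v \<bullet>c v = of_real ((l2_norm v)\<^sup>2)"
  unfolding l2_norm_sq[OF assms] cscalar_prod_sum[OF assms]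
  by (simp add: complex_norm_square del: of_real_power flip: of_real_power)

text \<open>A Gram-Schmidt step by dimension count: orthogonality to the columns before
  \<open>k\<close> and vanishing of the coordinates after \<open>k\<close> are \<open>n - 1\<close>
  linear conditions on \<open>n\<close> unknowns. \<open>M\<close> stores them with row
  \<open>k\<close> zero, so its determinant vanishes and a nonzero solution exists; \<open>P\<close>
  is injective, so its image can be normalised.\<close>

lemma triangular_orthonormalisation:
  fixes P Q :: "complex mat"
  assumes P: "P \<in> carrier_mat n n" and Q: "Q \<in> carrier_mat n n" and QP: "Q * P = 1\<^sub>m n" and k: "k < n"
  obtains v where "v \<in> carrier_vec n" "\<And>i. k < i \<Longrightarrow> i < n \<Longrightarrow> v $ i = 0"
    "\<And>j. j < k \<Longrightarrow> (P *\<^sub>v v) \<bullet>c (col P j) = 0" "(P *\<^sub>v v) \<bullet>c (P *\<^sub>v v) = 1"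
proof -
  define M where "M = Matrix.mat n n (\<lambda>(r, i). if r < k then \<Sum>l<n. P $$ (l, i) * cnj (P $$ (l, r))
    else if k < r then (if i = r then 1 else 0) else 0)"
  have M: "M \<in> carrier_mat n n" by (simp add: M_def)
  have "det M = det (mat\<^sub>r n n (\<lambda>i. if i = k then 0\<^sub>v n else row M i))"
    using M by (intro arg_cong[where f = det] eq_matI) (auto simp: M_def)
  also have "\<dots> = 0"
    by (rule det_row_0[OF k]) (use M in auto)
  finally obtain v where v: "v \<in> carrier_vec n" "v \<noteq> 0\<^sub>v n" and Mv: "M *\<^sub>v v = 0\<^sub>v n"
    using det_0_iff_vec_prod_zero[OF M] by auto
  have Mr: "(\<Sum>i<n. M $$ (r, i) * v $ i) = 0" if "r < n" for r
    using mult_mat_vec_index_sum[OF M v(1) that] Mv that by simp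
  have sup: "v $ r = 0" if "k < r" "r < n" for r
  proof -
    have "(\<Sum>i<n. M $$ (r, i) * v $ i) = (\<Sum>i<n. if i = r then v $ i else 0)"
      using that by (intro sum.cong) (auto simp: M_def)
    then show ?thesis using Mr[OF that(2)] that by simp
  qed
  have orth: "(P *\<^sub>v v) \<bullet>c (col P j) = 0" if "j < k" for j
  proof -
    have j: "j < n" using that k by simp
    have "(P *\<^sub>v v) \<bullet>c (col P j) = (\<Sum>l<n. (\<Sum>i<n. P $$ (l, i) * v $ i) * cnj (P $$ (l, j)))"
      using P j v(1) by (subst cscalar_prod_sum[of _ n]) (auto simp: mult_mat_vec_index_sum[OF P v(1)] simp del: index_mult_mat_vec)
    also have "\<dots> = (\<Sum>i<n. M $$ (j, i) * v $ i)"
      using that j unfolding sum_distrib_right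
      by (subst sum.swap) (auto intro!: sum.cong simp: M_def sum_distrib_left mult_ac)
    finally show ?thesis using Mr[OF j] by simp
  qed
  have Pv: "P *\<^sub>v v \<in> carrier_vec n" using P v by auto
  have "P *\<^sub>v v \<noteq> 0\<^sub>v n"
  proof
    assume "P *\<^sub>v v = 0\<^sub>v n"
    then have "(Q * P) *\<^sub>v v = 0\<^sub>v n" using P Q v assoc_mult_mat_vec[OF Q P v(1)] by auto
    then show False using v QP by simp
  qed
  then have nz: "l2_norm (P *\<^sub>v v) \<noteq> 0"
    using cscalar_prod_self[OF Pv] conjugate_square_eq_0_vec[OF Pv] by auto
  define w where "w = of_real (1 / l2_norm (P *\<^sub>v v)) \<cdot>\<^sub>v v"
  have w: "w \<in> carrier_vec n" using v by (simp add: w_def)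
  have Pw: "P *\<^sub>v w = of_real (1 / l2_norm (P *\<^sub>v v)) \<cdot>\<^sub>v (P *\<^sub>v v)"
    using P v by (simp add: w_def mult_mat_vec)
  show ?thesis
  proof (rule that[OF w])
    show "w $ i = 0" if "k < i" "i < n" for i
      using sup[OF that] that v by (simp add: w_def)
    show "(P *\<^sub>v w) \<bullet>c (col P j) = 0" if "j < k" for j
      using orth[OF that] P v that k unfolding Pw by (subst smult_scalar_prod_distrib[of _ n]) auto
    have "(P *\<^sub>v w) \<bullet>c (P *\<^sub>v w) = of_real (1 / l2_norm (P *\<^sub>v v)) * of_real (1 / l2_norm (P *\<^sub>v v)) * ((P *\<^sub>v v) \<bullet>c (P *\<^sub>v v))"
      unfolding Pw using P v by (simp add: cscalar_prod_sum[of _ n] sum_distrib_left mult_ac)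
    then show "(P *\<^sub>v w) \<bullet>c (P *\<^sub>v w) = 1"
      using nz by (simp add: cscalar_prod_self[OF Pv] power2_eq_square)
  qed
qed

lemma eigenvalues_upper_triangular:
  assumes "T \<in> carrier_mat n n" "upper_triangular T"
  shows "eigenvalues T = image_mset (\<lambda>k. T $$ (k, k)) (mset_set {..<n})"
proof -
  have "eigenvalues T = proots (prod_list (map (\<lambda>a. [:- a, 1:]) (diag_mat T)))"
    using char_poly_upper_triangular[OF assms] by (simp add: eigenvalues_def)
  also have "\<dots> = mset (diag_mat T)"
  proof -
    have "proots (prod_list (map (\<lambda>a. [:- a, 1:]) xs)) = mset xs" for xs :: "complex list"
    proof (induction xs)
      case (Cons x xs)
      have "(\<Prod>a\<leftarrow>xs. [:- a, 1:]) \<noteq> 0" by (auto simp: prod_list_zero_iff)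
      then show ?case using Cons by (simp add: proots_mult del: mult_pCons_left)
    qed simp
    then show ?thesis .
  qed
  also have "\<dots> = image_mset (\<lambda>k. T $$ (k, k)) (mset_set {..<n})"
    using assms by (simp add: diag_mat_def atLeast0LessThan)
  finally show ?thesis .
qed

lemma cscalar_prod_adjoint:
  fixes A :: "complex mat"
  assumes "A \<in> carrier_mat n m" "u \<in> carrier_vec m" "v \<in> carrier_vec n"
  shows "(A *\<^sub>v u) \<bullet>c v = u \<bullet>c (mat_adjoint A *\<^sub>v v)"
proof -
  have "(A *\<^sub>v u) \<bullet>c v = (\<Sum>i<n. (\<Sum>j<m. A $$ (i, j) * u $ j) * cnj (v $ i))"
    using assms by (subst cscalar_prod_sum[of _ n]) (auto simp: mult_mat_vec_index_sum[of _ n m] simp del: index_mult_mat_vec)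
  also have "\<dots> = (\<Sum>j<m. u $ j * cnj (\<Sum>i<n. mat_adjoint A $$ (j, i) * v $ i))"
    using assms unfolding sum_distrib_right
    by (subst sum.swap) (auto simp: sum_distrib_left mult_ac intro!: sum.cong)
  also have "\<dots> = u \<bullet>c (mat_adjoint A *\<^sub>v v)"
    using assms mat_adjoint_carrier[OF assms(1)]
      mult_mat_vec_carrier[OF mat_adjoint_carrier[OF assms(1)] assms(3)]
    by (subst cscalar_prod_sum[of _ m]) (auto simp: mult_mat_vec_index_sum[of _ m n] simp del: index_mult_mat_vec)
  finally show ?thesis .
qed

text \<open>The library's Schur decomposition \<open>A = P T Q\<close> does not record orthogonality, so the columns of
  \<open>P\<close> are orthonormalised by an upper triangular factor.\<close>

theorem unitary_schur:
  fixes A :: "complex mat"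
  assumes A: "A \<in> carrier_mat n n"
  obtains U where "U \<in> carrier_mat n n" "mat_adjoint U * U = 1\<^sub>m n"
    "upper_triangular (mat_adjoint U * A * U)"
    "eigenvalues A = image_mset (\<lambda>k. (mat_adjoint U * A * U) $$ (k, k)) (mset_set {..<n})"
proof -
  obtain es where es: "char_poly A = (\<Prod>a\<leftarrow>es. [:- a, 1:])"
    using char_poly_factorized[OF A] by auto
  obtain T P Q where "schur_decomposition A es = (T, P, Q)"
    by (cases "schur_decomposition A es") auto
  from schur_decomposition[OF A es this]
  have sim: "similar_mat_wit A T P Q" and T_upper: "upper_triangular T" by auto
  then have carr: "T \<in> carrier_mat n n" "P \<in> carrier_mat n n" "Q \<in> carrier_mat n n"
    and QP: "Q * P = 1\<^sub>m n" and AT: "A = P * T * Q"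
    using similar_mat_witD2[OF A sim] by auto
  have AP: "A * P = P * T"
    unfolding AT using carr QP by (simp add: assoc_mult_mat[of _ n n _ n _ n])
  have "\<forall>k<n. \<exists>v. v \<in> carrier_vec n \<and> (\<forall>i. k < i \<longrightarrow> i < n \<longrightarrow> v $ i = 0) \<and>
      (\<forall>j<k. (P *\<^sub>v v) \<bullet>c (col P j) = 0) \<and> (P *\<^sub>v v) \<bullet>c (P *\<^sub>v v) = 1"
    using triangular_orthonormalisation[OF carr(2,3) QP] by metis
  then obtain s where s: "\<And>k. k < n \<Longrightarrow> s k \<in> carrier_vec n"
    and s0: "\<And>k i. k < n \<Longrightarrow> k < i \<Longrightarrow> i < n \<Longrightarrow> s k $ i = 0"
    and s_orth: "\<And>k j. k < n \<Longrightarrow> j < k \<Longrightarrow> (P *\<^sub>v s k) \<bullet>c (col P j) = 0"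
    and s_norm: "\<And>k. k < n \<Longrightarrow> (P *\<^sub>v s k) \<bullet>c (P *\<^sub>v s k) = 1"
    by metis
  define u where "u = (\<lambda>k. P *\<^sub>v s k)"
  have u: "u k \<in> carrier_vec n" if "k < n" for k using carr s[OF that] by (auto simp: u_def)
  \<comment> \<open>Since \<open>u k\<close> is orthogonal to the columns of \<open>P\<close> before
    \<open>k\<close>, it is orthogonal to their span. Orthonormality, triangularity and the diagonal
    entries all come from this.\<close>
  have perp: "(P *\<^sub>v w) \<bullet>c u k = 0"
    if "w \<in> carrier_vec n" "k < n" "\<And>i. k \<le> i \<Longrightarrow> i < n \<Longrightarrow> w $ i = 0" for w k
  proof -
    have "(P *\<^sub>v w) \<bullet>c u k = (\<Sum>l<n. (\<Sum>j<n. P $$ (l, j) * w $ j) * cnj (u k $ l))"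
      using carr that u[OF that(2)]
      by (subst cscalar_prod_sum[of _ n]) (auto simp: mult_mat_vec_index_sum[of _ n n] simp del: index_mult_mat_vec)
    also have "\<dots> = (\<Sum>j<n. w $ j * cnj (\<Sum>l<n. u k $ l * cnj (P $$ (l, j))))"
      unfolding sum_distrib_right by (subst sum.swap) (auto simp: sum_distrib_left mult_ac)
    also have "\<dots> = (\<Sum>j<n. w $ j * cnj (if j < k then u k \<bullet>c col P j else 0))"
      using carr that u[OF that(2)]
      by (intro sum.cong) (auto simp: cscalar_prod_sum[of _ n])
    also have "\<dots> = 0"
      using s_orth[OF that(2)] by (intro sum.neutral) (auto simp: u_def)
    finally show ?thesis .
  qed
  have orth1: "u j \<bullet>c u k = 0" if "j < k" "k < n" for j k
    using perp[of "s j" k] that s[of j] s0[of j] by (auto simp: u_def)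
  have orth: "u j \<bullet>c u k = (if j = k then 1 else 0)" if "j < n" "k < n" for j k
  proof (cases "j < k \<or> j = k")
    case True
    then show ?thesis using orth1[of j k] s_norm that by (auto simp: u_def)
  next
    case False
    then have "u k \<bullet>c u j = 0" using orth1[of k j] that by simp
    moreover have "u j \<bullet>c u k = cnj (u k \<bullet>c u j)"
      using u that by (simp add: cscalar_prod_sum[of _ n] mult.commute)
    ultimately show ?thesis using False by simp
  qed
  define U where "U = Matrix.mat n n (\<lambda>(i, k). u k $ i)"
  have U: "U \<in> carrier_mat n n" by (simp add: U_def)
  have colU: "col U k = u k" if "k < n" for k using u[OF that] that by (auto simp: U_def)
  have aU: "mat_adjoint U \<in> carrier_mat n n" using U by simp
  have aUM: "(mat_adjoint U * M) $$ (j, k) = col M k \<bullet>c u j" if "M \<in> carrier_mat n n" "j < n" "k < n" for M j k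
  proof -
    have "(mat_adjoint U * M) $$ (j, k) = (\<Sum>i<n. mat_adjoint U $$ (j, i) * M $$ (i, k))"
      by (rule mult_mat_index_sum[OF aU that])
    also have "\<dots> = (\<Sum>i<n. M $$ (i, k) * cnj (u j $ i))"
      using that by (intro sum.cong) (auto simp: U_def mult.commute)
    also have "\<dots> = col M k \<bullet>c u j"
      using that u by (simp add: cscalar_prod_sum[of _ n])
    finally show ?thesis .
  qed
  have UU: "mat_adjoint U * U = 1\<^sub>m n"
  proof (rule eq_matI)
    show "(mat_adjoint U * U) $$ (j, k) = 1\<^sub>m n $$ (j, k)" if "j < dim_row (1\<^sub>m n)" "k < dim_col (1\<^sub>m n)" for j k
      using that aUM[OF U, of j k] orth[of k j] by (auto simp: colU)
  qed (use aU U in auto)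
  have AU: "A * U \<in> carrier_mat n n" using A U by simp
  have colAU: "col (A * U) k = P *\<^sub>v (T *\<^sub>v s k)" if "k < n" for k
  proof -
    have "col (A * U) k = A *\<^sub>v (P *\<^sub>v s k)"
      using col_mult2[OF A U that] colU[OF that] by (simp only: u_def)
    also have "\<dots> = (A * P) *\<^sub>v s k" using A carr s[OF that] by (simp add: assoc_mult_mat_vec[of _ n n _ n])
    also have "\<dots> = P *\<^sub>v (T *\<^sub>v s k)" using AP carr s[OF that] by (simp add: assoc_mult_mat_vec[of _ n n _ n])
    finally show ?thesis .
  qed
  have Ts: "(T *\<^sub>v s k) $ i = (if i = k then T $$ (k, k) * s k $ k else 0)" if "k < n" "k \<le> i" "i < n" for k i
  proof -
    have "(T *\<^sub>v s k) $ i = (\<Sum>l<n. T $$ (i, l) * s k $ l)"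
      using carr s that by (intro mult_mat_vec_index_sum) auto
    also have "\<dots> = (\<Sum>l<n. if l = k then (if i = k then T $$ (k, k) * s k $ k else 0) else 0)"
    proof (rule sum.cong)
      fix l assume "l \<in> {..<n}"
      then show "T $$ (i, l) * s k $ l = (if l = k then (if i = k then T $$ (k, k) * s k $ k else 0) else 0)"
        using that s0[of k l] upper_triangularD[OF T_upper, of l i] carr by (cases l k rule: linorder_cases) auto
    qed simp
    also have "\<dots> = (if i = k then T $$ (k, k) * s k $ k else 0)" using that by simp
    finally show ?thesis .
  qed
  define B where "B = mat_adjoint U * A * U"
  have B: "B \<in> carrier_mat n n" unfolding B_def using aU A U by (metis mult_carrier_mat)
  have B_entry: "B $$ (j, k) = (P *\<^sub>v (T *\<^sub>v s k)) \<bullet>c u j" if "j < n" "k < n" for j k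
    using aUM[OF AU that] colAU that A aU U by (simp add: B_def assoc_mult_mat[of _ n n _ n _ n])
  have upper: "upper_triangular B"
  proof (rule upper_triangularI)
    fix i j assume "j < i" "i < dim_row B"
    then show "B $$ (i, j) = 0"
      using B B_entry[of i j] perp[of "T *\<^sub>v s j" i] Ts[of j] carr s[of j] by auto
  qed
  \<comment> \<open>The vector \<open>T *\<^sub>v s k\<close> minus \<open>T $$ (k, k)\<close> times
    \<open>s k\<close> has no coordinates from \<open>k\<close> on, so \<open>perp\<close> applies
    to it. The diagonal of \<open>T\<close>, which carries the eigenvalues, is thus
    preserved.\<close>
  have diag: "B $$ (k, k) = T $$ (k, k)" if k: "k < n" for k
  proof -
    have T1: "T *\<^sub>v s k \<in> carrier_vec n" "T $$ (k, k) \<cdot>\<^sub>v s k \<in> carrier_vec n" using carr s[OF k] by auto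
    have "(P *\<^sub>v (T *\<^sub>v s k - T $$ (k, k) \<cdot>\<^sub>v s k)) \<bullet>c u k = 0"
    proof (rule perp[OF _ k])
      fix i assume "k \<le> i" "i < n"
      then show "(T *\<^sub>v s k - T $$ (k, k) \<cdot>\<^sub>v s k) $ i = 0"
        using Ts[OF k] s0[OF k] s[OF k] T1 by (auto simp del: index_mult_mat_vec)
    qed (use T1 in simp)
    also have "P *\<^sub>v (T *\<^sub>v s k - T $$ (k, k) \<cdot>\<^sub>v s k) = P *\<^sub>v (T *\<^sub>v s k) - T $$ (k, k) \<cdot>\<^sub>v u k"
      using carr T1 s[OF k] by (simp add: mult_minus_distrib_mat_vec[of _ n n] mult_mat_vec u_def)
    finally have "(P *\<^sub>v (T *\<^sub>v s k)) \<bullet>c u k - T $$ (k, k) * (u k \<bullet>c u k) = 0"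
      using carr T1 u[OF k]
      by (simp add: cscalar_prod_sum[of _ n] sum_subtractf sum_distrib_left algebra_simps del: index_mult_mat_vec)
    then show ?thesis using orth k B_entry by simp
  qed
  have "similar_mat A T" using sim by (auto simp: similar_mat_def)
  then have "eigenvalues A = eigenvalues T" by (simp add: eigenvalues_def char_poly_similar)
  also have "\<dots> = image_mset (\<lambda>k. B $$ (k, k)) (mset_set {..<n})"
    unfolding eigenvalues_upper_triangular[OF carr(1) T_upper] using diag by (intro image_mset_cong) auto
  finally show ?thesis using that[OF U UU] upper unfolding B_def by blast
qed

section \<open>Traces and operator bounds\<close>

definition mtrace :: "complex mat \<Rightarrow> complex" where
  "mtrace A = (\<Sum>i<dim_row A. A $$ (i, i))"

text \<open>The entrywise norm is dual to the largest modulus of an entry, and sums of integrals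
  bound it directly.\<close>

definition mat_l1 :: "complex mat \<Rightarrow> real" where
  "mat_l1 A = (\<Sum>i<dim_row A. \<Sum>j<dim_col A. cmod (A $$ (i, j)))"

definition op_bounded :: "complex mat \<Rightarrow> real \<Rightarrow> bool" where
  "op_bounded A c \<longleftrightarrow> (\<forall>v\<in>carrier_vec (dim_col A). l2_norm (A *\<^sub>v v) \<le> c * l2_norm v)"

text \<open>Equivalently, the numerical range of \<open>A\<close> lies in the strip of half-width
  \<open>c\<close> about the real axis.\<close>

definition im_bounded :: "complex mat \<Rightarrow> real \<Rightarrow> bool" where
  "im_bounded A c \<longleftrightarrow> (\<forall>v\<in>carrier_vec (dim_col A). \<bar>Im ((A *\<^sub>v v) \<bullet>c v)\<bar> \<le> c * (l2_norm v)\<^sup>2)"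

lemma mat_l1_nonneg [simp]: "0 \<le> mat_l1 A"
  by (simp add: mat_l1_def sum_nonneg)

lemma mtrace_mult_comm:
  assumes "A \<in> carrier_mat n m" "B \<in> carrier_mat m n"
  shows "mtrace (A * B) = mtrace (B * A)"
proof -
  have "mtrace (A * B) = (\<Sum>i<n. \<Sum>k<m. A $$ (i, k) * B $$ (k, i))"
    using assms by (simp add: mtrace_def mult_mat_index_sum[OF assms] del: index_mult_mat(1))
  also have "\<dots> = (\<Sum>k<m. \<Sum>i<n. B $$ (k, i) * A $$ (i, k))"
    by (subst sum.swap) (simp add: mult.commute)
  also have "\<dots> = mtrace (B * A)"
    using assms by (simp add: mtrace_def mult_mat_index_sum[OF assms(2,1)] del: index_mult_mat(1))
  finally show ?thesis .
qed

lemma mtrace_minus: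
  assumes "A \<in> carrier_mat n n" "B \<in> carrier_mat n n"
  shows "mtrace (A - B) = mtrace A - mtrace B"
  using assms by (simp add: mtrace_def sum_subtractf)

lemma mtrace_add:
  assumes "A \<in> carrier_mat n n" "B \<in> carrier_mat n n"
  shows "mtrace (A + B) = mtrace A + mtrace B"
  using assms by (simp add: mtrace_def sum.distrib)

lemma op_boundedD:
  "op_bounded A c \<Longrightarrow> A \<in> carrier_mat n m \<Longrightarrow> v \<in> carrier_vec m \<Longrightarrow> l2_norm (A *\<^sub>v v) \<le> c * l2_norm v"
  by (auto simp: op_bounded_def)

lemma op_bounded_mult:
  assumes "A \<in> carrier_mat n m" "B \<in> carrier_mat m l" "op_bounded A a" "op_bounded B b" "0 \<le> a"
  shows "op_bounded (A * B) (a * b)"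
  unfolding op_bounded_def
proof
  fix v :: "complex Matrix.vec" assume "v \<in> carrier_vec (dim_col (A * B))"
  then have v: "v \<in> carrier_vec l" using assms by simp
  have Bv: "B *\<^sub>v v \<in> carrier_vec m" using assms v by auto
  have "l2_norm ((A * B) *\<^sub>v v) = l2_norm (A *\<^sub>v (B *\<^sub>v v))"
    using assms v by (simp add: assoc_mult_mat_vec[of _ n m _ l])
  also have "\<dots> \<le> a * l2_norm (B *\<^sub>v v)" by (rule op_boundedD[OF assms(3,1) Bv])
  also have "\<dots> \<le> a * (b * l2_norm v)" by (intro mult_left_mono op_boundedD[OF assms(4,2) v] assms)
  finally show "l2_norm ((A * B) *\<^sub>v v) \<le> a * b * l2_norm v" by (simp add: mult.assoc)
qed

lemma cmod_index_le_l2_norm: "v \<in> carrier_vec n \<Longrightarrow> i < n \<Longrightarrow> cmod (v $ i) \<le> l2_norm v"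
  unfolding l2_norm_def by (rule member_le_L2_set) auto

lemma l2_norm_unit_vec: "i < n \<Longrightarrow> l2_norm (unit_vec n i :: complex Matrix.vec) = 1"
  by (simp add: l2_norm_def L2_set_def unit_vec_def if_distrib[of cmod] if_distrib[of "\<lambda>x. x ^ 2"] cong: if_cong)

lemma op_bounded_index:
  assumes "op_bounded A c" "A \<in> carrier_mat n m" "i < n" "j < m"
  shows "cmod (A $$ (i, j)) \<le> c"
proof -
  have "A $$ (i, j) = (A *\<^sub>v unit_vec m j) $ i"
    using assms by (auto simp: scalar_prod_right_unit)
  also have "cmod \<dots> \<le> l2_norm (A *\<^sub>v unit_vec m j)"
    using assms by (intro cmod_index_le_l2_norm[of _ n]) auto
  also have "\<dots> \<le> c * l2_norm (unit_vec m j :: complex Matrix.vec)"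
    using assms by (intro op_boundedD[of A c n m]) auto
  finally show ?thesis using assms by (simp add: l2_norm_unit_vec)
qed

text \<open>The trace pairs entries of \<open>M\<close> with entries of \<open>K\<close>, and no
  entry of \<open>K\<close> exceeds its operator bound.\<close>

lemma cmod_mtrace_mult_le:
  assumes "M \<in> carrier_mat n n" "K \<in> carrier_mat n n" "op_bounded K c"
  shows "cmod (mtrace (M * K)) \<le> mat_l1 M * c"
proof -
  have "mtrace (M * K) = (\<Sum>i<n. \<Sum>j<n. M $$ (i, j) * K $$ (j, i))"
    using assms by (simp add: mtrace_def mult_mat_index_sum[OF assms(1,2)] del: index_mult_mat(1))
  also have "cmod \<dots> \<le> (\<Sum>i<n. \<Sum>j<n. cmod (M $$ (i, j)) * c)"
    by (intro sum_norm_le) (auto simp: norm_mult intro!: mult_left_mono op_bounded_index[OF assms(3,2)])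
  also have "\<dots> = mat_l1 M * c"
    using assms by (simp add: mat_l1_def sum_distrib_right)
  finally show ?thesis .
qed

lemma cmod_cscalar_prod_le:
  assumes "u \<in> carrier_vec n" "v \<in> carrier_vec n"
  shows "cmod (u \<bullet>c v) \<le> l2_norm u * l2_norm v"
proof -
  have "cmod (u \<bullet>c v) \<le> (\<Sum>i<n. \<bar>cmod (u $ i)\<bar> * \<bar>cmod (v $ i)\<bar>)"
    unfolding cscalar_prod_sum[OF assms(2)] by (intro sum_norm_le) (simp add: norm_mult)
  also have "\<dots> \<le> l2_norm u * l2_norm v"
    using L2_set_mult_ineq[of "\<lambda>i. cmod (u $ i)" "\<lambda>i. cmod (v $ i)" "{..<n}"] assms
    by (simp add: l2_norm_def)
  finally show ?thesis .
qed

lemma l2_norm_eq_0_iff: "v \<in> carrier_vec n \<Longrightarrow> l2_norm v = 0 \<longleftrightarrow> v = 0\<^sub>v n"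
  by (auto simp: l2_norm_def L2_set_eq_0_iff)

lemma l2_norm_zero: "l2_norm (0\<^sub>v n) = 0"
  by (simp add: l2_norm_eq_0_iff[of _ n])

section \<open>Resolvents\<close>

lemma shift_mult_vec:
  fixes A :: "complex mat"
  assumes "A \<in> carrier_mat n n" "v \<in> carrier_vec n"
  shows "(A - z \<cdot>\<^sub>m 1\<^sub>m n) *\<^sub>v v = A *\<^sub>v v - z \<cdot>\<^sub>v v"
proof -
  have "(z \<cdot>\<^sub>m 1\<^sub>m n) *\<^sub>v v = z \<cdot>\<^sub>v v"
    using assms by (intro eq_vecI) (auto simp: smult_scalar_prod_distrib[of _ n])
  moreover have "(A - z \<cdot>\<^sub>m 1\<^sub>m n) *\<^sub>v v = A *\<^sub>v v - (z \<cdot>\<^sub>m 1\<^sub>m n) *\<^sub>v v"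
    using assms by (intro minus_mult_distrib_mat_vec[of _ n n]) auto
  ultimately show ?thesis by simp
qed

lemma cscalar_prod_minus_smult:
  assumes "x \<in> carrier_vec n" "v \<in> carrier_vec n"
  shows "(x - z \<cdot>\<^sub>v v) \<bullet>c v = x \<bullet>c v - z * of_real ((l2_norm v)\<^sup>2)"
  unfolding cscalar_prod_self[OF assms(2), symmetric] using assms
  by (simp add: cscalar_prod_sum[of _ n] sum_subtractf sum_distrib_left algebra_simps)

text \<open>Pair the shifted vector with \<open>v\<close>: the shift contributes \<open>Im z\<close>
  times the squared norm to the imaginary part, the numerical range takes away at most
  \<open>c\<close> times it, and Cauchy-Schwarz then cancels one factor of the norm.\<close>

lemma im_bounded_coercive:
  assumes A: "A \<in> carrier_mat n n" and C: "im_bounded A c" and v: "v \<in> carrier_vec n"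
  shows "(\<bar>Im z\<bar> - c) * l2_norm v \<le> l2_norm ((A - z \<cdot>\<^sub>m 1\<^sub>m n) *\<^sub>v v)"
proof (cases "l2_norm v = 0")
  case False
  let ?w = "(A - z \<cdot>\<^sub>m 1\<^sub>m n) *\<^sub>v v"
  have w: "?w \<in> carrier_vec n" using A v by (intro mult_mat_vec_carrier[of _ n n]) auto
  have eq: "?w \<bullet>c v = (A *\<^sub>v v) \<bullet>c v - z * of_real ((l2_norm v)\<^sup>2)"
    using A v by (simp add: shift_mult_vec cscalar_prod_minus_smult[of _ n])
  have "\<bar>Im z\<bar> * (l2_norm v)\<^sup>2 = \<bar>Im ((A *\<^sub>v v) \<bullet>c v) - Im (?w \<bullet>c v)\<bar>"
    unfolding eq by (simp add: abs_mult del: of_real_power)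
  also have "\<dots> \<le> \<bar>Im ((A *\<^sub>v v) \<bullet>c v)\<bar> + cmod (?w \<bullet>c v)"
    using abs_Im_le_cmod[of "?w \<bullet>c v"] by linarith
  also have "\<dots> \<le> c * (l2_norm v)\<^sup>2 + l2_norm ?w * l2_norm v"
    using C A v cmod_cscalar_prod_le[OF w v] by (intro add_mono) (auto simp: im_bounded_def)
  finally have "((\<bar>Im z\<bar> - c) * l2_norm v) * l2_norm v \<le> l2_norm ?w * l2_norm v"
    by (simp add: algebra_simps power2_eq_square)
  then show ?thesis using False l2_norm_nonneg[of v] by (simp add: mult_le_cancel_right)
qed simp

text \<open>Coercivity gives injectivity, hence invertibility in finite dimension, and applied to
  \<open>G *\<^sub>v v\<close> it gives the operator bound. Distance to the strip replaces distance
  to the spectrum, which would not bound the resolvent of a nonnormal matrix.\<close>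

lemma resolvent_exists:
  assumes A: "A \<in> carrier_mat n n" and C: "im_bounded A c" and z: "c < \<bar>Im z\<bar>"
  obtains G where "G \<in> carrier_mat n n" "(A - z \<cdot>\<^sub>m 1\<^sub>m n) * G = 1\<^sub>m n" "G * (A - z \<cdot>\<^sub>m 1\<^sub>m n) = 1\<^sub>m n"
    "op_bounded G (1 / (\<bar>Im z\<bar> - c))"
proof -
  let ?M = "A - z \<cdot>\<^sub>m 1\<^sub>m n"
  have M: "?M \<in> carrier_mat n n" using A by auto
  have "det ?M \<noteq> 0"
  proof
    assume "det ?M = 0"
    then obtain v where v: "v \<in> carrier_vec n" "v \<noteq> 0\<^sub>v n" "?M *\<^sub>v v = 0\<^sub>v n"
      using det_0_iff_vec_prod_zero[OF M] by auto
    have "(\<bar>Im z\<bar> - c) * l2_norm v \<le> 0"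
      using im_bounded_coercive[OF A C v(1), of z] unfolding v(3) l2_norm_zero .
    then have "l2_norm v \<le> 0" using z by (simp add: mult_le_0_iff)
    then show False using v l2_norm_eq_0_iff[OF v(1)] l2_norm_nonneg[of v] by linarith
  qed
  from det_non_zero_imp_unit[OF M this, of "()"]
  obtain G where G: "G \<in> carrier_mat n n" "G * ?M = 1\<^sub>m n" "?M * G = 1\<^sub>m n"
    unfolding Units_def ring_mat_def by auto
  have "op_bounded G (1 / (\<bar>Im z\<bar> - c))"
    unfolding op_bounded_def
  proof
    fix v :: "complex Matrix.vec" assume "v \<in> carrier_vec (dim_col G)"
    then have v: "v \<in> carrier_vec n" using G by auto
    have Gv: "G *\<^sub>v v \<in> carrier_vec n" using G v by auto
    have "?M *\<^sub>v (G *\<^sub>v v) = v"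
      using G M v assoc_mult_mat_vec[OF M G(1) v] by simp
    then have "(\<bar>Im z\<bar> - c) * l2_norm (G *\<^sub>v v) \<le> l2_norm v"
      using im_bounded_coercive[OF A C Gv, of z] by simp
    then show "l2_norm (G *\<^sub>v v) \<le> 1 / (\<bar>Im z\<bar> - c) * l2_norm v"
      using z by (simp add: field_simps)
  qed
  then show ?thesis using that G by blast
qed

lemma upper_triangular_inverse_diag:
  fixes B H :: "complex mat"
  assumes B: "B \<in> carrier_mat n n" "upper_triangular B" and H: "H \<in> carrier_mat n n"
    and BH: "B * H = 1\<^sub>m n" and k: "k < n"
  shows "H $$ (k, k) = 1 / B $$ (k, k)"
proof -
  have "det B * det H = 1" using det_mult[OF B(1) H] BH by simp
  then have "det B \<noteq> 0" by auto
  then have nz: "B $$ (i, i) \<noteq> 0" if "i < n" for i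
    using det_upper_triangular[OF B(2,1)] that B(1) by (auto simp: prod_list_zero_iff diag_mat_def)
  have entry: "(\<Sum>k<n. B $$ (i, k) * H $$ (k, j)) = (if i = j then 1 else 0)" if "i < n" "j < n" for i j
    using mult_mat_index_sum[OF B(1) H that] BH that by simp
  \<comment> \<open>The induction climbs from the last row: row \<open>i\<close> of \<open>B\<close>
    meets only rows of \<open>H\<close> from \<open>i\<close> on, and those beyond \<open>i\<close>
    already vanish in column \<open>j\<close>.\<close>
  have low: "j < i \<Longrightarrow> i < n \<Longrightarrow> H $$ (i, j) = 0" for i j
  proof (induction "n - i" arbitrary: i rule: less_induct)
    case less
    have "(\<Sum>k<n. B $$ (i, k) * H $$ (k, j)) = (\<Sum>k<n. if k = i then B $$ (i, i) * H $$ (i, j) else 0)"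
    proof (rule sum.cong)
      fix k assume "k \<in> {..<n}"
      then show "B $$ (i, k) * H $$ (k, j) = (if k = i then B $$ (i, i) * H $$ (i, j) else 0)"
        using less.hyps[of k] less.prems upper_triangularD[OF B(2), of k i] B(1)
        by (cases k i rule: linorder_cases) auto
    qed simp
    then have "B $$ (i, i) * H $$ (i, j) = 0" using entry[of i j] less.prems by simp
    then show ?case using nz less.prems by simp
  qed
  have "(\<Sum>l<n. B $$ (k, l) * H $$ (l, k)) = (\<Sum>l<n. if l = k then B $$ (k, k) * H $$ (k, k) else 0)"
  proof (rule sum.cong)
    fix l assume "l \<in> {..<n}"
    then show "B $$ (k, l) * H $$ (l, k) = (if l = k then B $$ (k, k) * H $$ (k, k) else 0)"
      using low[of k l] k upper_triangularD[OF B(2), of l k] B(1)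
      by (cases l k rule: linorder_cases) auto
  qed simp
  then show ?thesis using entry[OF k k] k nz[OF k] by (simp add: field_simps)
qed

section \<open>Conjugation by a unitary matrix and the trace of a resolvent\<close>

lemma unitary_right_inverse:
  fixes U :: "complex mat"
  assumes U: "U \<in> carrier_mat n n" and UU: "mat_adjoint U * U = 1\<^sub>m n"
  shows "U * mat_adjoint U = 1\<^sub>m n"
  by (rule mat_mult_left_right_inverse[OF mat_adjoint_carrier[OF U] U UU])

lemma mat_mult_regroup:
  fixes A :: "'a::semiring_1 mat"
  assumes "V \<in> carrier_mat n n" "A \<in> carrier_mat n n" "U \<in> carrier_mat n n" "B \<in> carrier_mat n n"
    "W \<in> carrier_mat n n" "X \<in> carrier_mat n n"
  shows "(V * A * U) * (W * B * X) = V * (A * (U * W) * B) * X"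
  using assms by (simp add: assoc_mult_mat[of _ n n _ n _ n])

lemma unitary_conj_mult:
  fixes U :: "complex mat"
  assumes U: "U \<in> carrier_mat n n" and UU: "mat_adjoint U * U = 1\<^sub>m n"
    and A: "A \<in> carrier_mat n n" and B: "B \<in> carrier_mat n n"
  shows "(mat_adjoint U * A * U) * (mat_adjoint U * B * U) = mat_adjoint U * (A * B) * U"
proof -
  let ?V = "mat_adjoint U"
  have V: "?V \<in> carrier_mat n n" by (rule mat_adjoint_carrier[OF U])
  have "(?V * A * U) * (?V * B * U) = ?V * (A * (U * ?V) * B) * U"
    by (rule mat_mult_regroup[OF V A U B V U])
  also have "\<dots> = ?V * (A * B) * U"
    unfolding unitary_right_inverse[OF U UU] using A B by simp
  finally show ?thesis .
qed

lemma mtrace_unitary_conj: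
  fixes U :: "complex mat"
  assumes U: "U \<in> carrier_mat n n" and UU: "mat_adjoint U * U = 1\<^sub>m n" and A: "A \<in> carrier_mat n n"
  shows "mtrace (mat_adjoint U * A * U) = mtrace A"
proof -
  let ?V = "mat_adjoint U"
  have V: "?V \<in> carrier_mat n n" by (rule mat_adjoint_carrier[OF U])
  have "mtrace (?V * A * U) = mtrace (U * (?V * A))"
    using U V A by (intro mtrace_mult_comm[of _ n n]) auto
  also have "U * (?V * A) = A"
    using unitary_right_inverse[OF U UU] U V A assoc_mult_mat[OF U V A] by simp
  finally show ?thesis .
qed

text \<open>In Schur form the shifted matrix is triangular with diagonal \<open>x - z\<close>, so
  its inverse has the reciprocals on the diagonal; conjugation leaves the trace unchanged.\<close>

lemma mtrace_resolvent:
  assumes A: "A \<in> carrier_mat n n" and G: "G \<in> carrier_mat n n"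
    and AG: "(A - z \<cdot>\<^sub>m 1\<^sub>m n) * G = 1\<^sub>m n"
  shows "mtrace G = (\<Sum>x\<in>#eigenvalues A. 1 / (x - z))"
proof -
  obtain U where U: "U \<in> carrier_mat n n" "mat_adjoint U * U = 1\<^sub>m n"
    "upper_triangular (mat_adjoint U * A * U)"
    "eigenvalues A = image_mset (\<lambda>k. (mat_adjoint U * A * U) $$ (k, k)) (mset_set {..<n})"
    using unitary_schur[OF A] by blast
  let ?V = "mat_adjoint U"
  have V: "?V \<in> carrier_mat n n" by (rule mat_adjoint_carrier[OF U(1)])
  let ?B = "?V * A * U" let ?H = "?V * G * U" let ?C = "?V * (A - z \<cdot>\<^sub>m 1\<^sub>m n) * U"
  have B: "?B \<in> carrier_mat n n" using A V U(1) by (metis mult_carrier_mat)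
  have H: "?H \<in> carrier_mat n n" using G V U(1) by (metis mult_carrier_mat)
  have M: "A - z \<cdot>\<^sub>m 1\<^sub>m n \<in> carrier_mat n n" using A by auto
  have C: "?C = ?B - z \<cdot>\<^sub>m 1\<^sub>m n"
  proof -
    have "?V * (A - z \<cdot>\<^sub>m 1\<^sub>m n) = ?V * A - z \<cdot>\<^sub>m ?V"
      using V A mult_smult_distrib[OF V one_carrier_mat, of z] by (subst mult_minus_distrib_mat[of _ n n]) auto
    moreover have "(?V * A - z \<cdot>\<^sub>m ?V) * U = ?V * A * U - (z \<cdot>\<^sub>m ?V) * U"
      using V A U(1) by (intro minus_mult_distrib_mat[of _ n n]) auto
    moreover have "(z \<cdot>\<^sub>m ?V) * U = z \<cdot>\<^sub>m (?V * U)"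
      by (rule mult_smult_assoc_mat[OF V U(1)])
    ultimately show ?thesis using U(2) by simp
  qed
  have C': "?C \<in> carrier_mat n n" unfolding C using B by auto
  have "?C * ?H = ?V * 1\<^sub>m n * U"
    using unitary_conj_mult[OF U(1,2) M G] AG by simp
  also have "\<dots> = 1\<^sub>m n" using V U by simp
  finally have CH: "?C * ?H = 1\<^sub>m n" .
  have upC: "upper_triangular ?C"
    unfolding C using U(3) B by (auto simp: upper_triangular_def)
  have "mtrace G = mtrace ?H" using mtrace_unitary_conj[OF U(1,2) G] by simp
  also have "\<dots> = (\<Sum>k<n. 1 / ?C $$ (k, k))"
    using upper_triangular_inverse_diag[OF C' upC H CH] H unfolding mtrace_def by auto
  also have "\<dots> = (\<Sum>k<n. 1 / (?B $$ (k, k) - z))"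
    using B unfolding C by (intro sum.cong) auto
  finally show ?thesis by (simp only: U(4) image_mset.compositionality comp_def flip: sum_unfold_sum_mset)
qed

section \<open>Eigenvalues, traces and powers\<close>

lemma eigenvalues_unitary_conj:
  fixes U :: "complex mat"
  assumes U: "U \<in> carrier_mat n n" and UU: "mat_adjoint U * U = 1\<^sub>m n" and A: "A \<in> carrier_mat n n"
  shows "eigenvalues (mat_adjoint U * A * U) = eigenvalues A"
proof -
  let ?V = "mat_adjoint U"
  have V: "?V \<in> carrier_mat n n" by (rule mat_adjoint_carrier[OF U])
  have "similar_mat_wit (?V * A * U) A ?V U"
    using U V A UU unitary_right_inverse[OF U UU] by (intro similar_mat_witI) auto
  then have "similar_mat (?V * A * U) A" unfolding similar_mat_def by blast
  then show ?thesis by (simp add: eigenvalues_def char_poly_similar)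
qed

lemma mtrace_eigenvalues:
  assumes A: "A \<in> carrier_mat n n"
  shows "mtrace A = (\<Sum>x\<in>#eigenvalues A. x)"
proof -
  obtain U where U: "U \<in> carrier_mat n n" "mat_adjoint U * U = 1\<^sub>m n"
    "upper_triangular (mat_adjoint U * A * U)"
    "eigenvalues A = image_mset (\<lambda>k. (mat_adjoint U * A * U) $$ (k, k)) (mset_set {..<n})"
    using unitary_schur[OF A] by blast
  have "dim_row (mat_adjoint U * A * U) = n" using U(1) by simp
  then have "mtrace (mat_adjoint U * A * U) = (\<Sum>x\<in>#eigenvalues A. x)"
    unfolding mtrace_def by (simp only: U(4) image_mset.compositionality comp_def id_def flip: sum_unfold_sum_mset)
  then show ?thesis using mtrace_unitary_conj[OF U(1,2) A] by simp
qed

lemma eigenvalues_power: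
  assumes A: "A \<in> carrier_mat n n"
  shows "eigenvalues (A ^\<^sub>m p) = image_mset (\<lambda>x. x ^ p) (eigenvalues A)"
proof -
  obtain U where U: "U \<in> carrier_mat n n" "mat_adjoint U * U = 1\<^sub>m n"
    "upper_triangular (mat_adjoint U * A * U)"
    "eigenvalues A = image_mset (\<lambda>k. (mat_adjoint U * A * U) $$ (k, k)) (mset_set {..<n})"
    using unitary_schur[OF A] by blast
  let ?V = "mat_adjoint U" let ?B = "?V * A * U"
  have V: "?V \<in> carrier_mat n n" by (rule mat_adjoint_carrier[OF U(1)])
  have B: "?B \<in> carrier_mat n n" using A V U(1) by (metis mult_carrier_mat)
  have "(?V * (A ^\<^sub>m p) * U) \<in> carrier_mat n n \<and> upper_triangular (?V * (A ^\<^sub>m p) * U) \<and>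
      (\<forall>k<n. (?V * (A ^\<^sub>m p) * U) $$ (k, k) = (?B $$ (k, k)) ^ p)"
  proof (induction p)
    case 0
    have "?V * (A ^\<^sub>m 0) * U = 1\<^sub>m n" using A U V by simp
    then show ?case by simp
  next
    case (Suc p)
    let ?C = "?V * (A ^\<^sub>m p) * U"
    from Suc have C: "?C \<in> carrier_mat n n" "upper_triangular ?C"
      "\<And>k. k < n \<Longrightarrow> ?C $$ (k, k) = (?B $$ (k, k)) ^ p" by auto
    have eq: "?V * (A ^\<^sub>m Suc p) * U = ?C * ?B"
      using unitary_conj_mult[OF U(1,2) pow_carrier_mat[OF A] A] by simp
    have entry: "(?C * ?B) $$ (i, j) = (if i = j then (?B $$ (i, i)) ^ Suc p else 0)" if "j \<le> i" "i < n" for i j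
    proof -
      have "(?C * ?B) $$ (i, j) = (\<Sum>k<n. ?C $$ (i, k) * ?B $$ (k, j))"
        using that by (intro mult_mat_index_sum[OF C(1) B]) auto
      also have "\<dots> = (\<Sum>k<n. if k = i then (if i = j then (?B $$ (i, i)) ^ Suc p else 0) else 0)"
      proof (rule sum.cong)
        fix k assume "k \<in> {..<n}"
        then show "?C $$ (i, k) * ?B $$ (k, j) = (if k = i then (if i = j then (?B $$ (i, i)) ^ Suc p else 0) else 0)"
          using that upper_triangularD[OF C(2), of k i] upper_triangularD[OF U(3), of j k]
            upper_triangularD[OF U(3), of j i] B C
          by (cases k i rule: linorder_cases) (auto simp: mult.commute simp del: index_mult_mat)
      qed simp
      finally show ?thesis using that by simp
    qed
    have carr: "?C * ?B \<in> carrier_mat n n" using B C(1) by (rule mult_carrier_mat[rotated])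
    show ?case unfolding eq
      using carr entry by (auto simp: upper_triangular_def simp del: index_mult_mat)
  qed
  note C = this
  have "eigenvalues (A ^\<^sub>m p) = eigenvalues (?V * (A ^\<^sub>m p) * U)"
    using eigenvalues_unitary_conj[OF U(1,2) pow_carrier_mat[OF A]] by simp
  also have "\<dots> = image_mset (\<lambda>k. (?B $$ (k, k)) ^ p) (mset_set {..<n})"
    using C by (subst eigenvalues_upper_triangular[of _ n]) (auto intro!: image_mset_cong simp del: index_mult_mat)
  finally show ?thesis by (simp only: U(4) image_mset.compositionality comp_def)
qed

lemma eigenvalues_mult_self:
  assumes A: "A \<in> carrier_mat n n"
  shows "eigenvalues (A * A) = image_mset (\<lambda>x. x\<^sup>2) (eigenvalues A)"
  using eigenvalues_power[OF A, of 2] A by (simp add: numeral_2_eq_2)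

section \<open>Perturbation of resolvent traces\<close>

lemma mat_adjoint_adjoint [simp]: "mat_adjoint (mat_adjoint A) = (A :: complex mat)"
  by (rule eq_matI) auto

lemma mat_l1_minus_commute:
  assumes "A \<in> carrier_mat n n" "B \<in> carrier_mat n n"
  shows "mat_l1 (A - B) = mat_l1 (B - A)"
  using assms by (auto simp: mat_l1_def norm_minus_commute intro!: sum.cong)

lemma mat_l1_adjoint:
  assumes "A \<in> carrier_mat n n"
  shows "mat_l1 (mat_adjoint A) = mat_l1 A"
proof -
  have "mat_l1 (mat_adjoint A) = (\<Sum>i<n. \<Sum>j<n. cmod (A $$ (j, i)))"
    using assms by (simp add: mat_l1_def)
  also have "\<dots> = mat_l1 A"
    using assms by (subst sum.swap) (simp add: mat_l1_def)
  finally show ?thesis .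
qed

lemma inverse_diff:
  fixes M N :: "complex mat"
  assumes M: "M \<in> carrier_mat n n" and N: "N \<in> carrier_mat n n"
    and G: "G \<in> carrier_mat n n" and H: "H \<in> carrier_mat n n"
    and GM: "G * M = 1\<^sub>m n" and NH: "N * H = 1\<^sub>m n"
  shows "G - H = G * (N - M) * H"
proof -
  have "G * (N - M) * H = (G * N - G * M) * H"
    using assms by (simp add: mult_minus_distrib_mat[of _ n n])
  also have "\<dots> = G * N * H - G * M * H"
    using assms by (intro minus_mult_distrib_mat[of _ n n]) auto
  also have "G * N * H = G" using assms by (simp add: assoc_mult_mat[of _ n n _ n _ n])
  also have "G * M * H = H" using assms by simp
  finally show ?thesis by simp
qed

lemma shift_diff:
  fixes A X :: "complex mat"
  assumes "A \<in> carrier_mat n n" "X \<in> carrier_mat n n"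
  shows "(X - z \<cdot>\<^sub>m 1\<^sub>m n) - (A - z \<cdot>\<^sub>m 1\<^sub>m n) = X - A"
  using assms by (intro eq_matI) auto

text \<open>Cyclicity of the trace brings the two resolvents together:
  \<open>tr (G (X - A) H) = tr ((X - A) (H G))\<close>. The product \<open>H * G\<close> is bounded
  by the square of the resolvent bound, and the duality of \<open>mat_l1\<close> with the largest
  entry does the rest.\<close>

theorem resolvent_trace_perturbation:
  assumes A: "A \<in> carrier_mat n n" and X: "X \<in> carrier_mat n n"
    and imA: "im_bounded A c" and imX: "im_bounded X c" and z: "c < \<bar>Im z\<bar>"
  shows "cmod ((\<Sum>x\<in>#eigenvalues A. 1 / (x - z)) - (\<Sum>x\<in>#eigenvalues X. 1 / (x - z)))
    \<le> mat_l1 (A - X) / (\<bar>Im z\<bar> - c)\<^sup>2"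
proof -
  let ?r = "1 / (\<bar>Im z\<bar> - c)"
  obtain G where G: "G \<in> carrier_mat n n" "(A - z \<cdot>\<^sub>m 1\<^sub>m n) * G = 1\<^sub>m n"
    "G * (A - z \<cdot>\<^sub>m 1\<^sub>m n) = 1\<^sub>m n" "op_bounded G ?r"
    using resolvent_exists[OF A imA z] by blast
  obtain H where H: "H \<in> carrier_mat n n" "(X - z \<cdot>\<^sub>m 1\<^sub>m n) * H = 1\<^sub>m n"
    "op_bounded H ?r"
    using resolvent_exists[OF X imX z] by blast
  have sh: "A - z \<cdot>\<^sub>m 1\<^sub>m n \<in> carrier_mat n n" "X - z \<cdot>\<^sub>m 1\<^sub>m n \<in> carrier_mat n n" using A X by auto
  have XA: "X - A \<in> carrier_mat n n" using A X by auto
  have "G - H = G * (X - A) * H"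
    using inverse_diff[OF sh G(1) H(1) G(3) H(2)] A X by (simp add: shift_diff)
  then have "mtrace G - mtrace H = mtrace (G * ((X - A) * H))"
    using mtrace_minus[OF G(1) H(1)] G(1) H(1) XA by simp
  also have "\<dots> = mtrace ((X - A) * H * G)"
    using G(1) H(1) XA by (intro mtrace_mult_comm[of _ n n]) auto
  also have "\<dots> = mtrace ((X - A) * (H * G))"
    using G(1) H(1) XA by simp
  finally have "cmod (mtrace G - mtrace H) \<le> mat_l1 (X - A) * (?r * ?r)"
    using cmod_mtrace_mult_le[OF XA _ op_bounded_mult[OF H(1) G(1) H(3) G(4)]] G(1) H(1) z by simp
  then show ?thesis
    using mtrace_resolvent[OF A G(1,2)] mtrace_resolvent[OF X H(1,2)] mat_l1_minus_commute[OF A X]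
    by (simp add: power2_eq_square)
qed

lemma adjoint_mult_self_cscalar:
  fixes A :: "complex mat"
  assumes A: "A \<in> carrier_mat n n" and v: "v \<in> carrier_vec n"
  shows "((mat_adjoint A * A) *\<^sub>v v) \<bullet>c v = of_real ((l2_norm (A *\<^sub>v v))\<^sup>2)"
proof -
  have Av: "A *\<^sub>v v \<in> carrier_vec n" using A v by auto
  have aA: "mat_adjoint A \<in> carrier_mat n n" by (rule mat_adjoint_carrier[OF A])
  have "((mat_adjoint A * A) *\<^sub>v v) \<bullet>c v = (mat_adjoint A *\<^sub>v (A *\<^sub>v v)) \<bullet>c v"
    using assoc_mult_mat_vec[OF aA A v] by simp
  also have "\<dots> = (A *\<^sub>v v) \<bullet>c (A *\<^sub>v v)"
    using cscalar_prod_adjoint[OF aA Av v] by simp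
  also have "\<dots> = of_real ((l2_norm (A *\<^sub>v v))\<^sup>2)" by (rule cscalar_prod_self[OF Av])
  finally show ?thesis .
qed

lemma im_bounded_adjoint_mult_self:
  assumes A: "A \<in> carrier_mat n n"
  shows "im_bounded (mat_adjoint A * A) 0"
  unfolding im_bounded_def
proof
  fix v :: "complex Matrix.vec" assume "v \<in> carrier_vec (dim_col (mat_adjoint A * A))"
  then have v: "v \<in> carrier_vec n" using A by simp
  show "\<bar>Im (((mat_adjoint A * A) *\<^sub>v v) \<bullet>c v)\<bar> \<le> 0 * (l2_norm v)\<^sup>2"
    by (simp only: adjoint_mult_self_cscalar[OF A v] Im_complex_of_real)
qed

text \<open>The bound is independent of the size of \<open>A\<close>. With \<open>u = G v\<close>,
  pairing the resolvent equation with \<open>u\<close> gives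
  \<open>|A u|^2 = <v, u> + w |u|^2\<close>, and \<open>|u| \<le> |v| / |Im w|\<close> bounds both
  terms; the constant is the square root of the resulting coefficient.\<close>

lemma op_bounded_mult_resolvent:
  assumes A: "A \<in> carrier_mat n n" and w: "Im w \<noteq> 0" and G: "G \<in> carrier_mat n n"
    and AG: "(mat_adjoint A * A - w \<cdot>\<^sub>m 1\<^sub>m n) * G = 1\<^sub>m n" and Gb: "op_bounded G (1 / \<bar>Im w\<bar>)"
  shows "op_bounded (A * G) (sqrt (1 / \<bar>Im w\<bar> + cmod w / (Im w)\<^sup>2))"
  unfolding op_bounded_def
proof
  fix v :: "complex Matrix.vec" assume "v \<in> carrier_vec (dim_col (A * G))"
  then have v: "v \<in> carrier_vec n" using G by auto
  define u where "u = G *\<^sub>v v"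
  have u: "u \<in> carrier_vec n" using G v by (auto simp: u_def)
  have aA: "mat_adjoint A \<in> carrier_mat n n" by (rule mat_adjoint_carrier[OF A])
  have AA: "mat_adjoint A * A \<in> carrier_mat n n" using aA A by auto
  have M: "mat_adjoint A * A - w \<cdot>\<^sub>m 1\<^sub>m n \<in> carrier_mat n n" by auto
  have ub: "l2_norm u \<le> l2_norm v / \<bar>Im w\<bar>" using op_boundedD[OF Gb G v] by (simp add: u_def)
  have "v = (mat_adjoint A * A - w \<cdot>\<^sub>m 1\<^sub>m n) *\<^sub>v u"
    unfolding u_def using assoc_mult_mat_vec[OF M G v] AG v by simp
  also have "\<dots> = (mat_adjoint A * A) *\<^sub>v u - w \<cdot>\<^sub>v u" by (rule shift_mult_vec[OF AA u])
  finally have "v \<bullet>c u = ((mat_adjoint A * A) *\<^sub>v u) \<bullet>c u - w * of_real ((l2_norm u)\<^sup>2)"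
    by (simp only: cscalar_prod_minus_smult[OF mult_mat_vec_carrier[OF AA u] u])
  then have "of_real ((l2_norm (A *\<^sub>v u))\<^sup>2) = v \<bullet>c u + w * of_real ((l2_norm u)\<^sup>2)"
    using adjoint_mult_self_cscalar[OF A u] by (simp del: of_real_power)
  then have "(l2_norm (A *\<^sub>v u))\<^sup>2 = cmod (v \<bullet>c u + w * of_real ((l2_norm u)\<^sup>2))"
    by (metis norm_of_real abs_of_nonneg zero_le_power2)
  also have "\<dots> \<le> l2_norm v * l2_norm u + cmod w * (l2_norm u)\<^sup>2"
    by (intro order_trans[OF norm_triangle_ineq] add_mono cmod_cscalar_prod_le[OF v u])
      (simp add: norm_mult del: of_real_power)
  also have "\<dots> \<le> l2_norm v * (l2_norm v / \<bar>Im w\<bar>) + cmod w * (l2_norm v / \<bar>Im w\<bar>)\<^sup>2"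
    by (intro add_mono mult_left_mono power_mono ub) auto
  also have "\<dots> = (1 / \<bar>Im w\<bar> + cmod w / (Im w)\<^sup>2) * (l2_norm v)\<^sup>2"
    by (simp add: power2_eq_square field_simps)
  finally have "sqrt ((l2_norm (A *\<^sub>v u))\<^sup>2) \<le> sqrt ((1 / \<bar>Im w\<bar> + cmod w / (Im w)\<^sup>2) * (l2_norm v)\<^sup>2)"
    by (rule real_sqrt_le_mono)
  moreover have "(A * G) *\<^sub>v v = A *\<^sub>v u" using assoc_mult_mat_vec[OF A G v] by (simp add: u_def)
  ultimately show "l2_norm ((A * G) *\<^sub>v v) \<le> sqrt (1 / \<bar>Im w\<bar> + cmod w / (Im w)\<^sup>2) * l2_norm v"
    by (simp add: real_sqrt_mult)
qed

text \<open>With \<open>E = A - X\<close> and \<open>F\<close> its adjoint, the Gram matrices differ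
  by \<open>F A + X E\<close>. After a cyclic permutation \<open>A\<close> stands next to its
  resolvent \<open>G\<close> and \<open>X\<close> next to its resolvent \<open>H\<close>, so the
  sizes of \<open>A\<close> and \<open>X\<close> never enter. The two terms give the factor 2, and
  hermiticity turns the Gram matrix of \<open>X\<close> into its square.\<close>

theorem singular_resolvent_trace_perturbation:
  assumes A: "A \<in> carrier_mat n n" and X: "X \<in> carrier_mat n n"
    and herm: "mat_adjoint X = X" and w: "Im w \<noteq> 0"
  shows "cmod ((\<Sum>x\<in>#eigenvalues (mat_adjoint A * A). 1 / (x - w)) - (\<Sum>x\<in>#eigenvalues X. 1 / (x\<^sup>2 - w)))
    \<le> mat_l1 (A - X) * (2 * sqrt (1 / \<bar>Im w\<bar> + cmod w / (Im w)\<^sup>2) / \<bar>Im w\<bar>)"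
proof -
  let ?r = "1 / \<bar>Im w\<bar>" let ?b = "sqrt (1 / \<bar>Im w\<bar> + cmod w / (Im w)\<^sup>2)"
  define P where "P = mat_adjoint A * A"
  define Y where "Y = X * X"
  have aA: "mat_adjoint A \<in> carrier_mat n n" by (rule mat_adjoint_carrier[OF A])
  have P: "P \<in> carrier_mat n n" using aA A by (auto simp: P_def)
  have Y: "Y \<in> carrier_mat n n" using X by (auto simp: Y_def)
  have imP: "im_bounded P 0" unfolding P_def by (rule im_bounded_adjoint_mult_self[OF A])
  have imY: "im_bounded Y 0" using im_bounded_adjoint_mult_self[OF X] by (simp add: herm Y_def)
  have w0: "0 < \<bar>Im w\<bar>" using w by simp
  obtain G where G: "G \<in> carrier_mat n n" "(P - w \<cdot>\<^sub>m 1\<^sub>m n) * G = 1\<^sub>m n"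
    "op_bounded G ?r"
    using resolvent_exists[OF P imP w0] by auto
  obtain H where H: "H \<in> carrier_mat n n" "(Y - w \<cdot>\<^sub>m 1\<^sub>m n) * H = 1\<^sub>m n"
    "H * (Y - w \<cdot>\<^sub>m 1\<^sub>m n) = 1\<^sub>m n" "op_bounded H ?r"
    using resolvent_exists[OF Y imY w0] by auto
  have AGb: "op_bounded (A * G) ?b"
    using op_bounded_mult_resolvent[OF A w G(1)] G by (simp add: P_def)
  have XHb: "op_bounded (X * H) ?b"
    using op_bounded_mult_resolvent[OF X w H(1)] H by (simp add: Y_def herm)
  have shY: "Y - w \<cdot>\<^sub>m 1\<^sub>m n \<in> carrier_mat n n" using Y by auto
  \<comment> \<open>The second term produces \<open>H * X\<close>, whereas the bound is known for
    \<open>X * H\<close>. The inverse of a polynomial in \<open>X\<close> commutes with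
    \<open>X\<close>.\<close>
  have comm: "H * X = X * H"
  proof -
    have "(Y - w \<cdot>\<^sub>m 1\<^sub>m n) * X = Y * X - (w \<cdot>\<^sub>m 1\<^sub>m n) * X"
      using X Y by (intro minus_mult_distrib_mat[of _ n n]) auto
    also have "Y * X = X * Y" using X by (simp add: Y_def)
    also have "(w \<cdot>\<^sub>m 1\<^sub>m n) * X = X * (w \<cdot>\<^sub>m 1\<^sub>m n)"
      using mult_smult_distrib[OF X one_carrier_mat, of w] mult_smult_assoc_mat[OF one_carrier_mat X, of w] X by simp
    also have "X * Y - X * (w \<cdot>\<^sub>m 1\<^sub>m n) = X * (Y - w \<cdot>\<^sub>m 1\<^sub>m n)"
      using X Y by (intro mult_minus_distrib_mat[of _ n n, symmetric]) auto
    finally have YX: "(Y - w \<cdot>\<^sub>m 1\<^sub>m n) * X = X * (Y - w \<cdot>\<^sub>m 1\<^sub>m n)" .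
    have "H * X = H * X * ((Y - w \<cdot>\<^sub>m 1\<^sub>m n) * H)" using H X by simp
    also have "\<dots> = H * (X * (Y - w \<cdot>\<^sub>m 1\<^sub>m n)) * H"
      using H X shY by (simp add: assoc_mult_mat[of _ n n _ n _ n])
    also have "\<dots> = (H * (Y - w \<cdot>\<^sub>m 1\<^sub>m n)) * (X * H)"
      unfolding YX[symmetric] using H(1) X shY by (simp add: assoc_mult_mat[of _ n n _ n _ n])
    also have "\<dots> = X * H" using H X by simp
    finally show ?thesis .
  qed
  define E where "E = A - X"
  define F where "F = mat_adjoint E"
  have E: "E \<in> carrier_mat n n" using minus_carrier_mat[OF X, of A] by (simp add: E_def)
  have F: "F \<in> carrier_mat n n" unfolding F_def by (rule mat_adjoint_carrier[OF E])
  have PY: "P - Y = F * A + X * E"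
  proof -
    have "F = mat_adjoint A - mat_adjoint X"
      unfolding E_def F_def using A X by (intro eq_matI) auto
    then have "F = mat_adjoint A - X" by (simp add: herm)
    then have "F * A = P - X * A"
      using A X aA by (simp add: minus_mult_distrib_mat[of _ n n] P_def)
    moreover have "X * E = X * A - Y"
      using A X by (simp add: E_def mult_minus_distrib_mat[of _ n n] Y_def)
    ultimately show ?thesis
      using P Y A X by (intro eq_matI) auto
  qed
  have shP: "P - w \<cdot>\<^sub>m 1\<^sub>m n \<in> carrier_mat n n" using P by auto
  have AG: "A * G \<in> carrier_mat n n" and XH: "X * H \<in> carrier_mat n n" using A G X H by auto
  have EAG: "F * (A * G) \<in> carrier_mat n n" using F AG by auto
  have EG: "E * G \<in> carrier_mat n n" using E G by auto
  have "H - G = H * (F * A + X * E) * G"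
    using inverse_diff[OF shY shP H(1) G(1) H(3) G(2)] P Y by (simp add: shift_diff PY)
  also have "\<dots> = H * (F * (A * G)) + (H * X) * (E * G)"
  proof -
    have FA: "F * A \<in> carrier_mat n n" and XE: "X * E \<in> carrier_mat n n" using F A X E by auto
    have "H * (F * A + X * E) * G = (H * (F * A) + H * (X * E)) * G"
      by (simp only: mult_add_distrib_mat[OF H(1) FA XE])
    also have "\<dots> = H * (F * A) * G + H * (X * E) * G"
      by (rule add_mult_distrib_mat[OF mult_carrier_mat[OF H(1) FA] mult_carrier_mat[OF H(1) XE] G(1)])
    also have "\<dots> = H * (F * (A * G)) + (H * X) * (E * G)"
      using H(1) G(1) X A E F by (simp add: assoc_mult_mat[of _ n n _ n _ n])
    finally show ?thesis .
  qed
  finally have HG: "H - G = H * (F * (A * G)) + (X * H) * (E * G)" by (simp add: comm)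
  have "mtrace H - mtrace G = mtrace (H * (F * (A * G))) + mtrace ((X * H) * (E * G))"
    using mtrace_minus[OF H(1) G(1)] unfolding HG
    using mtrace_add[OF mult_carrier_mat[OF H(1) EAG] mult_carrier_mat[OF XH EG]] by simp
  also have "mtrace (H * (F * (A * G))) = mtrace (F * ((A * G) * H))"
    using mtrace_mult_comm[OF H(1) EAG] assoc_mult_mat[OF F AG H(1)] by simp
  also have "mtrace ((X * H) * (E * G)) = mtrace (E * (G * (X * H)))"
    using mtrace_mult_comm[OF XH EG] assoc_mult_mat[OF E G(1) XH] by simp
  finally have "cmod (mtrace H - mtrace G) \<le>
      cmod (mtrace (F * ((A * G) * H))) + cmod (mtrace (E * (G * (X * H))))"
    by (simp only: norm_triangle_ineq)
  also have "\<dots> \<le> mat_l1 F * (?b * ?r) + mat_l1 E * (?r * ?b)"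
  proof (rule add_mono)
    show "cmod (mtrace (F * ((A * G) * H))) \<le> mat_l1 F * (?b * ?r)"
      by (rule cmod_mtrace_mult_le[OF F mult_carrier_mat[OF AG H(1)]
            op_bounded_mult[OF AG H(1) AGb H(4)]]) simp
    show "cmod (mtrace (E * (G * (X * H)))) \<le> mat_l1 E * (?r * ?b)"
      by (rule cmod_mtrace_mult_le[OF E mult_carrier_mat[OF G(1) XH]
            op_bounded_mult[OF G(1) XH G(3) XHb]]) simp
  qed
  also have "\<dots> = mat_l1 E * (2 * ?b / \<bar>Im w\<bar>)"
    using mat_l1_adjoint[OF E] by (simp add: F_def)
  finally have "cmod (mtrace G - mtrace H) \<le> mat_l1 (A - X) * (2 * ?b / \<bar>Im w\<bar>)"
    by (simp add: norm_minus_commute E_def)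
  moreover have "mtrace G = (\<Sum>x\<in>#eigenvalues (mat_adjoint A * A). 1 / (x - w))"
    using mtrace_resolvent[OF P G(1,2)] by (simp add: P_def)
  moreover have "mtrace H = (\<Sum>x\<in>#eigenvalues X. 1 / (x\<^sup>2 - w))"
    using mtrace_resolvent[OF Y H(1,2)] eigenvalues_mult_self[OF X] by (simp add: Y_def image_mset.compositionality comp_def)
  ultimately show ?thesis by simp
qed

section \<open>Imaginary parts of eigenvalues\<close>

lemma quadratic_form_sum:
  fixes A :: "complex mat"
  assumes "A \<in> carrier_mat n n" "v \<in> carrier_vec n"
  shows "(A *\<^sub>v v) \<bullet>c v = (\<Sum>i<n. \<Sum>j<n. A $$ (i, j) * (v $ j * cnj (v $ i)))"
proof -
  have "(A *\<^sub>v v) \<bullet>c v = (\<Sum>i<n. (A *\<^sub>v v) $ i * cnj (v $ i))"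
    by (rule cscalar_prod_sum[OF assms(2)])
  also have "\<dots> = (\<Sum>i<n. (\<Sum>j<n. A $$ (i, j) * v $ j) * cnj (v $ i))"
    by (intro sum.cong refl) (simp add: mult_mat_vec_index_sum[OF assms] del: index_mult_mat_vec)
  finally show ?thesis by (simp add: sum_distrib_right mult.assoc)
qed

text \<open>For the value \<open>q\<close> of the form, \<open>q - cnj q\<close> is
  \<open>2 i Im q\<close> and at the same time the form of \<open>A\<close> minus its adjoint, so
  only the skew part contributes.\<close>

lemma im_quadratic_form_le:
  fixes A :: "complex mat"
  assumes A: "A \<in> carrier_mat n n" and v: "v \<in> carrier_vec n"
  shows "\<bar>Im ((A *\<^sub>v v) \<bullet>c v)\<bar>
    \<le> (\<Sum>i<n. \<Sum>j<n. cmod ((A - mat_adjoint A) $$ (i, j)) * (cmod (v $ i) * cmod (v $ j))) / 2"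
proof -
  let ?q = "(A *\<^sub>v v) \<bullet>c v"
  have "cnj ?q = (\<Sum>j<n. \<Sum>i<n. cnj (A $$ (j, i)) * (v $ j * cnj (v $ i)))"
    unfolding quadratic_form_sum[OF assms] by (simp add: mult_ac)
  also have "\<dots> = (\<Sum>i<n. \<Sum>j<n. cnj (A $$ (j, i)) * (v $ j * cnj (v $ i)))"
    by (rule sum.swap)
  finally have "?q - cnj ?q = (\<Sum>i<n. \<Sum>j<n. (A - mat_adjoint A) $$ (i, j) * (v $ j * cnj (v $ i)))"
    unfolding quadratic_form_sum[OF assms] using A
    by (simp add: sum_subtractf[symmetric] algebra_simps)
  then have "cmod (?q - cnj ?q) \<le>
      (\<Sum>i<n. \<Sum>j<n. cmod ((A - mat_adjoint A) $$ (i, j)) * (cmod (v $ i) * cmod (v $ j)))"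
    by (simp only:) (intro sum_norm_le, simp add: norm_mult mult_ac)
  moreover have "cmod (?q - cnj ?q) = 2 * \<bar>Im ?q\<bar>"
    by (simp add: complex_diff_cnj norm_mult)
  ultimately show ?thesis by simp
qed

lemma im_bounded_mat_l1:
  assumes A: "A \<in> carrier_mat n n"
  shows "im_bounded A (mat_l1 (A - mat_adjoint A) / 2)"
  unfolding im_bounded_def
proof
  fix v :: "complex Matrix.vec" assume "v \<in> carrier_vec (dim_col A)"
  then have v: "v \<in> carrier_vec n" using A by simp
  have "\<bar>Im ((A *\<^sub>v v) \<bullet>c v)\<bar>
    \<le> (\<Sum>i<n. \<Sum>j<n. cmod ((A - mat_adjoint A) $$ (i, j)) * (cmod (v $ i) * cmod (v $ j))) / 2"
    by (rule im_quadratic_form_le[OF A v])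
  also have "\<dots> \<le> (\<Sum>i<n. \<Sum>j<n. cmod ((A - mat_adjoint A) $$ (i, j)) * (l2_norm v * l2_norm v)) / 2"
    using cmod_index_le_l2_norm[OF v] by (intro divide_right_mono sum_mono mult_left_mono mult_mono) auto
  also have "\<dots> = mat_l1 (A - mat_adjoint A) / 2 * (l2_norm v)\<^sup>2"
    using A by (simp add: mat_l1_def sum_distrib_right power2_eq_square)
  finally show "\<bar>Im ((A *\<^sub>v v) \<bullet>c v)\<bar> \<le> mat_l1 (A - mat_adjoint A) / 2 * (l2_norm v)\<^sup>2" .
qed

text \<open>The diagonal of the Schur form consists of values of the quadratic form at the columns
  of the unitary matrix. That its rows are unit vectors is recorded too, for sums over
  \<open>k\<close> at a fixed coordinate.\<close>

lemma unitary_schur_columns: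
  fixes A :: "complex mat"
  assumes A: "A \<in> carrier_mat n n"
  shows "\<exists>u :: nat \<Rightarrow> complex Matrix.vec. (\<forall>k<n. u k \<in> carrier_vec n) \<and>
    (\<forall>k<n. l2_norm (u k) = 1) \<and> (\<forall>i<n. (\<Sum>k<n. (cmod (u k $ i))\<^sup>2) = 1) \<and>
    eigenvalues A = image_mset (\<lambda>k. (A *\<^sub>v u k) \<bullet>c u k) (mset_set {..<n})"
proof -
  obtain U where U: "U \<in> carrier_mat n n" "mat_adjoint U * U = 1\<^sub>m n"
    "eigenvalues A = image_mset (\<lambda>k. (mat_adjoint U * A * U) $$ (k, k)) (mset_set {..<n})"
    using unitary_schur[OF A] by blast
  let ?V = "mat_adjoint U"
  have V: "?V \<in> carrier_mat n n" by (rule mat_adjoint_carrier[OF U(1)])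
  have colU: "col U k \<in> carrier_vec n" if "k < n" for k using U(1) that by auto
  show ?thesis
  proof (intro exI[of _ "\<lambda>k. col U k"] conjI allI impI)
    show "col U k \<in> carrier_vec n" if "k < n" for k by (rule colU[OF that])
    show "l2_norm (col U k) = 1" if k: "k < n" for k
    proof -
      have "(?V * U) $$ (k, k) = (\<Sum>i<n. ?V $$ (k, i) * U $$ (i, k))"
        by (rule mult_mat_index_sum[OF V U(1) k k])
      also have "\<dots> = col U k \<bullet>c col U k"
        using U(1) k by (simp add: cscalar_prod_sum[OF colU[OF k]] mult.commute)
      finally have "of_real ((l2_norm (col U k))\<^sup>2) = (1 :: complex)"
        using k U(2) cscalar_prod_self[OF colU[OF k]] by simp
      then have "(l2_norm (col U k))\<^sup>2 = 1" by (simp only: of_real_eq_1_iff)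
      then show ?thesis using l2_norm_nonneg[of "col U k"] by (simp add: power2_eq_1_iff)
    qed
    show "(\<Sum>k<n. (cmod (col U k $ i))\<^sup>2) = 1" if i: "i < n" for i
    proof -
      have "(U * ?V) $$ (i, i) = (\<Sum>k<n. U $$ (i, k) * ?V $$ (k, i))"
        by (rule mult_mat_index_sum[OF U(1) V i i])
      also have "\<dots> = of_real (\<Sum>k<n. (cmod (col U k $ i))\<^sup>2)"
        using U(1) i by (simp add: complex_norm_square del: of_real_power)
      finally have "of_real (\<Sum>k<n. (cmod (col U k $ i))\<^sup>2) = (1 :: complex)"
        using unitary_right_inverse[OF U(1,2)] i by simp
      then show ?thesis by (simp only: of_real_eq_1_iff)
    qed
    have "(?V * A * U) $$ (k, k) = (A *\<^sub>v col U k) \<bullet>c col U k" if k: "k < n" for k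
    proof -
      have AU: "A * U \<in> carrier_mat n n" using A U(1) by simp
      have "(?V * A * U) $$ (k, k) = (?V * (A * U)) $$ (k, k)"
        by (simp only: assoc_mult_mat[OF V A U(1)])
      also have "\<dots> = (\<Sum>i<n. ?V $$ (k, i) * (A * U) $$ (i, k))"
        by (rule mult_mat_index_sum[OF V AU k k])
      also have "\<dots> = (A *\<^sub>v col U k) \<bullet>c col U k"
        unfolding cscalar_prod_sum[OF colU[OF k]]
        using U(1) A k by (intro sum.cong) (auto simp: mult.commute)
      finally show ?thesis .
    qed
    then show "eigenvalues A = image_mset (\<lambda>k. (A *\<^sub>v col U k) \<bullet>c col U k) (mset_set {..<n})"
      unfolding U(3) by (intro image_mset_cong) simp
  qed
qed

text \<open>Summed over all Schur columns, entry \<open>(i, j)\<close> of the skew part receives the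
  weight \<open>\<Sum>k. |u_k(i)| |u_k(j)|\<close>. By the inequality between geometric and
  arithmetic mean this is at most 1, because the rows of a unitary matrix are unit vectors. Hence no
  factor \<open>n\<close> appears.\<close>

theorem sum_abs_Im_eigenvalues_le:
  assumes A: "A \<in> carrier_mat n n"
  shows "(\<Sum>x\<in>#eigenvalues A. \<bar>Im x\<bar>) \<le> mat_l1 (A - mat_adjoint A) / 2"
proof -
  obtain u where u: "\<And>k. k < n \<Longrightarrow> u k \<in> carrier_vec n" and un: "\<And>k. k < n \<Longrightarrow> l2_norm (u k) = 1"
    and u1: "\<And>i. i < n \<Longrightarrow> (\<Sum>k<n. (cmod (u k $ i))\<^sup>2) = 1"
    and ev: "eigenvalues A = image_mset (\<lambda>k. (A *\<^sub>v u k) \<bullet>c u k) (mset_set {..<n})"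
    using unitary_schur_columns[OF A] by blast
  let ?D = "\<lambda>i j. cmod ((A - mat_adjoint A) $$ (i, j))"
  have le1: "(\<Sum>k<n. cmod (u k $ i) * cmod (u k $ j)) \<le> 1" if "i < n" "j < n" for i j
  proof -
    have "(\<Sum>k<n. cmod (u k $ i) * cmod (u k $ j)) \<le> (\<Sum>k<n. ((cmod (u k $ i))\<^sup>2 + (cmod (u k $ j))\<^sup>2) / 2)"
    proof (rule sum_mono)
      fix k
      show "cmod (u k $ i) * cmod (u k $ j) \<le> ((cmod (u k $ i))\<^sup>2 + (cmod (u k $ j))\<^sup>2) / 2"
        using sum_squares_bound[of "cmod (u k $ i)" "cmod (u k $ j)"] by simp
    qed
    also have "\<dots> = 1"
      using u1[OF that(1)] u1[OF that(2)] by (simp add: sum.distrib add_divide_distrib flip: sum_divide_distrib)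
    finally show ?thesis .
  qed
  have swap: "(\<Sum>k<n. \<Sum>i<n. \<Sum>j<n. f k i j) = (\<Sum>i<n. \<Sum>j<n. \<Sum>k<n. f k i j)"
    for f :: "nat \<Rightarrow> nat \<Rightarrow> nat \<Rightarrow> real"
    by (subst sum.swap) (intro sum.cong refl sum.swap)
  have "(\<Sum>x\<in>#eigenvalues A. \<bar>Im x\<bar>) = (\<Sum>k<n. \<bar>Im ((A *\<^sub>v u k) \<bullet>c u k)\<bar>)"
    by (simp only: ev image_mset.compositionality comp_def flip: sum_unfold_sum_mset)
  also have "\<dots> \<le> (\<Sum>k<n. (\<Sum>i<n. \<Sum>j<n. ?D i j * (cmod (u k $ i) * cmod (u k $ j))) / 2)"
    using u by (intro sum_mono im_quadratic_form_le[OF A]) auto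
  also have "\<dots> = (\<Sum>i<n. \<Sum>j<n. ?D i j * (\<Sum>k<n. cmod (u k $ i) * cmod (u k $ j))) / 2"
    unfolding sum_divide_distrib[symmetric] by (subst swap) (simp only: sum_distrib_left)
  also have "\<dots> \<le> (\<Sum>i<n. \<Sum>j<n. ?D i j * 1) / 2"
    using le1 by (intro divide_right_mono sum_mono mult_left_mono) auto
  also have "\<dots> = mat_l1 (A - mat_adjoint A) / 2" using A by (simp add: mat_l1_def)
  finally show ?thesis .
qed

section \<open>Hermitian matrices, and the size and number of eigenvalues\<close>

lemma mat_l1_hermitian:
  assumes "mat_adjoint A = A" shows "mat_l1 (A - mat_adjoint A) = 0"
  unfolding assms by (auto simp: mat_l1_def)

lemma im_bounded_hermitian:
  assumes "A \<in> carrier_mat n n" "mat_adjoint A = A" shows "im_bounded A 0"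
  using im_bounded_mat_l1[OF assms(1)] mat_l1_hermitian[OF assms(2)] by simp

lemma eigenvalues_hermitian_real:
  assumes A: "A \<in> carrier_mat n n" and herm: "mat_adjoint A = A" and x: "x \<in># eigenvalues A"
  shows "Im x = 0"
proof -
  obtain M where M: "eigenvalues A = add_mset x M" using multi_member_split[OF x] by blast
  have "0 \<le> (\<Sum>y\<in>#M. \<bar>Im y\<bar>)" by (induction M) auto
  then show ?thesis
    using sum_abs_Im_eigenvalues_le[OF A] mat_l1_hermitian[OF herm] by (simp add: M)
qed

lemma cmod_eigenvalue_le:
  assumes A: "A \<in> carrier_mat n n" and b: "op_bounded A c" and x: "x \<in># eigenvalues A"
  shows "cmod x \<le> c"
proof -
  obtain u where u: "\<And>k. k < n \<Longrightarrow> u k \<in> carrier_vec n" and un: "\<And>k. k < n \<Longrightarrow> l2_norm (u k) = 1"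
    and u1: "\<And>i. i < n \<Longrightarrow> (\<Sum>k<n. (cmod (u k $ i))\<^sup>2) = 1"
    and ev: "eigenvalues A = image_mset (\<lambda>k. (A *\<^sub>v u k) \<bullet>c u k) (mset_set {..<n})"
    using unitary_schur_columns[OF A] by blast
  obtain k where k: "k < n" "x = (A *\<^sub>v u k) \<bullet>c u k" using x unfolding ev by auto
  have "cmod x \<le> l2_norm (A *\<^sub>v u k) * l2_norm (u k)"
    unfolding k(2) by (rule cmod_cscalar_prod_le[OF mult_mat_vec_carrier[OF A u] u]) (fact k)+
  then show ?thesis using op_boundedD[OF b A u[OF k(1)]] un[OF k(1)] by simp
qed

lemma size_eigenvalues:
  assumes A: "A \<in> carrier_mat n n" shows "size (eigenvalues A) = n"
proof -
  obtain U where "eigenvalues A = image_mset (\<lambda>k. (mat_adjoint U * A * U) $$ (k, k)) (mset_set {..<n})"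
    using unitary_schur[OF A] by blast
  then show ?thesis by simp
qed

section \<open>Norm and rank\<close>

text \<open>The weight \<open>|A_ij|\<close> is split into two square roots: Cauchy-Schwarz inside a
  row uses the row sums, and the later sum over \<open>i\<close> uses the column sums.\<close>

lemma op_bounded_schur_test:
  fixes A :: "complex mat"
  assumes A: "A \<in> carrier_mat n n" and c: "0 \<le> c"
    and row: "\<And>i. i < n \<Longrightarrow> (\<Sum>j<n. cmod (A $$ (i, j))) \<le> c"
    and col: "\<And>j. j < n \<Longrightarrow> (\<Sum>i<n. cmod (A $$ (i, j))) \<le> c"
  shows "op_bounded A c"
  unfolding op_bounded_def
proof
  fix v :: "complex Matrix.vec" assume "v \<in> carrier_vec (dim_col A)"
  then have v: "v \<in> carrier_vec n" using A by simp
  have Av: "A *\<^sub>v v \<in> carrier_vec n" using A v by simp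
  have entry: "(cmod ((A *\<^sub>v v) $ i))\<^sup>2 \<le> c * (\<Sum>j<n. cmod (A $$ (i, j)) * (cmod (v $ j))\<^sup>2)" if i: "i < n" for i
  proof -
    have "cmod ((A *\<^sub>v v) $ i) \<le> (\<Sum>j<n. cmod (A $$ (i, j)) * cmod (v $ j))"
      unfolding mult_mat_vec_index_sum[OF A v i] by (intro sum_norm_le) (simp add: norm_mult)
    then have "(cmod ((A *\<^sub>v v) $ i))\<^sup>2 \<le> (\<Sum>j<n. cmod (A $$ (i, j)) * cmod (v $ j))\<^sup>2"
      by (intro power_mono) auto
    also have "\<dots> = (\<Sum>j<n. sqrt (cmod (A $$ (i, j))) * (sqrt (cmod (A $$ (i, j))) * cmod (v $ j)))\<^sup>2"
      by (simp add: mult.assoc[symmetric])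
    also have "\<dots> \<le> (\<Sum>j<n. (sqrt (cmod (A $$ (i, j))))\<^sup>2) * (\<Sum>j<n. (sqrt (cmod (A $$ (i, j))) * cmod (v $ j))\<^sup>2)"
      by (rule Cauchy_Schwarz_ineq_sum)
    also have "\<dots> = (\<Sum>j<n. cmod (A $$ (i, j))) * (\<Sum>j<n. cmod (A $$ (i, j)) * (cmod (v $ j))\<^sup>2)"
      by (simp add: power_mult_distrib)
    also have "\<dots> \<le> c * (\<Sum>j<n. cmod (A $$ (i, j)) * (cmod (v $ j))\<^sup>2)"
      by (intro mult_right_mono row[OF i] sum_nonneg) auto
    finally show ?thesis .
  qed
  have "(l2_norm (A *\<^sub>v v))\<^sup>2 \<le> (\<Sum>i<n. c * (\<Sum>j<n. cmod (A $$ (i, j)) * (cmod (v $ j))\<^sup>2))"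
    unfolding l2_norm_sq[OF Av] by (intro sum_mono entry) auto
  also have "\<dots> = c * (\<Sum>j<n. (\<Sum>i<n. cmod (A $$ (i, j))) * (cmod (v $ j))\<^sup>2)"
    unfolding sum_distrib_left[symmetric] sum_distrib_right by (subst sum.swap) simp
  also have "\<dots> \<le> c * (\<Sum>j<n. c * (cmod (v $ j))\<^sup>2)"
    using c by (intro mult_left_mono sum_mono mult_right_mono col) auto
  also have "\<dots> = (c * l2_norm v)\<^sup>2"
    unfolding power_mult_distrib l2_norm_sq[OF v] by (simp add: sum_distrib_left power2_eq_square mult.assoc)
  finally show "l2_norm (A *\<^sub>v v) \<le> c * l2_norm v"
    using c by (auto intro: power2_le_imp_le)
qed

lemma spectral_norm_le:
  assumes A: "A \<in> carrier_mat n n" and b: "op_bounded A c" and c: "0 \<le> c"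
  shows "spectral_norm A \<le> c"
  unfolding spectral_norm_def
proof (rule cSUP_least)
  show "{v \<in> carrier_vec (dim_col A). l2_norm v \<le> 1} \<noteq> {}"
    using l2_norm_zero[of "dim_col A"] by (intro ex_in_conv[THEN iffD1] exI[of _ "0\<^sub>v (dim_col A)"]) simp
  fix v assume "v \<in> {v \<in> carrier_vec (dim_col A). l2_norm v \<le> 1}"
  then have v: "v \<in> carrier_vec (dim_col A)" "l2_norm v \<le> 1" by auto
  have "l2_norm (A *\<^sub>v v) \<le> c * l2_norm v" using b v by (simp add: op_bounded_def)
  also have "\<dots> \<le> c" using v(2) c by (simp add: mult_left_le)
  finally show "l2_norm (A *\<^sub>v v) \<le> c" .
qed

text \<open>A maximal independent set of columns has as many elements as the rank and cannot contain
  the zero vector, so its members come from \<open>J\<close>.\<close>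

lemma rank_le_nonzero_columns:
  fixes R :: "complex mat"
  assumes R: "R \<in> carrier_mat n n" and J: "J \<subseteq> {..<n}"
    and zero: "\<And>i j. i < n \<Longrightarrow> j < n \<Longrightarrow> j \<notin> J \<Longrightarrow> R $$ (i, j) = 0"
  shows "vec_space.rank n R \<le> card J"
proof -
  interpret vec_space "TYPE(complex)" n .
  let ?P = "\<lambda>T. T \<subseteq> set (cols R) \<and> lin_indpt T"
  obtain S where S: "maximal S ?P"
    using maximal_exists[of ?P "card (set (cols R))" "{}"]
    by (meson List.finite_set card_mono empty_iff empty_subsetI finite_lin_indpt2 rev_finite_subset)
  have "S \<subseteq> (\<lambda>j. col R j) ` J"
  proof
    fix x assume x: "x \<in> S"
    then have "x \<in> set (cols R)" using S by (auto simp: maximal_def)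
    then obtain j where j: "j < n" "x = col R j" using R by (auto simp: cols_def)
    have "x \<noteq> 0\<^sub>v n"
    proof
      assume x0: "x = 0\<^sub>v n"
      have "S \<subseteq> carrier_vec n" using S R cols_dim[of R] by (auto simp: maximal_def)
      then show False using x x0 S zero_nin_lin_indpt[of S] by (auto simp: maximal_def)
    qed
    then have "j \<in> J" using zero[of _ j] j R by (auto intro!: eq_vecI)
    then show "x \<in> (\<lambda>j. col R j) ` J" using j by simp
  qed
  moreover have "finite J" using J finite_subset by blast
  ultimately have "card S \<le> card J" by (meson card_image_le card_mono finite_imageI order_trans)
  then show ?thesis using rank_card_indpt[OF R S] by simp
qed

section \<open>Resolvents determine the distribution\<close>

definition symbol_mean :: "'a::euclidean_space set \<Rightarrow> ('a \<Rightarrow> complex) \<Rightarrow> complex" where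
  "symbol_mean D f = (LINT x|lebesgue_on D. f x) / of_real (measure lebesgue D)"

text \<open>The partial fraction identity makes this closed span of resolvents an algebra.\<close>

inductive_set resolvent_algebra :: "real \<Rightarrow> (real \<Rightarrow> complex) set" for M where
  const: "(\<lambda>_. c) \<in> resolvent_algebra M"
| resolvent: "M \<le> \<bar>Im z\<bar> \<Longrightarrow> (\<lambda>t. 1 / (of_real t - z)) \<in> resolvent_algebra M"
| add: "f \<in> resolvent_algebra M \<Longrightarrow> g \<in> resolvent_algebra M \<Longrightarrow> (\<lambda>t. f t + g t) \<in> resolvent_algebra M"
| scale: "f \<in> resolvent_algebra M \<Longrightarrow> (\<lambda>t. c * f t) \<in> resolvent_algebra M"
| uniform_limit: "(\<And>e. 0 < e \<Longrightarrow> \<exists>g. g \<in> resolvent_algebra M \<and> (\<forall>t. cmod (f t - g t) \<le> e)) \<Longrightarrow>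
    f \<in> resolvent_algebra M"

lemma cmod_resolvent_le:
  assumes "0 < M" "M \<le> \<bar>Im z\<bar>"
  shows "cmod (1 / (of_real t - z)) \<le> 1 / M"
proof -
  have "M \<le> cmod (of_real t - z)"
    using abs_Im_le_cmod[of "of_real t - z"] assms by simp
  then show ?thesis using assms by (simp add: norm_divide frac_le)
qed

lemma resolvent_algebra_bounded:
  assumes "f \<in> resolvent_algebra M" "0 < M"
  shows "\<exists>B. \<forall>t. cmod (f t) \<le> B"
  using assms(1)
proof induction
  case (const c) then show ?case by blast
next
  case (resolvent z) then show ?case using cmod_resolvent_le[OF assms(2)] by blast
next
  case (add f g)
  then obtain A B where "\<forall>t. cmod (f t) \<le> A" "\<forall>t. cmod (g t) \<le> B" by blast
  then have "\<forall>t. cmod (f t + g t) \<le> A + B" by (meson add_mono norm_triangle_ineq order_trans)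
  then show ?case by blast
next
  case (scale f c)
  then obtain A where "\<forall>t. cmod (f t) \<le> A" by blast
  then have "\<forall>t. cmod (c * f t) \<le> cmod c * A" by (simp add: norm_mult mult_left_mono)
  then show ?case by blast
next
  case (uniform_limit f)
  from uniform_limit(1)[of 1] obtain g A where g: "\<forall>t. cmod (f t - g t) \<le> 1" "\<forall>t. cmod (g t) \<le> A" by auto
  have "cmod (f t) \<le> 1 + A" for t
    using g(1)[rule_format, of t] g(2)[rule_format, of t] norm_triangle_ineq[of "f t - g t" "g t"] by simp
  then show ?case by blast
qed

lemma resolvent_algebra_continuous:
  assumes "f \<in> resolvent_algebra M" "0 < M"
  shows "continuous_on UNIV f"
  using assms(1)
proof induction
  case (resolvent z)
  have "complex_of_real t - z \<noteq> 0" for t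
    using resolvent assms(2) by (auto simp: complex_eq_iff)
  then show ?case by (auto intro!: continuous_intros)
next
  case (uniform_limit f)
  have "\<forall>k. \<exists>g. continuous_on UNIV g \<and> (\<forall>t. cmod (f t - g t) \<le> inverse (Suc k))"
    using uniform_limit by (metis inverse_positive_iff_positive of_nat_0_less_iff zero_less_Suc)
  then obtain g where g: "\<And>k. continuous_on UNIV (g k)" "\<And>k t. cmod (f t - g k t) \<le> inverse (Suc k)"
    by metis
  show ?case
  proof (rule uniform_limit_theorem[where f = g and F = sequentially])
    show "uniform_limit UNIV g f sequentially"
      unfolding uniform_limit_iff
    proof (intro allI impI)
      fix e :: real assume "0 < e"
      then have "\<forall>\<^sub>F k in sequentially. inverse (real (Suc k)) < e"
        using LIMSEQ_inverse_real_of_nat by (auto dest: order_tendstoD(2))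
      then show "\<forall>\<^sub>F k in sequentially. \<forall>x\<in>UNIV. dist (g k x) (f x) < e"
        by eventually_elim (metis g(2) dist_norm norm_minus_commute le_less_trans)
    qed
  qed (auto simp: g)
qed (auto intro!: continuous_intros)

text \<open>Two distinct poles separate by partial fractions. A double pole does not, so one of its
  two copies is displaced and the product is recovered as a uniform limit.\<close>

lemma resolvent_algebra_mult_resolvent:
  assumes "f \<in> resolvent_algebra M" "0 < M" "M \<le> \<bar>Im z\<bar>"
  shows "(\<lambda>t. f t * (1 / (of_real t - z))) \<in> resolvent_algebra M"
  using assms(1)
proof induction
  case (const c)
  show ?case by (rule resolvent_algebra.scale[OF resolvent_algebra.resolvent[OF assms(3)]])
next
  case (resolvent w)
  have nz: "complex_of_real t - x \<noteq> 0" if "M \<le> \<bar>Im x\<bar>" for t x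
    using that assms(2) by (auto simp: complex_eq_iff)
  have distinct: "(\<lambda>t. 1 / (of_real t - x) * (1 / (of_real t - y))) \<in> resolvent_algebra M"
    if "M \<le> \<bar>Im x\<bar>" "M \<le> \<bar>Im y\<bar>" "x \<noteq> y" for x y
  proof -
    have "(\<lambda>t. 1 / (of_real t - x) * (1 / (of_real t - y))) =
      (\<lambda>t. 1 / (x - y) * (1 / (of_real t - x) + (-1) * (1 / (of_real t - y))))"
      using nz[OF that(1)] nz[OF that(2)] that(3) by (auto simp: fun_eq_iff field_simps)
    also have "\<dots> \<in> resolvent_algebra M"
      by (intro resolvent_algebra.scale resolvent_algebra.add resolvent_algebra.resolvent that)
    finally show ?thesis .
  qed
  show ?case
  proof (cases "w = z")
    case False then show ?thesis using distinct resolvent assms(3) by blast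
  next
    case True
    show ?thesis unfolding True
    proof (rule resolvent_algebra.uniform_limit)
      fix e :: real assume e: "0 < e"
      \<comment> \<open>The error is \<open>z - y\<close> times three resolvents of modulus at most
        \<open>1 / M\<close>, hence at most \<open>h / M ^ 3 = e\<close>.\<close>
      define h where "h = e * M ^ 3"
      have h: "0 < h" using e assms(2) by (simp add: h_def)
      \<comment> \<open>The displacement points away from the real axis, so the new pole still has
        height at least \<open>M\<close>.\<close>
      define y where "y = z + \<i> * of_real (sgn (Im z) * h)"
      have Imz: "Im z \<noteq> 0" using assms(2,3) by auto
      have "\<bar>Im y\<bar> = \<bar>Im z\<bar> + h"
        using Imz h by (auto simp: y_def sgn_if)
      then have y: "M \<le> \<bar>Im y\<bar>" using assms(3) h by simp
      have yz: "cmod (y - z) = h" using h Imz by (simp add: y_def norm_mult abs_mult abs_sgn_eq)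
      then have "z \<noteq> y" using h by auto
      moreover have "cmod (1 / (of_real t - z) * (1 / (of_real t - z)) - 1 / (of_real t - z) * (1 / (of_real t - y))) \<le> e" for t
      proof -
        have "1 / (of_real t - z) * (1 / (of_real t - z)) - 1 / (of_real t - z) * (1 / (of_real t - y)) =
          (1 / (of_real t - z)) * (1 / (of_real t - z)) * (1 / (of_real t - y)) * (z - y)"
        proof -
          have "1 / u * (1 / u) - 1 / u * (1 / v) = 1 / u * (1 / u) * (1 / v) * (v - u)"
            if "u \<noteq> 0" "v \<noteq> 0" for u v :: complex
            using that by (simp add: field_simps)
          from this[OF nz[OF assms(3)] nz[OF y], of t t] show ?thesis by simp
        qed
        then have "cmod (1 / (of_real t - z) * (1 / (of_real t - z)) - 1 / (of_real t - z) * (1 / (of_real t - y))) =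
          cmod (1 / (of_real t - z)) * cmod (1 / (of_real t - z)) * cmod (1 / (of_real t - y)) * h"
          using yz by (simp only: norm_mult norm_minus_commute)
        also have "\<dots> \<le> 1 / M * (1 / M) * (1 / M) * h"
          using cmod_resolvent_le[OF assms(2)] y assms h
          by (intro mult_right_mono mult_mono) auto
        also have "\<dots> = e" using assms(2) by (simp add: h_def power3_eq_cube)
        finally show ?thesis .
      qed
      ultimately show "\<exists>g. g \<in> resolvent_algebra M \<and>
          (\<forall>t. cmod (1 / (of_real t - z) * (1 / (of_real t - z)) - g t) \<le> e)"
        using distinct[OF assms(3) y] by blast
    qed
  qed
next
  case (add f g)
  then show ?case using resolvent_algebra.add[OF add(3,4)] by (simp only: distrib_right)
next
  case (scale f c)
  then show ?case using resolvent_algebra.scale[OF scale(2), of c] by (simp only: mult.assoc)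
next
  case (uniform_limit f)
  show ?case
  proof (rule resolvent_algebra.uniform_limit)
    fix e :: real assume e: "0 < e"
    then have "0 < e * M" using assms(2) by simp
    from uniform_limit(1)[OF this] obtain g
      where g: "(\<lambda>t. g t * (1 / (of_real t - z))) \<in> resolvent_algebra M" "\<forall>t. cmod (f t - g t) \<le> e * M" by blast
    have "cmod (f t * (1 / (of_real t - z)) - g t * (1 / (of_real t - z))) \<le> e" for t
    proof -
      have "cmod (f t * (1 / (of_real t - z)) - g t * (1 / (of_real t - z))) = cmod (f t - g t) * cmod (1 / (of_real t - z))"
        by (simp only: left_diff_distrib[symmetric] norm_mult)
      also have "\<dots> \<le> e * M * (1 / M)"
        using g(2) e assms(2) by (intro mult_mono cmod_resolvent_le assms) auto
      finally show ?thesis using assms(2) by simp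
    qed
    then show "\<exists>g. g \<in> resolvent_algebra M \<and> (\<forall>t. cmod (f t * (1 / (of_real t - z)) - g t) \<le> e)"
      using g(1) by blast
  qed
qed

lemma resolvent_algebra_mult:
  assumes "g \<in> resolvent_algebra M" "f \<in> resolvent_algebra M" "0 < M"
  shows "(\<lambda>t. f t * g t) \<in> resolvent_algebra M"
  using assms(1)
proof induction
  case (const c)
  then show ?case using resolvent_algebra.scale[OF assms(2), of c] by (simp only: mult.commute)
next
  case (resolvent z)
  then show ?case by (rule resolvent_algebra_mult_resolvent[OF assms(2,3)])
next
  case (add g h)
  then show ?case using resolvent_algebra.add[OF add(3,4)] by (simp only: distrib_left)
next
  case (scale g c)
  then show ?case using resolvent_algebra.scale[OF scale(2), of c] by (simp only: mult.left_commute)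
next
  case (uniform_limit g)
  obtain B where B: "\<forall>t. cmod (f t) \<le> B" using resolvent_algebra_bounded[OF assms(2,3)] by blast
  have B0: "0 \<le> B" using B norm_ge_zero order_trans by blast
  show ?case
  proof (rule resolvent_algebra.uniform_limit)
    fix e :: real assume e: "0 < e"
    then have "0 < e / (B + 1)" using B0 by simp
    from uniform_limit(1)[OF this] obtain h
      where h: "(\<lambda>t. f t * h t) \<in> resolvent_algebra M" "\<forall>t. cmod (g t - h t) \<le> e / (B + 1)" by blast
    have "cmod (f t * g t - f t * h t) \<le> e" for t
    proof -
      have "cmod (f t * g t - f t * h t) = cmod (f t) * cmod (g t - h t)"
        by (simp only: right_diff_distrib[symmetric] norm_mult)
      also have "\<dots> \<le> (B + 1) * (e / (B + 1))"
        using h(2) B B0 e by (intro mult_mono) (auto intro: order_trans)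
      finally show ?thesis using B0 by simp
    qed
    then show "\<exists>h. h \<in> resolvent_algebra M \<and> (\<forall>t. cmod (f t * g t - h t) \<le> e)"
      using h(1) by blast
  qed
qed

text \<open>The Cayley transform \<open>zeta t = (t + i M) / (t - i M)\<close> maps the line onto
  the unit circle without the point 1, and \<open>zeta'\<close> is its conjugate; both lie in the
  algebra. A function of bounded support becomes a continuous function on the circle vanishing near
  1. Stone-Weierstrass is applied to the ring \<open>R\<close> of functions whose pullback lies in
  the algebra; the coordinate functions separate points.\<close>

lemma real_Cc_in_resolvent_algebra:
  fixes G :: "real \<Rightarrow> real"
  assumes M: "0 < M" and G: "continuous_on UNIV G" and bd: "bounded {x. G x \<noteq> 0}"
  shows "(\<lambda>t. complex_of_real (G t)) \<in> resolvent_algebra M"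
proof -
  obtain K where K: "\<And>x. G x \<noteq> 0 \<Longrightarrow> \<bar>x\<bar> \<le> K" using bd unfolding bounded_iff by auto
  \<comment> \<open>Since \<open>1 - Re (zeta t) = 2 M^2 / (t^2 + M^2)\<close>, the number
    \<open>d\<close> is the value at \<open>t^2 = K^2 + 1\<close>, just outside the support of
    \<open>G\<close>.\<close>
  define d where "d = 2 * M\<^sup>2 / (K\<^sup>2 + M\<^sup>2 + 1)"
  have den: "0 < K\<^sup>2 + M\<^sup>2 + 1" by (simp add: add_nonneg_pos)
  have d: "0 < d" using M den by (simp add: d_def)
  have G0: "G t = 0" if "K\<^sup>2 < t\<^sup>2" for t
    using K[of t] that by (metis abs_le_square_iff abs_of_nonneg abs_ge_zero linorder_not_less order_trans)
  define zeta where "zeta = (\<lambda>t. 1 + 2 * \<i> * of_real M * (1 / (complex_of_real t - \<i> * of_real M)))"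
  define zeta' where "zeta' = (\<lambda>t. 1 + (- 2) * \<i> * of_real M * (1 / (complex_of_real t - - \<i> * of_real M)))"
  have pos: "0 < t\<^sup>2 + M\<^sup>2" for t using M by (simp add: add_nonneg_pos)
  define p where "p = (\<lambda>t. (t\<^sup>2 - M\<^sup>2) / (t\<^sup>2 + M\<^sup>2))"
  define q where "q = (\<lambda>t. 2 * t * M / (t\<^sup>2 + M\<^sup>2))"
  have p: "p t = 1 - 2 * M\<^sup>2 / (t\<^sup>2 + M\<^sup>2)" for t
    using pos[of t] unfolding p_def by (subst divide_eq_eq) (auto simp: left_diff_distrib)
  have zz: "zeta t = Complex (p t) (q t)" "zeta' t = Complex (p t) (- q t)" for t
    by (auto simp: zeta_def zeta'_def complex_eq_iff Re_divide Im_divide power2_eq_square p q_def)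
  have zRA: "zeta \<in> resolvent_algebra M" "zeta' \<in> resolvent_algebra M"
    unfolding zeta_def zeta'_def using M
    by (intro resolvent_algebra.add resolvent_algebra.const resolvent_algebra.scale resolvent_algebra.resolvent; simp)+
  have z_sphere: "zeta t \<in> sphere 0 1" for t
  proof -
    have "(cmod (zeta t))\<^sup>2 = ((t\<^sup>2 - M\<^sup>2)\<^sup>2 + (2 * t * M)\<^sup>2) / (t\<^sup>2 + M\<^sup>2)\<^sup>2"
      by (simp add: zz cmod_power2 p_def q_def power_divide add_divide_distrib)
    also have "(t\<^sup>2 - M\<^sup>2)\<^sup>2 + (2 * t * M)\<^sup>2 = (t\<^sup>2 + M\<^sup>2)\<^sup>2" by (simp add: power2_eq_square algebra_simps)
    finally have "(cmod (zeta t))\<^sup>2 = 1" using pos[of t] M by simp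
    then show ?thesis 
      using norm_ge_zero[of "zeta t"] by (auto simp: power2_eq_1_iff simp del: norm_ge_zero)
  qed
  define R where "R = {phi :: complex \<Rightarrow> real. continuous_on (sphere 0 1) phi \<and>
    (\<lambda>t. complex_of_real (phi (zeta t))) \<in> resolvent_algebra M}"
  have ReR: "Re \<in> R"
  proof -
    have "(\<lambda>t. complex_of_real (Re (zeta t))) = (\<lambda>t. 1 / 2 * (zeta t + zeta' t))"
      by (auto simp: fun_eq_iff zz complex_eq_iff)
    also have "\<dots> \<in> resolvent_algebra M" by (intro resolvent_algebra.scale resolvent_algebra.add zRA)
    finally show ?thesis by (auto simp: R_def intro!: continuous_intros)
  qed
  have ImR: "Im \<in> R"
  proof -
    have "(\<lambda>t. complex_of_real (Im (zeta t))) = (\<lambda>t. - \<i> / 2 * (zeta t + (- 1) * zeta' t))"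
      by (auto simp: fun_eq_iff zz complex_eq_iff)
    also have "\<dots> \<in> resolvent_algebra M" by (intro resolvent_algebra.scale resolvent_algebra.add zRA)
    finally show ?thesis by (auto simp: R_def intro!: continuous_intros)
  qed
  interpret function_ring_on R "sphere 0 1"
  proof
    show "f \<in> R \<Longrightarrow> g \<in> R \<Longrightarrow> (\<lambda>x. f x + g x) \<in> R" for f g
      by (auto simp: R_def intro!: continuous_intros resolvent_algebra.add)
    show "f \<in> R \<Longrightarrow> g \<in> R \<Longrightarrow> (\<lambda>x. f x * g x) \<in> R" for f g
      using M by (auto simp: R_def intro!: continuous_intros resolvent_algebra_mult)
    show "(\<lambda>_. c) \<in> R" for c by (auto simp: R_def intro!: resolvent_algebra.const)
    show "\<exists>f\<in>R. f x \<noteq> f y" if "x \<noteq> y" for x y :: complex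
      using ReR ImR that by (auto simp: complex_eq_iff)
  qed (auto simp: R_def)
  \<comment> \<open>The quotient \<open>M * Im x / (1 - Re x)\<close> inverts the Cayley transform.
    The cut at \<open>Re x = 1 - d\<close> avoids its singularity at 1, the image of
    infinity.\<close>
  define phi where "phi = (\<lambda>x. if Re x \<le> 1 - d then G (M * Im x / (1 - Re x)) else 0)"
  have "continuous_on ({x \<in> sphere 0 1. Re x \<le> 1 - d} \<union> {x \<in> sphere 0 1. 1 - d \<le> Re x}) phi"
    unfolding phi_def
  proof (rule continuous_on_If)
    show "continuous_on {x \<in> sphere 0 1. Re x \<le> 1 - d} (\<lambda>x. G (M * Im x / (1 - Re x)))"
      using d by (intro continuous_on_compose2[OF G] continuous_intros) auto
    fix x :: complex assume x: "x \<in> {x \<in> sphere 0 1. Re x \<le> 1 - d}" "\<not> Re x \<le> 1 - d"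
    then show "G (M * Im x / (1 - Re x)) = 0" by simp
  next
    fix x :: complex assume x: "x \<in> {x \<in> sphere 0 1. 1 - d \<le> Re x}" "Re x \<le> 1 - d"
    then have Rx: "1 - Re x = d" and "(cmod x)\<^sup>2 = 1" by auto
    have "Re x = 1 - d" using Rx by simp
    moreover have "(Re x)\<^sup>2 + (Im x)\<^sup>2 = 1" using \<open>(cmod x)\<^sup>2 = 1\<close> cmod_power2[of x] by argo
    ultimately have "(Im x)\<^sup>2 = 1 - (1 - d)\<^sup>2" by simp
    then have "(Im x)\<^sup>2 = 2 * d - d\<^sup>2" by (simp add: power2_eq_square algebra_simps)
    then have "(M * Im x / (1 - Re x))\<^sup>2 = M\<^sup>2 * (2 * d - d\<^sup>2) / d\<^sup>2"
      by (simp add: Rx power_divide power_mult_distrib)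
    also have "\<dots> = 2 * M\<^sup>2 / d - M\<^sup>2" using d by (simp add: field_simps power2_eq_square)
    also have "\<dots> = K\<^sup>2 + 1" using M den by (simp add: d_def field_simps)
    finally show "G (M * Im x / (1 - Re x)) = 0" by (intro G0) simp
  qed (auto intro!: closed_Collect_conj closed_Collect_le closed_Collect_eq continuous_intros simp: continuous_on_id)
  also have "{x \<in> sphere 0 1. Re x \<le> 1 - d} \<union> {x \<in> sphere 0 1. 1 - d \<le> Re x} = sphere 0 1" by auto
  finally have phi: "continuous_on (sphere 0 1) phi" .
  have phi_zeta: "phi (zeta t) = G t" for t
  proof -
    have "1 - Re (zeta t) = 2 * M\<^sup>2 / (t\<^sup>2 + M\<^sup>2)" by (simp add: zz p)
    moreover have "M * Im (zeta t) / (1 - Re (zeta t)) = t"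
      using pos[of t] M unfolding calculation by (simp add: zz q_def power2_eq_square)
    moreover have "G t = 0" if "2 * M\<^sup>2 / (t\<^sup>2 + M\<^sup>2) < d"
    proof (rule G0)
      show "K\<^sup>2 < t\<^sup>2" using that M pos[of t] den by (simp add: d_def divide_less_cancel divide_simps split: if_splits)
    qed
    ultimately show ?thesis by (auto simp: phi_def)
  qed
  show ?thesis
  proof (rule resolvent_algebra.uniform_limit)
    fix e :: real assume "0 < e"
    then obtain g where g: "g \<in> R" "\<forall>x\<in>sphere 0 1. \<bar>phi x - g x\<bar> < e"
      using Stone_Weierstrass_basic[OF phi] by blast
    have "cmod (of_real (G t) - of_real (g (zeta t))) \<le> e" for t
      using g(2) z_sphere[of t] phi_zeta[of t] by (metis less_imp_le norm_of_real of_real_diff)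
    then show "\<exists>h. h \<in> resolvent_algebra M \<and> (\<forall>t. cmod (complex_of_real (G t) - h t) \<le> e)"
      using g(1) by (auto simp: R_def)
  qed
qed

lemma Cc_in_resolvent_algebra:
  assumes M: "0 < M" and F: "F \<in> Cc"
  shows "F \<in> resolvent_algebra M"
proof -
  have F': "continuous_on UNIV F" "bounded {x. F x \<noteq> 0}" using F by (auto simp: Cc_def)
  have "(\<lambda>t. complex_of_real (Re (F t))) \<in> resolvent_algebra M"
    by (rule real_Cc_in_resolvent_algebra[OF M])
      (auto intro!: continuous_intros F' bounded_subset[OF F'(2)])
  moreover have "(\<lambda>t. complex_of_real (Im (F t))) \<in> resolvent_algebra M"
    by (rule real_Cc_in_resolvent_algebra[OF M])
      (auto intro!: continuous_intros F' bounded_subset[OF F'(2)])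
  ultimately have "(\<lambda>t. of_real (Re (F t)) + \<i> * of_real (Im (F t))) \<in> resolvent_algebra M"
    by (intro resolvent_algebra.add resolvent_algebra.scale)
  then show ?thesis by (simp flip: complex_eq)
qed

section \<open>Means of symbols and their stability under approximation\<close>

lemma integrable_bounded_symbol:
  fixes g :: "'a::euclidean_space \<Rightarrow> complex"
  assumes D: "D \<in> sets lebesgue" "emeasure lebesgue D < \<infinity>"
    and g: "g \<in> borel_measurable (lebesgue_on D)" and B: "\<And>x. x \<in> D \<Longrightarrow> cmod (g x) \<le> B"
  shows "integrable (lebesgue_on D) g"
proof (rule finite_measure.integrable_const_bound[where B = B])
  show "finite_measure (lebesgue_on D)"
    using D by (intro finite_measureI) (simp add: emeasure_restrict_space less_top)
  show "AE x in lebesgue_on D. cmod (g x) \<le> B" using B by (auto intro: AE_I2)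
qed (fact g)

lemma symbol_onD:
  assumes "symbol_on D f"
  shows "D \<in> sets lebesgue" "emeasure lebesgue D < \<infinity>" "0 < measure lebesgue D"
    "f \<in> borel_measurable (lebesgue_on D)" "measure (lebesgue_on D) (space (lebesgue_on D)) = measure lebesgue D"
  using assms by (auto simp: symbol_on_def measure_def enn2real_positive_iff emeasure_restrict_space less_top)

lemma cmod_symbol_mean_diff_le:
  assumes D: "symbol_on D k"
    and f: "integrable (lebesgue_on D) f" and g: "integrable (lebesgue_on D) g"
    and le: "\<And>x. x \<in> D \<Longrightarrow> cmod (f x - g x) \<le> e"
  shows "cmod (symbol_mean D f - symbol_mean D g) \<le> e"
proof -
  note D = symbol_onD[OF D]
  have fin: "finite_measure (lebesgue_on D)"
    using D(1,2) by (intro finite_measureI) (simp add: emeasure_restrict_space less_top)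
  have "cmod ((LINT x|lebesgue_on D. f x) - (LINT x|lebesgue_on D. g x)) = cmod (LINT x|lebesgue_on D. f x - g x)"
    using f g by simp
  also have "\<dots> \<le> (LINT x|lebesgue_on D. cmod (f x - g x))"
    by (rule integral_norm_bound)
  also have "\<dots> \<le> (LINT x|lebesgue_on D. e)"
    using f g le fin by (intro integral_mono) (auto intro: finite_measure.integrable_const)
  also have "\<dots> = measure lebesgue D * e" using D by simp
  finally show ?thesis
    using D(3) by (simp add: symbol_mean_def diff_divide_distrib[symmetric] norm_divide field_simps)
qed

text \<open>Closeness is asked only at the points of \<open>S n\<close> and at the values of
  \<open>h\<close>. This covers uniform approximation on the whole line as well as polynomial
  approximation on an interval that contains all these points.\<close>

lemma mean_convergence_uniform_limit:
  fixes h :: "'a::euclidean_space \<Rightarrow> real" and S :: "nat \<Rightarrow> real multiset" and f :: "real \<Rightarrow> complex"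
  assumes D: "symbol_on D k" and S: "\<And>n. 1 \<le> n \<Longrightarrow> size (S n) = n"
    and int: "integrable (lebesgue_on D) (\<lambda>x. f (h x))"
    and approx: "\<And>e. 0 < e \<Longrightarrow> \<exists>g. (\<lambda>n. (\<Sum>t\<in>#S n. g t) / of_nat n) \<longlonglongrightarrow> symbol_mean D (\<lambda>x. g (h x)) \<and>
      integrable (lebesgue_on D) (\<lambda>x. g (h x)) \<and> (\<forall>x\<in>D. cmod (f (h x) - g (h x)) \<le> e) \<and>
      (\<forall>n\<ge>1. \<forall>t\<in>#S n. cmod (f t - g t) \<le> e)"
  shows "(\<lambda>n. (\<Sum>t\<in>#S n. f t) / of_nat n) \<longlonglongrightarrow> symbol_mean D (\<lambda>x. f (h x))"
proof (rule LIMSEQ_I)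
  fix e :: real assume e: "0 < e"
  then have e3: "0 < e / 3" by simp
  from approx[OF this] obtain g where
    gl: "(\<lambda>n. (\<Sum>t\<in>#S n. g t) / of_nat n) \<longlonglongrightarrow> symbol_mean D (\<lambda>x. g (h x))"
    and gi: "integrable (lebesgue_on D) (\<lambda>x. g (h x))"
    and fgD: "\<forall>x\<in>D. cmod (f (h x) - g (h x)) \<le> e / 3"
    and fgS: "\<forall>n\<ge>1. \<forall>t\<in>#S n. cmod (f t - g t) \<le> e / 3" by blast
  from LIMSEQ_D[OF gl e3] obtain n0
    where n0: "\<forall>n\<ge>n0. cmod ((\<Sum>t\<in>#S n. g t) / of_nat n - symbol_mean D (\<lambda>x. g (h x))) < e / 3" by blast
  have m: "cmod (symbol_mean D (\<lambda>x. f (h x)) - symbol_mean D (\<lambda>x. g (h x))) \<le> e / 3"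
    using fgD by (intro cmod_symbol_mean_diff_le[OF D int gi]) auto
  have s: "cmod ((\<Sum>t\<in>#S n. f t) / of_nat n - (\<Sum>t\<in>#S n. g t) / of_nat n) \<le> e / 3" if n: "1 \<le> n" for n
  proof -
    have "(\<forall>t\<in>#A. cmod (f t - g t) \<le> e / 3) \<Longrightarrow> cmod ((\<Sum>t\<in>#A. f t) - (\<Sum>t\<in>#A. g t)) \<le> real (size A) * (e / 3)" for A
    proof (induction A)
      case (add x A)
      have "cmod ((\<Sum>t\<in>#add_mset x A. f t) - (\<Sum>t\<in>#add_mset x A. g t)) \<le>
          cmod (f x - g x) + cmod ((\<Sum>t\<in>#A. f t) - (\<Sum>t\<in>#A. g t))"
        using norm_triangle_ineq[of "f x - g x" "(\<Sum>t\<in>#A. f t) - (\<Sum>t\<in>#A. g t)"] by (simp add: algebra_simps)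
      also have "\<dots> \<le> e / 3 + real (size A) * (e / 3)" using add by (intro add_mono) auto
      finally show ?case by (simp add: algebra_simps)
    qed simp
    from this[of "S n"] show ?thesis
      using n S[OF n] fgS by (simp add: diff_divide_distrib[symmetric] norm_divide field_simps)
  qed
  have "cmod ((\<Sum>t\<in>#S n. f t) / of_nat n - symbol_mean D (\<lambda>x. f (h x))) < e" if "max n0 1 \<le> n" for n
  proof -
    let ?a = "(\<Sum>t\<in>#S n. f t) / of_nat n" let ?b = "(\<Sum>t\<in>#S n. g t) / of_nat n"
    let ?c = "symbol_mean D (\<lambda>x. g (h x))" let ?d = "symbol_mean D (\<lambda>x. f (h x))"
    have "cmod (?a - ?d) \<le> cmod (?a - ?b) + cmod (?b - ?c) + cmod (?c - ?d)"
      using norm_triangle_ineq[of "?a - ?b" "?b - ?c"] norm_triangle_ineq[of "?a - ?c" "?c - ?d"] by simp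
    also have "\<dots> < e"
    proof -
      have "cmod (?a - ?b) \<le> e / 3" "cmod (?b - ?c) < e / 3" "cmod (?c - ?d) \<le> e / 3"
        using s[of n] n0 m that by (simp_all add: norm_minus_commute)
      then show ?thesis by simp
    qed
    finally show ?thesis .
  qed
  then show "\<exists>no. \<forall>n\<ge>no. norm ((\<Sum>t\<in>#S n. f t) / of_nat n - symbol_mean D (\<lambda>x. f (h x))) < e" by blast
qed

text \<open>Both sides are linear in \<open>f\<close> and stable under uniform limits, so induction
  over the algebra reduces the claim to its generators; for constants, \<open>size (S n) = n\<close>
  normalises the average. Resolvents with poles at height at least \<open>M\<close> thus control the
  whole algebra.\<close>

theorem resolvent_convergence:
  fixes h :: "'a::euclidean_space \<Rightarrow> real" and S :: "nat \<Rightarrow> real multiset"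
  assumes M: "0 < M" and D: "symbol_on D (\<lambda>x. complex_of_real (h x))"
    and S: "\<And>n. 1 \<le> n \<Longrightarrow> size (S n) = n"
    and conv: "\<And>z. M \<le> \<bar>Im z\<bar> \<Longrightarrow> (\<lambda>n. (\<Sum>t\<in>#S n. 1 / (of_real t - z)) / of_nat n)
      \<longlonglongrightarrow> symbol_mean D (\<lambda>x. 1 / (of_real (h x) - z))"
    and f: "f \<in> resolvent_algebra M"
  shows "(\<lambda>n. (\<Sum>t\<in>#S n. f t) / of_nat n) \<longlonglongrightarrow> symbol_mean D (\<lambda>x. f (h x))"
proof -
  note D' = symbol_onD[OF D]
  have "(\<lambda>x. Re (complex_of_real (h x))) \<in> borel_measurable (lebesgue_on D)"
    using D'(4) by measurable
  then have h: "h \<in> borel_measurable (lebesgue_on D)" by simp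
  have int: "integrable (lebesgue_on D) (\<lambda>x. g (h x))" if g: "g \<in> resolvent_algebra M" for g
  proof -
    obtain B where "\<forall>t. cmod (g t) \<le> B" using resolvent_algebra_bounded[OF g M] by blast
    moreover have "(\<lambda>x. g (h x)) \<in> borel_measurable (lebesgue_on D)"
      using borel_measurable_continuous_onI[OF resolvent_algebra_continuous[OF g M]] h by (rule measurable_compose[rotated])
    ultimately show ?thesis using D' by (intro integrable_bounded_symbol) auto
  qed
  show ?thesis
    using f
  proof induction
    case (const c)
    have "symbol_mean D (\<lambda>x. c) = c"
      using D' by (simp add: symbol_mean_def scaleR_conv_of_real)
    moreover have "\<forall>\<^sub>F n in sequentially. c = (\<Sum>t\<in>#S n. c) / of_nat n"
      using eventually_ge_at_top[of 1] by eventually_elim (simp add: S sum_mset_constant)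
    ultimately show ?case by (simp add: tendsto_eventually eventually_mono)
  next
    case (resolvent z)
    then show ?case by (rule conv)
  next
    case (add f g)
    have "symbol_mean D (\<lambda>x. f (h x) + g (h x)) = symbol_mean D (\<lambda>x. f (h x)) + symbol_mean D (\<lambda>x. g (h x))"
      using int add by (simp add: symbol_mean_def add_divide_distrib)
    then show ?case using tendsto_add[OF add(3,4)] by (simp add: sum_mset.distrib add_divide_distrib)
  next
    case (scale f c)
    have "symbol_mean D (\<lambda>x. c * f (h x)) = c * symbol_mean D (\<lambda>x. f (h x))"
      by (simp add: symbol_mean_def)
    then show ?case using tendsto_mult[OF tendsto_const scale(2), of c]
      by (simp add: sum_mset_distrib_left image_mset.compositionality comp_def)
  next
    case (uniform_limit f)
    show ?case
    proof (rule mean_convergence_uniform_limit[OF D S])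
      show "integrable (lebesgue_on D) (\<lambda>x. f (h x))"
        by (rule int, rule resolvent_algebra.uniform_limit) (use uniform_limit in blast)
    qed (use uniform_limit int in blast)+
  qed
qed

section \<open>Approximation of integrable functions\<close>

lemma AE_lebesgue_on_iff:
  "S \<in> sets lebesgue \<Longrightarrow> (AE x in lebesgue_on S. P x) \<longleftrightarrow> (AE x in lebesgue. x \<in> S \<longrightarrow> P x)"
  by (rule AE_restrict_space_iff) simp

lemma measurable_AE_continuous_limit:
  fixes a :: "real \<Rightarrow> real"
  assumes "a \<in> borel_measurable (lebesgue_on S)" "S \<in> sets lebesgue"
  shows "\<exists>g. (\<forall>n::nat. continuous_on UNIV (g n)) \<and> (AE x in lebesgue_on S. (\<lambda>n. g n x) \<longlonglongrightarrow> a x)"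
proof -
  have "a measurable_on S" using assms by (simp add: measurable_on_iff_borel_measurable)
  then obtain N g where N: "negligible N" and g: "\<And>n::nat. continuous_on UNIV (g n)"
    and lim: "\<And>x. x \<notin> N \<Longrightarrow> (\<lambda>n. g n x) \<longlonglongrightarrow> (if x \<in> S then a x else 0)"
    unfolding measurable_on_def by blast
  have "AE x in lebesgue. x \<notin> N" using N by (simp add: negligible_iff_null_sets AE_not_in)
  then have "AE x in lebesgue. x \<in> S \<longrightarrow> (\<lambda>n. g n x) \<longlonglongrightarrow> a x"
    by eventually_elim (use lim in force)
  then have "AE x in lebesgue_on S. (\<lambda>n. g n x) \<longlonglongrightarrow> a x"
    by (subst AE_lebesgue_on_iff[OF assms(2)])
  with g show ?thesis by blast
qed

lemma continuous_measurable_lebesgue_on [measurable]: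
  fixes g :: "'a::euclidean_space \<Rightarrow> 'b::euclidean_space"
  assumes "continuous_on UNIV g" shows "g \<in> borel_measurable (lebesgue_on S)"
  using borel_measurable_continuous_onI[OF assms]
  by (intro measurable_restrict_space1 measurable_completion) simp

definition clamp_abs :: "real \<Rightarrow> real \<Rightarrow> real" where
  "clamp_abs K x = max (- K) (min K x)"

lemma continuous_clamp_abs [continuous_intros]:
  "continuous_on S f \<Longrightarrow> continuous_on S (\<lambda>x. clamp_abs K (f x))"
  unfolding clamp_abs_def by (intro continuous_intros)

lemma clamp_abs_measurable [measurable]: "clamp_abs K \<in> borel_measurable borel"
  unfolding clamp_abs_def by measurable

lemma abs_clamp_abs_le: "0 \<le> K \<Longrightarrow> \<bar>clamp_abs K x\<bar> \<le> K"
  by (auto simp: clamp_abs_def)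

text \<open>First \<open>a\<close> is clamped at a level \<open>K\<close>, then its a.e. continuous
  approximants are clamped at the same level. Clamping supplies the dominating constant that a.e.
  convergence alone does not give.\<close>

lemma integrable_L1_continuous_approx:
  fixes a :: "real \<Rightarrow> real"
  assumes a: "integrable (lebesgue_on {0..1}) a" and e: "0 < e"
  shows "\<exists>g. continuous_on UNIV g \<and> (LINT x|lebesgue_on {0..1}. \<bar>a x - g x\<bar>) < e \<and>
    integrable (lebesgue_on {0..1}) g"
proof -
  let ?M = "lebesgue_on {0..1::real}"
  note [measurable] = borel_measurable_integrable[OF a]
  have fin: "finite_measure ?M" by (intro finite_measureI) (simp add: emeasure_restrict_space)
  have "(\<lambda>K. LINT x|?M. \<bar>a x - clamp_abs (real K) (a x)\<bar>) \<longlonglongrightarrow> (LINT x|?M. 0)"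
  proof (rule integral_dominated_convergence[where w = "\<lambda>x. \<bar>a x\<bar>"])
    show "AE x in ?M. (\<lambda>K. \<bar>a x - clamp_abs (real K) (a x)\<bar>) \<longlonglongrightarrow> 0"
    proof (rule AE_I2)
      fix x
      have "\<forall>\<^sub>F K in sequentially. \<bar>a x - clamp_abs (real K) (a x)\<bar> = 0"
        using eventually_ge_at_top[of "nat \<lceil>\<bar>a x\<bar>\<rceil>"]
      proof eventually_elim
        case (elim K)
        then have "\<bar>a x\<bar> \<le> real K" by linarith
        then show ?case by (auto simp: clamp_abs_def)
      qed
      then show "(\<lambda>K. \<bar>a x - clamp_abs (real K) (a x)\<bar>) \<longlonglongrightarrow> 0" by (rule tendsto_eventually)
    qed
    show "AE x in ?M. norm \<bar>a x - clamp_abs (real K) (a x)\<bar> \<le> \<bar>a x\<bar>" for K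
      by (rule AE_I2) (auto simp: clamp_abs_def)
  qed (use a in auto)
  then have "\<forall>\<^sub>F K in sequentially. (LINT x|?M. \<bar>a x - clamp_abs (real K) (a x)\<bar>) < e / 2"
    using e by (intro order_tendstoD(2)[of _ 0]) auto
  then obtain K :: nat where K: "(LINT x|?M. \<bar>a x - clamp_abs (real K) (a x)\<bar>) < e / 2"
    by (auto simp: eventually_sequentially)
  obtain g where g: "\<And>n::nat. continuous_on UNIV (g n)" and lim: "AE x in ?M. (\<lambda>n. g n x) \<longlonglongrightarrow> a x"
    using measurable_AE_continuous_limit[OF borel_measurable_integrable[OF a]] by auto
  have cg: "continuous_on UNIV (\<lambda>x. clamp_abs (real K) (g n x))" for n by (intro continuous_intros g)
  note [measurable] = continuous_measurable_lebesgue_on[OF g] continuous_measurable_lebesgue_on[OF cg]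
  have intg: "integrable ?M (\<lambda>x. clamp_abs (real K) (g n x))" for n
    by (rule finite_measure.integrable_const_bound[OF fin, where B = K]) (auto simp: abs_clamp_abs_le)
  have inta: "integrable ?M (\<lambda>x. clamp_abs (real K) (a x))"
    by (rule finite_measure.integrable_const_bound[OF fin, where B = K]) (auto simp: abs_clamp_abs_le)
  have "(\<lambda>n. LINT x|?M. \<bar>clamp_abs (real K) (a x) - clamp_abs (real K) (g n x)\<bar>) \<longlonglongrightarrow> (LINT x|?M. 0)"
  proof (rule integral_dominated_convergence[where w = "\<lambda>x. 2 * real K"])
    show "AE x in ?M. (\<lambda>n. \<bar>clamp_abs (real K) (a x) - clamp_abs (real K) (g n x)\<bar>) \<longlonglongrightarrow> 0"
      using lim
    proof eventually_elim
      case (elim x)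
      have "isCont (clamp_abs (real K)) y" for y
        using continuous_clamp_abs[OF continuous_on_id, of UNIV K] by (simp add: continuous_on_eq_continuous_at)
      then have "(\<lambda>n. clamp_abs (real K) (g n x)) \<longlonglongrightarrow> clamp_abs (real K) (a x)"
        using elim by (rule isCont_tendsto_compose)
      from tendsto_rabs[OF tendsto_diff[OF tendsto_const[of "clamp_abs (real K) (a x)"] this]] show ?case by simp
    qed
    show "AE x in ?M. norm \<bar>clamp_abs (real K) (a x) - clamp_abs (real K) (g n x)\<bar> \<le> 2 * real K" for n
    proof (rule AE_I2)
      fix x
      show "norm \<bar>clamp_abs (real K) (a x) - clamp_abs (real K) (g n x)\<bar> \<le> 2 * real K"
        using abs_clamp_abs_le[of "real K" "a x"] abs_clamp_abs_le[of "real K" "g n x"] by simp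
    qed
    show "integrable ?M (\<lambda>x. 2 * real K)" by (rule finite_measure.integrable_const[OF fin])
  qed auto
  then have "\<forall>\<^sub>F n in sequentially. (LINT x|?M. \<bar>clamp_abs (real K) (a x) - clamp_abs (real K) (g n x)\<bar>) < e / 2"
    using e by (intro order_tendstoD(2)[of _ 0]) auto
  then obtain n where n: "(LINT x|?M. \<bar>clamp_abs (real K) (a x) - clamp_abs (real K) (g n x)\<bar>) < e / 2"
    by (auto simp: eventually_sequentially)
  have "(LINT x|?M. \<bar>a x - clamp_abs (real K) (g n x)\<bar>) \<le>
      (LINT x|?M. \<bar>a x - clamp_abs (real K) (a x)\<bar> + \<bar>clamp_abs (real K) (a x) - clamp_abs (real K) (g n x)\<bar>)"
    using a intg inta by (intro integral_mono) auto
  also have "\<dots> = (LINT x|?M. \<bar>a x - clamp_abs (real K) (a x)\<bar>) +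
      (LINT x|?M. \<bar>clamp_abs (real K) (a x) - clamp_abs (real K) (g n x)\<bar>)"
    using a intg inta by (intro Bochner_Integration.integral_add) auto
  finally have "(LINT x|?M. \<bar>a x - clamp_abs (real K) (g n x)\<bar>) < e" using K n by linarith
  with cg intg show ?thesis by blast
qed

text \<open>One sequence has to serve twice: L1 convergence controls the matrices, a.e. convergence
  the symbols. The second is obtained on a subsequence, which keeps the first.\<close>

theorem integrable_continuous_approx:
  fixes a :: "real \<Rightarrow> real"
  assumes a: "integrable (lebesgue_on {0..1}) a"
  shows "\<exists>g :: nat \<Rightarrow> real \<Rightarrow> real. (\<forall>m. continuous_on UNIV (g m)) \<and>
    (\<lambda>m. LINT x|lebesgue_on {0..1}. \<bar>a x - g m x\<bar>) \<longlonglongrightarrow> 0 \<and>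
    (AE x in lebesgue_on {0..1}. (\<lambda>m. g m x) \<longlonglongrightarrow> a x)"
proof -
  let ?M = "lebesgue_on {0..1::real}"
  have "\<forall>m. \<exists>g. continuous_on UNIV g \<and> (LINT x|?M. \<bar>a x - g x\<bar>) < inverse (real (Suc m)) \<and> integrable ?M g"
  proof
    fix m
    have "0 < inverse (real (Suc m))" by simp
    from integrable_L1_continuous_approx[OF a this]
    show "\<exists>g. continuous_on UNIV g \<and> (LINT x|?M. \<bar>a x - g x\<bar>) < inverse (real (Suc m)) \<and> integrable ?M g" .
  qed
  then obtain g where g: "\<And>m. continuous_on UNIV (g m)" "\<And>m. integrable ?M (g m)"
    and le: "\<And>m. (LINT x|?M. \<bar>a x - g m x\<bar>) < inverse (real (Suc m))" by metis
  have lim: "(\<lambda>m. LINT x|?M. norm (a x - g m x)) \<longlonglongrightarrow> 0"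
    unfolding real_norm_def
  proof (rule tendsto_sandwich[OF _ _ tendsto_const LIMSEQ_inverse_real_of_nat])
    show "\<forall>\<^sub>F m in sequentially. (LINT x|?M. \<bar>a x - g m x\<bar>) \<le> inverse (real (Suc m))"
      by (intro always_eventually allI less_imp_le le)
  qed (auto intro!: always_eventually Bochner_Integration.integral_nonneg)
  obtain r where r: "strict_mono r" "AE x in ?M. (\<lambda>n. a x - g (r n) x) \<longlonglongrightarrow> 0"
    using tendsto_L1_AE_subseq[OF _ lim] a g by auto
  show ?thesis
  proof (intro exI[of _ "\<lambda>m. g (r m)"] conjI allI)
    show "(\<lambda>m. LINT x|?M. \<bar>a x - g (r m) x\<bar>) \<longlonglongrightarrow> 0"
      using LIMSEQ_subseq_LIMSEQ[OF lim r(1)] by (simp add: comp_def)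
    show "AE x in ?M. (\<lambda>m. g (r m) x) \<longlonglongrightarrow> a x"
      using r(2)
    proof eventually_elim
      case (elim x)
      from tendsto_diff[OF tendsto_const[of "a x"] this] show ?case by simp
    qed
  qed (rule g)
qed

lemma riemann_sum_tendsto:
  fixes g :: "real \<Rightarrow> real"
  assumes g: "continuous_on {0..1} g"
  shows "(\<lambda>n. (\<Sum>i<n. g (real (i + 1) / real n)) / real n) \<longlonglongrightarrow> integral {0..1} g"
proof (rule LIMSEQ_I)
  fix e :: real assume e: "0 < e"
  have "uniformly_continuous_on {0..1} g" by (rule compact_uniformly_continuous[OF g]) simp
  then obtain d where d: "0 < d" "\<And>x y. x \<in> {0..1} \<Longrightarrow> y \<in> {0..1} \<Longrightarrow> \<bar>x - y\<bar> < d \<Longrightarrow> \<bar>g x - g y\<bar> < e / 2"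
    unfolding uniformly_continuous_on_def dist_real_def using e by (metis half_gt_zero)
  obtain N :: nat where N: "1 / d < real N" using reals_Archimedean2 by blast
  have "norm ((\<Sum>i<n. g (real (i + 1) / real n)) / real n - integral {0..1} g) < e" if n: "max N 1 \<le> n" for n
  proof -
    have n0: "0 < n" using n by simp
    have "1 / d < real n" using N n by (meson le_trans less_le_trans max.cobounded1 of_nat_mono)
    then have nd: "1 / real n < d" using n0 d(1) by (simp add: field_simps)
    have int: "g integrable_on {s..t}" if "0 \<le> s" "t \<le> 1" for s t
      using that g by (intro integrable_continuous_real) (auto intro: continuous_on_subset)
    have step: "\<bar>g (real (k + 1) / real n) / real n - integral {real k / real n..real (k + 1) / real n} g\<bar> \<le> e / 2 / real n"
      if k: "k < n" for k
    proof -
      let ?s = "real k / real n" let ?t = "real (k + 1) / real n"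
      have st: "0 \<le> ?s" "?s \<le> ?t" "?t \<le> 1" "?t - ?s = 1 / real n"
        using k n0 by (auto simp: field_simps)
      have "norm (integral {?s..?t} (\<lambda>x. g ?t - g x)) \<le> e / 2 * (?t - ?s)"
      proof (rule integral_bound[OF st(2)])
        show "continuous_on {?s..?t} (\<lambda>x. g ?t - g x)"
          using st by (intro continuous_intros continuous_on_subset[OF g]) auto
        fix x assume x: "x \<in> {?s..?t}"
        then have "\<bar>?t - x\<bar> < d" using st nd by auto
        moreover have "x \<in> {0..1}" "?t \<in> {0..1}"
          using x order_trans[OF st(1), of x] order_trans[OF _ st(3), of x] order_trans[OF st(1,2)] st(3) by auto
        ultimately have "\<bar>g ?t - g x\<bar> < e / 2" by (intro d(2)) auto
        then show "norm (g ?t - g x) \<le> e / 2" by simp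
      qed
      moreover have "integral {?s..?t} (\<lambda>x. g ?t - g x) = (?t - ?s) * g ?t - integral {?s..?t} g"
        using st int by (subst integral_diff) auto
      ultimately show ?thesis using st(4) by (simp add: mult.commute)
    qed
    have "integral {0..real k / real n} g = (\<Sum>i<k. integral {real i / real n..real (i + 1) / real n} g)" if "k \<le> n" for k
      using that
    proof (induction k)
      case (Suc k)
      have "integral {0..real k / real n} g + integral {real k / real n..real (Suc k) / real n} g = integral {0..real (Suc k) / real n} g"
        using Suc.prems n0 by (intro Henstock_Kurzweil_Integration.integral_combine int) (auto simp: field_simps)
      then show ?case using Suc by simp
    qed simp
    from this[of n] have tot: "integral {0..1} g = (\<Sum>i<n. integral {real i / real n..real (i + 1) / real n} g)"
      using n0 by simp
    have "norm ((\<Sum>i<n. g (real (i + 1) / real n)) / real n - integral {0..1} g) =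
        \<bar>\<Sum>i<n. g (real (i + 1) / real n) / real n - integral {real i / real n..real (i + 1) / real n} g\<bar>"
      by (simp add: tot sum_subtractf sum_divide_distrib)
    also have "\<dots> \<le> (\<Sum>i<n. e / 2 / real n)"
      by (rule order_trans[OF sum_abs sum_mono]) (use step in auto)
    also have "\<dots> < e" using n0 e by simp
    finally show ?thesis .
  qed
  then show "\<exists>no. \<forall>n\<ge>no. norm ((\<Sum>i<n. g (real (i + 1) / real n)) / real n - integral {0..1} g) < e" by blast
qed

section \<open>The domain \<open>[0, 1] \<times> [-\<pi>, \<pi>]\<close>\<close>

abbreviation glt_domain :: "(real \<times> real) set" where
  "glt_domain \<equiv> {0..1} \<times> {-pi..pi}"

lemma glt_domain_cbox: "glt_domain = cbox (0, -pi) (1, pi)"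
  by (simp add: cbox_Pair_eq)

lemma glt_domain_sets [simp]: "glt_domain \<in> sets lebesgue"
  by (simp add: glt_domain_cbox)

lemma emeasure_glt_domain: "emeasure lebesgue glt_domain = ennreal (2 * pi)"
  unfolding glt_domain_cbox by (subst emeasure_completion) (auto simp: emeasure_lborel_cbox_eq Basis_prod_def)

lemma measure_glt_domain: "measure lebesgue glt_domain = 2 * pi"
  using emeasure_glt_domain by (simp add: measure_def)

lemma AE_glt_domain_fst:
  assumes "AE x in lebesgue_on {0..1}. P x"
  shows "AE p in lebesgue_on glt_domain. P (fst p)"
proof -
  have "AE x in lebesgue. x \<in> {0..1} \<longrightarrow> P x" using assms by (simp add: AE_lebesgue_on_iff)
  then have "AE x in lborel. x \<in> {0..1} \<longrightarrow> P x" by (simp add: AE_completion_iff)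
  then obtain N where N: "N \<in> null_sets lborel" "{x. \<not> (x \<in> {0..1} \<longrightarrow> P x)} \<subseteq> N"
    unfolding eventually_ae_filter by auto
  have "N \<times> (UNIV :: real set) \<in> null_sets (lborel \<Otimes>\<^sub>M lborel)"
    by (rule lborel.times_in_null_sets1[OF N(1)]) simp
  then have "N \<times> (UNIV :: real set) \<in> null_sets lborel" by (simp add: lborel_prod)
  then have "AE p in lborel. p \<notin> N \<times> (UNIV :: real set)" by (rule AE_not_in)
  then have "AE p in lborel. p \<in> glt_domain \<longrightarrow> P (fst p)"
    by eventually_elim (use N(2) in auto)
  then show ?thesis by (simp add: AE_lebesgue_on_iff AE_completion_iff)
qed

text \<open>Measurability is expressed by continuous functions converging off a null set.
  Composition with \<open>fst\<close> preserves continuity, and the exceptional set becomes a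
  cylinder. The Borel null set \<open>N'\<close> covers \<open>N\<close>, so that the product
  measure shows this cylinder to be null.\<close>

lemma fst_measurable_glt_domain:
  fixes a :: "real \<Rightarrow> real"
  assumes a: "a \<in> borel_measurable (lebesgue_on {0..1})"
  shows "(\<lambda>p. a (fst p)) \<in> borel_measurable (lebesgue_on glt_domain)"
proof -
  obtain N g where N: "negligible N" and g: "\<And>n::nat. continuous_on UNIV (g n)"
    and lim: "\<And>x. x \<notin> N \<Longrightarrow> (\<lambda>n. g n x) \<longlonglongrightarrow> (if x \<in> {0..1} then a x else 0)"
    using a measurable_on_iff_borel_measurable[of "{0..1}" a] unfolding measurable_on_def by auto
  define b where "b = (\<lambda>x. if x \<in> {0..1} then a x else 0)"
  obtain N' where N': "N' \<in> null_sets lborel" "N \<subseteq> N'"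
    using N unfolding negligible_iff_null_sets null_sets_completion_iff2 by blast
  have "N' \<times> (UNIV :: real set) \<in> null_sets (lborel \<Otimes>\<^sub>M lborel)"
    by (rule lborel.times_in_null_sets1[OF N'(1)]) simp
  then have neg: "negligible (N' \<times> (UNIV :: real set))"
    by (simp add: lborel_prod negligible_iff_null_sets null_sets_completionI)
  have "(\<lambda>p :: real \<times> real. b (fst p)) measurable_on UNIV"
    unfolding measurable_on_def
  proof (intro exI conjI allI impI)
    show "negligible (N' \<times> (UNIV :: real set))" by (rule neg)
    show "continuous_on UNIV (\<lambda>p :: real \<times> real. g n (fst p))" for n
      by (rule continuous_on_compose2[OF g]) (auto intro: continuous_intros)
    show "(\<lambda>n. g n (fst p)) \<longlonglongrightarrow> (if p \<in> UNIV then b (fst p) else 0)" if "p \<notin> N' \<times> (UNIV :: real set)" for p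
    proof -
      have "fst p \<notin> N" using that N'(2) by (cases p) auto
      then show ?thesis using lim[of "fst p"] by (simp add: b_def)
    qed
  qed
  then have "(\<lambda>p :: real \<times> real. b (fst p)) \<in> borel_measurable lebesgue"
    using measurable_on_iff_borel_measurable[of UNIV "\<lambda>p :: real \<times> real. b (fst p)"] by simp
  then have "(\<lambda>p :: real \<times> real. b (fst p)) \<in> borel_measurable (lebesgue_on glt_domain)"
    by (rule measurable_restrict_space1)
  then show ?thesis by (rule measurable_cong[THEN iffD1, rotated]) (auto simp: b_def)
qed

text \<open>The indicators of the exceptional sets tend to 0 a.e. and are dominated by 1, which is
  integrable because \<open>D\<close> has finite measure.\<close>

lemma tendsto_in_measure_on_AE:
  fixes g :: "nat \<Rightarrow> 'a::euclidean_space \<Rightarrow> complex"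
  assumes D: "D \<in> sets lebesgue" "emeasure lebesgue D < \<infinity>"
    and g: "\<And>m. g m \<in> borel_measurable (lebesgue_on D)" and k: "\<kappa> \<in> borel_measurable (lebesgue_on D)"
    and lim: "AE p in lebesgue_on D. (\<lambda>m. g m p) \<longlonglongrightarrow> \<kappa> p"
  shows "tendsto_in_measure_on D g \<kappa>"
  unfolding tendsto_in_measure_on_def
proof (intro conjI allI impI)
  fix \<epsilon> :: real assume eps: "0 < \<epsilon>"
  note [measurable] = g k
  have fin: "finite_measure (lebesgue_on D)"
    using D by (intro finite_measureI) (simp add: emeasure_restrict_space less_top)
  define S where "S = (\<lambda>m. {p \<in> D. \<epsilon> < cmod (g m p - \<kappa> p)})"
  have S: "S m \<in> sets (lebesgue_on D)" for m
  proof -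
    have "{p \<in> space (lebesgue_on D). \<epsilon> < cmod (g m p - \<kappa> p)} \<in> sets (lebesgue_on D)" by measurable
    moreover have "space (lebesgue_on D) = D" by simp
    ultimately show ?thesis by (simp only: S_def)
  qed
  have "(\<lambda>m. LINT p|lebesgue_on D. indicator (S m) p :: real) \<longlonglongrightarrow> (LINT p|lebesgue_on D. 0)"
  proof (rule integral_dominated_convergence[where w = "\<lambda>_. 1"])
    show "AE p in lebesgue_on D. (\<lambda>m. indicator (S m) p :: real) \<longlonglongrightarrow> 0"
      using lim
    proof eventually_elim
      case (elim p)
      then have "\<forall>\<^sub>F m in sequentially. cmod (g m p - \<kappa> p) < \<epsilon>"
        using eps by (auto simp: tendsto_iff dist_norm)
      then have "\<forall>\<^sub>F m in sequentially. (indicator (S m) p :: real) = 0"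
        by eventually_elim (auto simp: S_def indicator_def)
      then show ?case by (rule tendsto_eventually)
    qed
    show "integrable (lebesgue_on D) (\<lambda>_. 1 :: real)" by (rule finite_measure.integrable_const[OF fin])
  qed (use S in \<open>auto simp: indicator_def\<close>)
  moreover have "(LINT p|lebesgue_on D. indicator (S m) p :: real) = measure (lebesgue_on D) (S m)" for m
    using S[of m] sets.sets_into_space[OF S[of m]] by (simp add: Int_absorb2)
  ultimately have "(\<lambda>m. measure (lebesgue_on D) (S m)) \<longlonglongrightarrow> 0" by simp
  then have "(\<lambda>m. ennreal (measure (lebesgue_on D) (S m))) \<longlonglongrightarrow> ennreal 0" by (rule tendsto_ennrealI)
  moreover have "ennreal (measure (lebesgue_on D) (S m)) = emeasure lebesgue (S m)" for m
  proof -
    have "emeasure (lebesgue_on D) (S m) = emeasure lebesgue (S m)"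
      by (rule emeasure_restrict_space) (use D(1) in \<open>simp_all add: S_def\<close>)
    then show ?thesis using finite_measure.emeasure_eq_measure[OF fin, of "S m"] by (simp only:)
  qed
  ultimately show "(\<lambda>m. emeasure lebesgue {p \<in> D. \<epsilon> < cmod (g m p - \<kappa> p)}) \<longlonglongrightarrow> 0"
    by (simp only: S_def ennreal_0)
qed (use g k in auto)

lemma symbol_mean_tendsto:
  fixes g :: "nat \<Rightarrow> 'a::euclidean_space \<Rightarrow> complex"
  assumes D: "D \<in> sets lebesgue" "emeasure lebesgue D < \<infinity>"
    and g: "\<And>m. g m \<in> borel_measurable (lebesgue_on D)" and k: "\<kappa> \<in> borel_measurable (lebesgue_on D)"
    and lim: "AE p in lebesgue_on D. (\<lambda>m. g m p) \<longlonglongrightarrow> \<kappa> p" and B: "\<And>m p. cmod (g m p) \<le> B"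
  shows "(\<lambda>m. symbol_mean D (g m)) \<longlonglongrightarrow> symbol_mean D \<kappa>"
proof -
  have fin: "finite_measure (lebesgue_on D)"
    using D by (intro finite_measureI) (simp add: emeasure_restrict_space less_top)
  have "(\<lambda>m. LINT p|lebesgue_on D. g m p) \<longlonglongrightarrow> (LINT p|lebesgue_on D. \<kappa> p)"
    by (rule integral_dominated_convergence[where w = "\<lambda>_. B"])
      (use g k lim B finite_measure.integrable_const[OF fin] in auto)
  then show ?thesis unfolding symbol_mean_def divide_inverse by (intro tendsto_mult tendsto_const)
qed

lemma symbol_mean_product:
  fixes g h :: "real \<Rightarrow> real"
  assumes g: "continuous_on UNIV g" and h: "continuous_on UNIV h"
  shows "symbol_mean glt_domain (\<lambda>p. of_real (g (fst p) * h (snd p))) =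
    of_real (integral {0..1} g * (integral {-pi..pi} h / (2 * pi)))"
proof -
  have c: "continuous_on UNIV (\<lambda>p :: real \<times> real. g (fst p) * h (snd p))"
    by (intro continuous_intros continuous_on_compose2[OF g] continuous_on_compose2[OF h]) auto
  have "(LINT p|lebesgue_on glt_domain. g (fst p) * h (snd p)) = integral glt_domain (\<lambda>p. g (fst p) * h (snd p))"
    unfolding glt_domain_cbox using c
    by (intro lebesgue_integral_eq_integral continuous_imp_integrable) (auto intro: continuous_on_subset)
  also have "\<dots> = integral {0..1} (\<lambda>x. integral {-pi..pi} (\<lambda>y. g x * h y))"
    unfolding glt_domain_cbox
    using integral_prod_continuous[OF continuous_on_subset[OF c subset_UNIV], of 0 "-pi" 1 pi] by simp
  also have "\<dots> = integral {0..1} g * integral {-pi..pi} h" by simp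
  finally have "(LINT p|lebesgue_on glt_domain. complex_of_real (g (fst p) * h (snd p))) =
      of_real (integral {0..1} g * integral {-pi..pi} h)"
    unfolding integral_complex_of_real by simp
  then show ?thesis unfolding symbol_mean_def measure_glt_domain by simp
qed

section \<open>Moments of the Laplacian symbol\<close>

definition lap_coeff :: "nat \<Rightarrow> int \<Rightarrow> complex" where
  "lap_coeff p = fourier_coeff (\<lambda>\<theta>. of_real ((2 - 2 * cos \<theta>) ^ p))"

lemma lap_coeff_integrable:
  "integrable (lebesgue_on {-pi..pi}) (\<lambda>\<theta>. complex_of_real ((2 - 2 * cos \<theta>) ^ p) * exp (- \<i> * of_int k * of_real \<theta>))"
  by (intro continuous_imp_integrable_real continuous_intros)

lemma lap_coeff_0: "lap_coeff 0 k = (if k = 0 then 1 else 0)"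
proof (cases "k = 0")
  case True
  then show ?thesis by (simp add: lap_coeff_def fourier_coeff_def scaleR_conv_of_real measure_restrict_space)
next
  case False
  have "((\<lambda>\<theta>. exp (- \<i> * of_int k * complex_of_real \<theta>)) has_integral
      exp (- \<i> * of_int k * of_real pi) / (- \<i> * of_int k) - exp (- \<i> * of_int k * of_real (- pi)) / (- \<i> * of_int k)) {-pi..pi}"
  proof (intro fundamental_theorem_of_calculus)
    fix x :: real
    have "((\<lambda>z. exp (- \<i> * of_int k * z) / (- \<i> * of_int k)) has_field_derivative exp (- \<i> * of_int k * of_real x))
        (at (of_real x))"
      using False by (auto intro!: derivative_eq_intros)
    then show "((\<lambda>\<theta>. exp (- \<i> * of_int k * of_real \<theta>) / (- \<i> * of_int k)) has_vector_derivative
        exp (- \<i> * of_int k * of_real x)) (at x within {-pi..pi})"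
      by (rule has_vector_derivative_real_field)
  qed simp
  moreover have "exp (- \<i> * of_int k * of_real pi) = exp (- \<i> * of_int k * of_real (- pi))"
    unfolding exp_eq by (intro exI[of _ "- k"]) (simp add: algebra_simps)
  ultimately have "integral {-pi..pi} (\<lambda>\<theta>. exp (- \<i> * of_int k * complex_of_real \<theta>)) = 0"
    by (simp add: integral_unique)
  moreover have "(LINT \<theta>|lebesgue_on {-pi..pi}. exp (- \<i> * of_int k * complex_of_real \<theta>)) =
      integral {-pi..pi} (\<lambda>\<theta>. exp (- \<i> * of_int k * complex_of_real \<theta>))"
    by (intro lebesgue_integral_eq_integral continuous_imp_integrable_real continuous_intros) auto
  ultimately show ?thesis using False by (simp add: lap_coeff_def fourier_coeff_def)
qed

text \<open>Writing \<open>2 cos \<theta>\<close> as a sum of two exponentials, multiplication by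
  \<open>2 - 2 cos \<theta>\<close> becomes a negative second difference of Fourier coefficients.
  Together with \<open>lap_coeff_0\<close> this recursion yields the support, the growth
  \<open>4 ^ p\<close> and the stencil 2, -1.\<close>

lemma lap_coeff_Suc: "lap_coeff (Suc p) k = 2 * lap_coeff p k - lap_coeff p (k - 1) - lap_coeff p (k + 1)"
proof -
  let ?E = "\<lambda>k \<theta>. exp (- \<i> * of_int k * complex_of_real \<theta>)"
  let ?g = "\<lambda>\<theta>. complex_of_real ((2 - 2 * cos \<theta>) ^ p)"
  have "complex_of_real ((2 - 2 * cos \<theta>) ^ Suc p) * ?E k \<theta> =
      2 * (?g \<theta> * ?E k \<theta>) - ?g \<theta> * ?E (k - 1) \<theta> - ?g \<theta> * ?E (k + 1) \<theta>" for \<theta>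
  proof -
    have "2 * of_real (cos \<theta>) = exp (\<i> * of_real \<theta>) + exp (- \<i> * complex_of_real \<theta>)"
      by (simp add: cos_of_real[symmetric] cos_exp_eq)
    moreover have "?E (k - 1) \<theta> = exp (\<i> * of_real \<theta>) * ?E k \<theta>" "?E (k + 1) \<theta> = exp (- \<i> * of_real \<theta>) * ?E k \<theta>"
      by (simp_all add: exp_add[symmetric] algebra_simps)
    moreover have "((2 - 2 * c) * g) * E = 2 * (g * E) - g * (e1 * E) - g * (e2 * E)"
      if "2 * c = e1 + e2" for c g E e1 e2 :: complex
      unfolding that by (simp add: algebra_simps)
    moreover have "complex_of_real ((2 - 2 * cos \<theta>) ^ Suc p) = (2 - 2 * of_real (cos \<theta>)) * ?g \<theta>"
      by simp
    ultimately show ?thesis by presburger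
  qed
  then have "(LINT \<theta>|lebesgue_on {-pi..pi}. complex_of_real ((2 - 2 * cos \<theta>) ^ Suc p) * ?E k \<theta>) =
    2 * (LINT \<theta>|lebesgue_on {-pi..pi}. ?g \<theta> * ?E k \<theta>) - (LINT \<theta>|lebesgue_on {-pi..pi}. ?g \<theta> * ?E (k - 1) \<theta>)
      - (LINT \<theta>|lebesgue_on {-pi..pi}. ?g \<theta> * ?E (k + 1) \<theta>)"
    using lap_coeff_integrable[of p k] lap_coeff_integrable[of p "k - 1"] lap_coeff_integrable[of p "k + 1"]
    by (simp only: Bochner_Integration.integral_diff Bochner_Integration.integrable_diff
        integrable_mult_right integral_mult_right_zero)
  then show ?thesis
    by (simp add: lap_coeff_def fourier_coeff_def diff_divide_distrib)
qed

lemma lap_coeff_support: "int p < \<bar>k\<bar> \<Longrightarrow> lap_coeff p k = 0"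
proof (induction p arbitrary: k)
  case 0 then show ?case by (simp add: lap_coeff_0)
next
  case (Suc p)
  then have "int p < \<bar>k\<bar>" "int p < \<bar>k - 1\<bar>" "int p < \<bar>k + 1\<bar>" by auto
  then show ?case using Suc.IH by (simp add: lap_coeff_Suc)
qed

lemma cmod_lap_coeff_le: "cmod (lap_coeff p k) \<le> 4 ^ p"
proof (induction p arbitrary: k)
  case (Suc p)
  have "cmod (lap_coeff (Suc p) k) \<le> 2 * cmod (lap_coeff p k) + cmod (lap_coeff p (k - 1)) + cmod (lap_coeff p (k + 1))"
    unfolding lap_coeff_Suc
    by (intro order_trans[OF norm_triangle_ineq4] add_mono) (auto simp: norm_mult)
  also have "\<dots> \<le> 4 ^ Suc p" using Suc[of k] Suc[of "k - 1"] Suc[of "k + 1"] by simp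
  finally show ?case .
qed (simp add: lap_coeff_0)

lemma lap_coeff_1: "lap_coeff 1 k = (if k = 0 then 2 else if \<bar>k\<bar> = 1 then -1 else 0)"
proof -
  have "lap_coeff 1 k = 2 * lap_coeff 0 k - lap_coeff 0 (k - 1) - lap_coeff 0 (k + 1)"
    unfolding One_nat_def lap_coeff_Suc ..
  then show ?thesis by (auto simp: lap_coeff_0)
qed

lemma lap_coeff_at_0: "lap_coeff p 0 = of_real (integral {-pi..pi} (\<lambda>\<theta>. (2 - 2 * cos \<theta>) ^ p) / (2 * pi))"
proof -
  have "(LINT \<theta>|lebesgue_on {-pi..pi}. complex_of_real ((2 - 2 * cos \<theta>) ^ p)) =
      of_real (LINT \<theta>|lebesgue_on {-pi..pi}. (2 - 2 * cos \<theta>) ^ p)"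
    by (rule integral_complex_of_real)
  also have "(LINT \<theta>|lebesgue_on {-pi..pi}. (2 - 2 * cos \<theta>) ^ p) = integral {-pi..pi} (\<lambda>\<theta>. (2 - 2 * cos \<theta>) ^ p)"
    by (intro lebesgue_integral_eq_integral continuous_imp_integrable_real continuous_intros) auto
  finally show ?thesis by (simp add: lap_coeff_def fourier_coeff_def)
qed

section \<open>Band sums and the entrywise norm of products\<close>

lemma card_near_le: "card {j. j < n \<and> \<bar>c - int j\<bar> \<le> int p} \<le> 2 * p + 1"
proof -
  have "int ` {j. j < n \<and> \<bar>c - int j\<bar> \<le> int p} \<subseteq> {c - int p..c + int p}" by auto
  then have "card (int ` {j. j < n \<and> \<bar>c - int j\<bar> \<le> int p}) \<le> card {c - int p..c + int p}"
    by (intro card_mono) auto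
  then show ?thesis by (simp add: card_image)
qed

text \<open>The centre \<open>c\<close> is an integer because the boundary terms form bands around
  the positions \<open>-1\<close> and \<open>n\<close>, outside the index range.\<close>

lemma sum_near_le:
  fixes f :: "nat \<Rightarrow> real"
  assumes "\<And>j. j < n \<Longrightarrow> \<bar>c - int j\<bar> \<le> int p \<Longrightarrow> f j \<le> b"
    and "\<And>j. j < n \<Longrightarrow> int p < \<bar>c - int j\<bar> \<Longrightarrow> f j = 0" and b: "0 \<le> b"
  shows "(\<Sum>j<n. f j) \<le> (2 * real p + 1) * b"
proof -
  let ?J = "{j. j < n \<and> \<bar>c - int j\<bar> \<le> int p}"
  have "(\<Sum>j<n. f j) = (\<Sum>j\<in>?J. f j)"
    using assms(2) by (intro sum.mono_neutral_right) force+
  also have "\<dots> \<le> (\<Sum>j\<in>?J. b)" using assms(1) by (intro sum_mono) auto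
  also have "\<dots> = real (card ?J) * b" by simp
  also have "\<dots> \<le> real (2 * p + 1) * b" by (intro mult_right_mono of_nat_mono card_near_le b)
  finally show ?thesis by (simp add: algebra_simps)
qed

lemma mat_l1_triangle:
  assumes "A \<in> carrier_mat n n" "B \<in> carrier_mat n n"
  shows "mat_l1 (A + B) \<le> mat_l1 A + mat_l1 B"
proof -
  have "mat_l1 (A + B) = (\<Sum>i<n. \<Sum>j<n. cmod (A $$ (i, j) + B $$ (i, j)))"
    using assms by (simp add: mat_l1_def)
  also have "\<dots> \<le> (\<Sum>i<n. \<Sum>j<n. cmod (A $$ (i, j)) + cmod (B $$ (i, j)))"
    by (intro sum_mono norm_triangle_ineq)
  also have "\<dots> = mat_l1 A + mat_l1 B"
    using assms by (simp add: mat_l1_def sum.distrib)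
  finally show ?thesis .
qed

lemma mat_l1_mult_le:
  assumes A: "A \<in> carrier_mat n n" and B: "B \<in> carrier_mat n n"
    and row: "\<And>k. k < n \<Longrightarrow> (\<Sum>j<n. cmod (B $$ (k, j))) \<le> R"
  shows "mat_l1 (A * B) \<le> mat_l1 A * R"
proof -
  have "mat_l1 (A * B) \<le> (\<Sum>i<n. \<Sum>j<n. \<Sum>k<n. cmod (A $$ (i, k)) * cmod (B $$ (k, j)))"
    using A B unfolding mat_l1_def
    by (auto simp: mult_mat_index_sum[OF A B] norm_mult simp del: index_mult_mat(1) intro!: sum_mono sum_norm_le)
  also have "\<dots> = (\<Sum>i<n. \<Sum>k<n. cmod (A $$ (i, k)) * (\<Sum>j<n. cmod (B $$ (k, j))))"
    unfolding sum_distrib_left by (intro sum.cong refl sum.swap)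
  also have "\<dots> \<le> (\<Sum>i<n. \<Sum>k<n. cmod (A $$ (i, k)) * R)"
    using row by (intro sum_mono mult_left_mono) auto
  also have "\<dots> = mat_l1 A * R" using A by (simp add: mat_l1_def sum_distrib_right)
  finally show ?thesis .
qed

text \<open>Over all integers \<open>k\<close> the convolution is exactly
  \<open>lap_coeff (Suc p)\<close>. The range \<open>k < n\<close> misses \<open>k = -1\<close> when
  \<open>j = 0\<close> and \<open>k = n\<close> when \<open>j = n - 1\<close>, each with weight -1,
  whence the plus signs.\<close>

lemma lap_coeff_truncated_convolution:
  assumes "i < n" "j < n"
  shows "(\<Sum>k<n. lap_coeff p (int i - int k) * lap_coeff 1 (int k - int j)) - lap_coeff (Suc p) (int i - int j) =
    (if j = 0 then lap_coeff p (int i + 1) else 0) + (if Suc j = n then lap_coeff p (int i - int n) else 0)"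
proof -
  have "(\<Sum>k<n. lap_coeff p (int i - int k) * lap_coeff 1 (int k - int j)) =
    (\<Sum>k<n. (if k = j then 2 * lap_coeff p (int i - int j) else 0) -
      (if k = Suc j then lap_coeff p (int i - int j - 1) else 0) -
      (if j = Suc k then lap_coeff p (int i - int j + 1) else 0))"
    by (intro sum.cong refl) (auto simp: lap_coeff_1[unfolded One_nat_def] algebra_simps)
  also have "\<dots> = 2 * lap_coeff p (int i - int j) -
      (if Suc j < n then lap_coeff p (int i - int j - 1) else 0) -
      (if 0 < j then lap_coeff p (int i - int j + 1) else 0)"
  proof -
    have "(\<Sum>k<n. if j = Suc k then lap_coeff p (int i - int j + 1) else 0) =
        (if 0 < j then lap_coeff p (int i - int j + 1) else 0)"
      using assms by (cases j) auto
    then show ?thesis using assms by (simp add: sum_subtractf)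
  qed
  finally show ?thesis
    using assms unfolding lap_coeff_Suc by (auto simp: algebra_simps)
qed

text \<open>The Toeplitz matrix of the \<open>p\<close>-th power of
  \<open>2 - 2 cos \<theta>\<close> with row \<open>i\<close> scaled by \<open>A i ^ p\<close>: up
  to boundary effects, the power that results when the coefficient is treated as constant near row
  \<open>i\<close>.\<close>

definition frozen_power :: "nat \<Rightarrow> (nat \<Rightarrow> real) \<Rightarrow> nat \<Rightarrow> complex mat" where
  "frozen_power n A p = Matrix.mat n n (\<lambda>(i, j). of_real (A i ^ p) * lap_coeff p (int i - int j))"

lemma mat_minus_telescope:
  fixes A :: "complex mat"
  assumes "A \<in> carrier_mat n m" "B \<in> carrier_mat n m" "C \<in> carrier_mat n m"
  shows "A - C = (A - B) + (B - C)"
  using assms by (intro eq_matI) auto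

lemma frozen_power_step:
  fixes X :: "complex mat" and A :: "nat \<Rightarrow> real"
  assumes X: "X \<in> carrier_mat n n"
    and band: "\<And>i j. i < n \<Longrightarrow> j < n \<Longrightarrow> 1 < \<bar>int i - int j\<bar> \<Longrightarrow> X $$ (i, j) = 0"
    and close: "\<And>i j. i < n \<Longrightarrow> j < n \<Longrightarrow> cmod (X $$ (i, j) - of_real (A i) * lap_coeff 1 (int i - int j)) \<le> d"
    and K: "\<And>i. i < n \<Longrightarrow> \<bar>A i\<bar> \<le> K"
    and osc: "\<And>i k. i < n \<Longrightarrow> k < n \<Longrightarrow> \<bar>int i - int k\<bar> \<le> int p \<Longrightarrow> \<bar>A i - A k\<bar> \<le> w"
    and row: "\<And>k. k < n \<Longrightarrow> (\<Sum>j<n. cmod (X $$ (k, j))) \<le> R"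
    and nn: "0 \<le> d" "0 \<le> w" "0 \<le> K"
  shows "mat_l1 (X ^\<^sub>m Suc p - frozen_power n A (Suc p)) \<le> mat_l1 (X ^\<^sub>m p - frozen_power n A p) * R +
    real n * ((2 * real p + 1) * (K ^ p * 4 ^ p * (3 * (d + 4 * w)))) + K ^ Suc p * (2 * ((2 * real p + 1) * 4 ^ p))"
proof -
  let ?Y = "frozen_power n A"
  have Y: "?Y q \<in> carrier_mat n n" for q by (simp add: frozen_power_def)
  have Xp: "X ^\<^sub>m q \<in> carrier_mat n n" for q using X by simp
  have YX: "?Y p * X \<in> carrier_mat n n" using X Y[of p] by auto
  define M where "M = ?Y p * X - ?Y (Suc p)"
  have M: "M \<in> carrier_mat n n" unfolding M_def using Y[of "Suc p"] by (rule minus_carrier_mat)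
  have D: "X ^\<^sub>m p - ?Y p \<in> carrier_mat n n" using Y[of p] by (rule minus_carrier_mat)
  have "X ^\<^sub>m Suc p - ?Y (Suc p) = (X ^\<^sub>m p - ?Y p) * X + M"
  proof -
    have "(X ^\<^sub>m p - ?Y p) * X = X ^\<^sub>m p * X - ?Y p * X"
      by (rule minus_mult_distrib_mat[OF Xp Y X])
    moreover have "X ^\<^sub>m p * X - ?Y (Suc p) = (X ^\<^sub>m p * X - ?Y p * X) + (?Y p * X - ?Y (Suc p))"
      by (rule mat_minus_telescope[OF mult_carrier_mat[OF Xp X] YX Y])
    ultimately show ?thesis by (simp only: M_def pow_mat.simps)
  qed
  then have "mat_l1 (X ^\<^sub>m Suc p - ?Y (Suc p)) \<le> mat_l1 ((X ^\<^sub>m p - ?Y p) * X) + mat_l1 M"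
    using mat_l1_triangle[OF mult_carrier_mat[OF D X] M] by (simp only:)
  moreover have "mat_l1 ((X ^\<^sub>m p - ?Y p) * X) \<le> mat_l1 (X ^\<^sub>m p - ?Y p) * R"
    by (rule mat_l1_mult_le[OF D X row])
  moreover have "mat_l1 M \<le> real n * ((2 * real p + 1) * (K ^ p * 4 ^ p * (3 * (d + 4 * w)))) +
      K ^ Suc p * (2 * ((2 * real p + 1) * 4 ^ p))"
  proof -
    let ?t = "\<lambda>i k. lap_coeff p (int i - int k)"
    \<comment> \<open>\<open>F\<close> is the cost of replacing row \<open>k\<close> by the stencil
      frozen at row \<open>i\<close>; \<open>G\<close> is the boundary defect of the truncated
      convolution.\<close>
    define F where "F = (\<lambda>i k j. cmod (of_real (A i ^ p) * ?t i k * (X $$ (k, j) - of_real (A i) * lap_coeff 1 (int k - int j))))"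
    define G where "G = (\<lambda>i j. (if j = 0 then cmod (lap_coeff p (int i + 1)) else 0) + (if Suc j = n then cmod (lap_coeff p (int i - int n)) else 0))"
    have entry: "cmod (M $$ (i, j)) \<le> (\<Sum>k<n. F i k j) + K ^ Suc p * G i j" if ij: "i < n" "j < n" for i j
    proof -
      let ?B = "(\<Sum>k<n. ?t i k * lap_coeff 1 (int k - int j)) - lap_coeff (Suc p) (int i - int j)"
      have "M $$ (i, j) = (\<Sum>k<n. of_real (A i ^ p) * ?t i k * X $$ (k, j)) - of_real (A i ^ Suc p) * lap_coeff (Suc p) (int i - int j)"
        using ij YX Y[of p] Y[of "Suc p"]
        by (simp add: M_def mult_mat_index_sum[OF Y X] del: index_mult_mat(1)) (simp add: frozen_power_def)
      also have "\<dots> = (\<Sum>k<n. of_real (A i ^ p) * ?t i k * (X $$ (k, j) - of_real (A i) * lap_coeff 1 (int k - int j))) +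
          of_real (A i ^ Suc p) * ?B"
        by (simp add: sum_subtractf sum_distrib_left algebra_simps)
      finally have "cmod (M $$ (i, j)) \<le> cmod (\<Sum>k<n. of_real (A i ^ p) * ?t i k * (X $$ (k, j) - of_real (A i) * lap_coeff 1 (int k - int j))) +
          cmod (of_real (A i ^ Suc p) * ?B)"
        by (simp only: norm_triangle_ineq)
      also have "\<dots> \<le> (\<Sum>k<n. F i k j) + K ^ Suc p * G i j"
      proof (rule add_mono)
        show "cmod (\<Sum>k<n. of_real (A i ^ p) * ?t i k * (X $$ (k, j) - of_real (A i) * lap_coeff 1 (int k - int j))) \<le> (\<Sum>k<n. F i k j)"
          unfolding F_def by (rule norm_sum)
        have "cmod ?B \<le> G i j"
          unfolding lap_coeff_truncated_convolution[OF ij] G_def by (auto intro: norm_triangle_le)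
        moreover have "cmod (of_real (A i ^ Suc p)) \<le> K ^ Suc p"
          using power_mono[OF K[OF ij(1)], of "Suc p"] by (simp only: norm_of_real power_abs abs_ge_zero)
        ultimately show "cmod (of_real (A i ^ Suc p) * ?B) \<le> K ^ Suc p * G i j"
          unfolding norm_mult using nn by (intro mult_mono) auto
      qed
      finally show ?thesis .
    qed
    have inner: "(\<Sum>j<n. F i k j) \<le> K ^ p * 4 ^ p * (3 * (d + 4 * w))"
      if ik: "i < n" "k < n" "\<bar>int i - int k\<bar> \<le> int p" for i k
    proof -
      have "(\<Sum>j<n. F i k j) \<le> (2 * real 1 + 1) * (K ^ p * 4 ^ p * (d + 4 * w))"
      proof (rule sum_near_le[where c = "int k"])
        fix j assume j: "j < n" "\<bar>int k - int j\<bar> \<le> int 1"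
        have "cmod (X $$ (k, j) - of_real (A i) * lap_coeff 1 (int k - int j)) \<le>
          cmod (X $$ (k, j) - of_real (A k) * lap_coeff 1 (int k - int j)) + cmod (of_real (A k - A i) * lap_coeff 1 (int k - int j))"
          by (rule order_trans[OF _ norm_triangle_ineq]) (simp add: algebra_simps)
        also have "\<dots> \<le> d + w * 4"
        proof (rule add_mono[OF close[OF ik(2) j(1)]])
          show "cmod (of_real (A k - A i) * lap_coeff 1 (int k - int j)) \<le> w * 4"
            unfolding norm_mult norm_of_real
            using osc[OF ik] cmod_lap_coeff_le[of 1 "int k - int j"] nn
            by (intro mult_mono) (auto simp: abs_minus_commute)
        qed
        finally have 1: "cmod (X $$ (k, j) - of_real (A i) * lap_coeff 1 (int k - int j)) \<le> d + 4 * w" by simp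
        have 2: "cmod (of_real (A i ^ p) * ?t i k) \<le> K ^ p * 4 ^ p"
          unfolding norm_mult using power_mono[OF K[OF ik(1)], of p] cmod_lap_coeff_le nn
          by (intro mult_mono) (auto simp: norm_power)
        show "F i k j \<le> K ^ p * 4 ^ p * (d + 4 * w)"
          unfolding F_def norm_mult[of "of_real (A i ^ p) * ?t i k"] using 1 2 nn by (intro mult_mono) auto
      next
        fix j assume j: "j < n" "int 1 < \<bar>int k - int j\<bar>"
        then show "F i k j = 0" using band[OF ik(2) j(1)] lap_coeff_support[of 1 "int k - int j"] by (simp add: F_def)
      qed (use nn in auto)
      also have "\<dots> = K ^ p * 4 ^ p * (3 * (d + 4 * w))" by (simp add: algebra_simps)
      finally show ?thesis .
    qed
    have FF: "(\<Sum>k<n. \<Sum>j<n. F i k j) \<le> (2 * real p + 1) * (K ^ p * 4 ^ p * (3 * (d + 4 * w)))" if i: "i < n" for i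
    proof (rule sum_near_le[where c = "int i"])
      show "(\<Sum>j<n. F i k j) = 0" if "k < n" "int p < \<bar>int i - int k\<bar>" for k
        using lap_coeff_support[OF that(2)] by (simp add: F_def)
    qed (use inner i nn in auto)
    have GG: "(\<Sum>i<n. \<Sum>j<n. G i j) \<le> 2 * ((2 * real p + 1) * 4 ^ p)"
    proof -
      have "(\<Sum>i<n. \<Sum>j<n. G i j) = (\<Sum>i<n. cmod (lap_coeff p (int i + 1))) + (\<Sum>i<n. cmod (lap_coeff p (int i - int n)))"
      proof (cases n)
        case (Suc m)
        have "(\<Sum>j<n. G i j) = cmod (lap_coeff p (int i + 1)) + cmod (lap_coeff p (int i - int n))" for i
          by (simp add: sum.distrib Suc G_def)
        then show ?thesis by (simp only: sum.distrib)
      qed (simp add: G_def)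
      also have "\<dots> \<le> (2 * real p + 1) * 4 ^ p + (2 * real p + 1) * 4 ^ p"
      proof (rule add_mono)
        show "(\<Sum>i<n. cmod (lap_coeff p (int i + 1))) \<le> (2 * real p + 1) * 4 ^ p"
          by (rule sum_near_le[where c = "- 1"]) (auto intro!: cmod_lap_coeff_le lap_coeff_support)
        show "(\<Sum>i<n. cmod (lap_coeff p (int i - int n))) \<le> (2 * real p + 1) * 4 ^ p"
          by (rule sum_near_le[where c = "int n"]) (auto intro!: cmod_lap_coeff_le lap_coeff_support)
      qed
      finally show ?thesis by (simp only: mult_2)
    qed
    have "mat_l1 M \<le> (\<Sum>i<n. \<Sum>j<n. (\<Sum>k<n. F i k j) + K ^ Suc p * G i j)"
    proof -
      have "mat_l1 M = (\<Sum>i<n. \<Sum>j<n. cmod (M $$ (i, j)))" using M by (simp add: mat_l1_def)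
      also have "\<dots> \<le> (\<Sum>i<n. \<Sum>j<n. (\<Sum>k<n. F i k j) + K ^ Suc p * G i j)"
        by (intro sum_mono entry) auto
      finally show ?thesis .
    qed
    also have "\<dots> = (\<Sum>i<n. \<Sum>k<n. \<Sum>j<n. F i k j) + K ^ Suc p * (\<Sum>i<n. \<Sum>j<n. G i j)"
    proof -
      have "(\<Sum>j<n. \<Sum>k<n. F i k j) = (\<Sum>k<n. \<Sum>j<n. F i k j)" for i by (rule sum.swap)
      then show ?thesis by (simp only: sum.distrib sum_distrib_left)
    qed
    also have "\<dots> \<le> (\<Sum>i<n. (2 * real p + 1) * (K ^ p * 4 ^ p * (3 * (d + 4 * w)))) + K ^ Suc p * (2 * ((2 * real p + 1) * 4 ^ p))"
      using FF nn by (intro add_mono sum_mono mult_left_mono GG) auto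
    also have "\<dots> = real n * ((2 * real p + 1) * (K ^ p * 4 ^ p * (3 * (d + 4 * w)))) + K ^ Suc p * (2 * ((2 * real p + 1) * 4 ^ p))"
      by simp
    finally show ?thesis .
  qed
  ultimately show ?thesis by linarith
qed

section \<open>Moments of sampled Laplacians\<close>

lemma bounded_on_unit_interval:
  fixes \<alpha> :: "real \<Rightarrow> real"
  assumes "continuous_on UNIV \<alpha>" shows "\<exists>K\<ge>0. \<forall>x\<in>{0..1}. \<bar>\<alpha> x\<bar> \<le> K"
proof -
  have "compact (\<alpha> ` {0..1})"
    by (rule compact_continuous_image[OF continuous_on_subset[OF assms]]) auto
  then obtain K where "\<forall>x\<in>{0..1}. \<bar>\<alpha> x\<bar> \<le> K" unfolding compact_eq_bounded_closed bounded_iff by auto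
  then show ?thesis by (intro exI[of _ "max K 0"]) (auto simp: le_max_iff_disj)
qed

text \<open>The modulus of continuity at scale \<open>c / n\<close>, a null sequence by uniform
  continuity on the compact interval. At \<open>n = 0\<close> division by zero makes the scale 0, so
  the claim remains meaningful.\<close>

lemma uniform_modulus:
  fixes \<alpha> :: "real \<Rightarrow> real"
  assumes "continuous_on UNIV \<alpha>" and c: "0 \<le> c"
  shows "\<exists>w :: nat \<Rightarrow> real. w \<longlonglongrightarrow> 0 \<and> (\<forall>n. 0 \<le> w n) \<and>
    (\<forall>n. \<forall>x\<in>{0..1}. \<forall>y\<in>{0..1}. \<bar>x - y\<bar> \<le> c / real n \<longrightarrow> \<bar>\<alpha> x - \<alpha> y\<bar> \<le> w n)"
proof -
  let ?S = "\<lambda>n. {\<bar>\<alpha> x - \<alpha> y\<bar> | x y. x \<in> {0..1} \<and> y \<in> {0..1} \<and> \<bar>x - y\<bar> \<le> c / real n}"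
  define w where "w = (\<lambda>n. Sup (?S n))"
  obtain K where K: "\<forall>x\<in>{0..1}. \<bar>\<alpha> x\<bar> \<le> K" using bounded_on_unit_interval[OF assms(1)] by blast
  have bdd: "bdd_above (?S n)" for n
  proof (rule bdd_aboveI)
    fix s assume "s \<in> ?S n"
    then obtain x y where "x \<in> {0..1}" "y \<in> {0..1}" "s = \<bar>\<alpha> x - \<alpha> y\<bar>" by blast
    moreover from this have "\<bar>\<alpha> x\<bar> \<le> K" "\<bar>\<alpha> y\<bar> \<le> K" using K by blast+
    ultimately show "s \<le> 2 * K" by linarith
  qed
  have w: "\<bar>\<alpha> x - \<alpha> y\<bar> \<le> w n" if "x \<in> {0..1}" "y \<in> {0..1}" "\<bar>x - y\<bar> \<le> c / real n" for n x y
    unfolding w_def by (rule cSup_upper[OF _ bdd]) (use that in blast)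
  have w0: "0 \<le> w n" for n using w[of 0 0 n] c by simp
  have "w \<longlonglongrightarrow> 0"
  proof (rule LIMSEQ_I)
    fix e :: real assume e: "0 < e"
    have "uniformly_continuous_on {0..1} \<alpha>"
      by (rule compact_uniformly_continuous[OF continuous_on_subset[OF assms(1)]]) auto
    moreover have "0 < e / 2" using e by simp
    ultimately obtain d where d: "0 < d" "\<And>x y. x \<in> {0..1} \<Longrightarrow> y \<in> {0..1} \<Longrightarrow> \<bar>x - y\<bar> < d \<Longrightarrow> \<bar>\<alpha> x - \<alpha> y\<bar> < e / 2"
      unfolding uniformly_continuous_on_def dist_real_def by metis
    obtain N :: nat where N: "c / d < real N" using reals_Archimedean2 by blast
    have "w n < e" if n: "max N 1 \<le> n" for n
    proof -
      have "real N \<le> real n" using n by simp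
      then have "c / d < real n" using N by linarith
      then have cd: "c / real n < d" using n d(1) by (simp add: field_simps)
      have "?S n \<noteq> {}" using c by (auto intro!: exI[of _ 0])
      moreover have "s \<le> e / 2" if "s \<in> ?S n" for s
        using that cd d(2) by (force intro: less_imp_le)
      ultimately have "w n \<le> e / 2" unfolding w_def by (rule cSup_least)
      then show ?thesis using e by simp
    qed
    then show "\<exists>no. \<forall>n\<ge>no. norm (w n - 0) < e"
      using w0 by (intro exI[of _ "max N 1"]) simp
  qed
  then show ?thesis using w w0 by blast
qed

lemma sampling_oscillation:
  fixes \<alpha> :: "real \<Rightarrow> real"
  assumes "continuous_on UNIV \<alpha>"
  shows "\<exists>w. w \<longlonglongrightarrow> 0 \<and> (\<forall>n. 0 \<le> w n) \<and> (\<forall>n. \<forall>i<n. \<forall>k<n. \<bar>int i - int k\<bar> \<le> int p \<longrightarrow>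
    \<bar>\<alpha> (real (i + 1) / real n) - \<alpha> (real (k + 1) / real n)\<bar> \<le> w n)"
proof -
  obtain w where w: "w \<longlonglongrightarrow> 0" "\<And>n. 0 \<le> w n"
    "\<And>n x y. x \<in> {0..1} \<Longrightarrow> y \<in> {0..1} \<Longrightarrow> \<bar>x - y\<bar> \<le> real p / real n \<Longrightarrow> \<bar>\<alpha> x - \<alpha> y\<bar> \<le> w n"
    using uniform_modulus[OF assms, of "real p"] by auto
  have "\<bar>\<alpha> (real (i + 1) / real n) - \<alpha> (real (k + 1) / real n)\<bar> \<le> w n"
    if "i < n" "k < n" "\<bar>int i - int k\<bar> \<le> int p" for n i k
  proof (rule w(3))
    have "\<bar>real (i + 1) / real n - real (k + 1) / real n\<bar> = \<bar>real_of_int (int i - int k)\<bar> / real n"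
      using that by (simp add: diff_divide_distrib[symmetric])
    also have "\<dots> \<le> real p / real n"
    proof (rule divide_right_mono)
      have "real_of_int \<bar>int i - int k\<bar> \<le> real_of_int (int p)" using that(3) by (simp only: of_int_le_iff)
      then show "\<bar>real_of_int (int i - int k)\<bar> \<le> real p" by (simp only: of_int_abs of_int_of_nat_eq)
    qed simp
    finally show "\<bar>real (i + 1) / real n - real (k + 1) / real n\<bar> \<le> real p / real n" .
  qed (use that in auto)
  then show ?thesis using w(1,2) by blast
qed

lemma mat_l1_minus_self: "mat_l1 (A - A) = 0"
  by (auto simp: mat_l1_def)

lemma cmod_mtrace_le:
  assumes "A \<in> carrier_mat n n" shows "cmod (mtrace A) \<le> mat_l1 A"
proof -
  have "cmod (mtrace A) \<le> (\<Sum>i<n. cmod (A $$ (i, i)))"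
    using assms by (simp add: mtrace_def norm_sum)
  also have "\<dots> \<le> (\<Sum>i<n. \<Sum>j<n. cmod (A $$ (i, j)))"
    by (intro sum_mono member_le_sum[where f = "\<lambda>j. cmod (A $$ (_, j))"]) auto
  also have "\<dots> = mat_l1 A" using assms by (simp add: mat_l1_def)
  finally show ?thesis .
qed

text \<open>The properties from which the moments are computed; \<open>diffusion_matrix\<close> with
  a continuous coefficient is the instance. Closeness is entrywise, and the band structure turns it
  into closeness of row sums.\<close>

locale sampled_laplacian =
  fixes \<alpha> :: "real \<Rightarrow> real" and X :: "nat \<Rightarrow> complex mat" and d :: "nat \<Rightarrow> real" and R :: real
  assumes cont: "continuous_on UNIV \<alpha>"
    and X: "X n \<in> carrier_mat n n"
    and band: "i < n \<Longrightarrow> j < n \<Longrightarrow> 1 < \<bar>int i - int j\<bar> \<Longrightarrow> X n $$ (i, j) = 0"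
    and close: "i < n \<Longrightarrow> j < n \<Longrightarrow>
      cmod (X n $$ (i, j) - of_real (\<alpha> (real (i + 1) / real n)) * lap_coeff 1 (int i - int j)) \<le> d n"
    and d: "d \<longlonglongrightarrow> 0" "0 \<le> d n"
    and row: "k < n \<Longrightarrow> (\<Sum>j<n. cmod (X n $$ (k, j))) \<le> R"
begin

abbreviation "samples n i \<equiv> \<alpha> (real (i + 1) / real n)"

text \<open>Divided by \<open>n\<close>, \<open>frozen_power_step\<close> multiplies the old error
  by the constant \<open>R\<close> and adds \<open>d n\<close>, the oscillation over
  \<open>p\<close> neighbours and a boundary term over \<open>n\<close>. All of these vanish for
  fixed \<open>p\<close>.\<close>

lemma power_close: "(\<lambda>n. mat_l1 (X n ^\<^sub>m p - frozen_power n (samples n) p) / real n) \<longlonglongrightarrow> 0"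
proof (induction p)
  case 0
  have "mat_l1 (X n ^\<^sub>m 0 - frozen_power n (samples n) 0) = 0" for n
  proof -
    have "X n ^\<^sub>m 0 = frozen_power n (samples n) 0"
      using X[of n] by (intro eq_matI) (auto simp: frozen_power_def lap_coeff_0)
    then show ?thesis by (simp only: mat_l1_minus_self)
  qed
  then show ?case by simp
next
  case (Suc p)
  obtain K where K: "0 \<le> K" "\<And>x. x \<in> {0..1} \<Longrightarrow> \<bar>\<alpha> x\<bar> \<le> K" using bounded_on_unit_interval[OF cont] by auto
  obtain w where w: "w \<longlonglongrightarrow> 0" "\<And>n. 0 \<le> w n" "\<And>n i k. i < n \<Longrightarrow> k < n \<Longrightarrow> \<bar>int i - int k\<bar> \<le> int p \<Longrightarrow>
      \<bar>samples n i - samples n k\<bar> \<le> w n"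
    using sampling_oscillation[OF cont, of p] by auto
  define E where "E = (\<lambda>p n. mat_l1 (X n ^\<^sub>m p - frozen_power n (samples n) p))"
  define c1 where "c1 = (2 * real p + 1) * (K ^ p * 4 ^ p * 3)"
  define c2 where "c2 = K ^ Suc p * (2 * ((2 * real p + 1) * 4 ^ p))"
  have step: "E (Suc p) n / real n \<le> E p n / real n * R + c1 * (d n + 4 * w n) + c2 * (1 / real n)" if "1 \<le> n" for n
  proof -
    have "E (Suc p) n \<le> E p n * R + real n * ((2 * real p + 1) * (K ^ p * 4 ^ p * (3 * (d n + 4 * w n)))) +
        K ^ Suc p * (2 * ((2 * real p + 1) * 4 ^ p))"
      unfolding E_def
    proof (rule frozen_power_step[OF X])
      show "\<bar>samples n i\<bar> \<le> K" if "i < n" for i by (rule K(2)) (use that in auto)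
    qed (use band close d w K row in auto)
    also have "\<dots> = E p n * R + real n * (c1 * (d n + 4 * w n)) + c2"
      by (simp add: c1_def c2_def mult_ac)
    finally show ?thesis using that by (simp add: field_simps)
  qed
  have "(\<lambda>n. E (Suc p) n / real n) \<longlonglongrightarrow> 0"
  proof (rule tendsto_sandwich[OF _ _ tendsto_const])
    show "\<forall>\<^sub>F n in sequentially. 0 \<le> E (Suc p) n / real n" by (simp add: E_def)
    show "\<forall>\<^sub>F n in sequentially. E (Suc p) n / real n \<le> E p n / real n * R + c1 * (d n + 4 * w n) + c2 * (1 / real n)"
      using eventually_ge_at_top[of 1] by eventually_elim (rule step)
    have "(\<lambda>n. E p n / real n * R + c1 * (d n + 4 * w n) + c2 * (1 / real n)) \<longlonglongrightarrow> 0 * R + c1 * (0 + 4 * 0) + c2 * 0"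
      using Suc unfolding E_def by (intro tendsto_intros d w lim_1_over_n)
    then show "(\<lambda>n. E p n / real n * R + c1 * (d n + 4 * w n) + c2 * (1 / real n)) \<longlonglongrightarrow> 0" by simp
  qed
  then show ?case by (simp add: E_def)
qed

lemma moment_tendsto:
  "(\<lambda>n. mtrace (X n ^\<^sub>m p) / of_nat n) \<longlonglongrightarrow>
    symbol_mean glt_domain (\<lambda>x. of_real ((\<alpha> (fst x) * (2 - 2 * cos (snd x))) ^ p))"
proof -
  let ?Y = "\<lambda>n. frozen_power n (samples n) p"
  have Y: "?Y n \<in> carrier_mat n n" for n by (simp add: frozen_power_def)
  have Xp: "X n ^\<^sub>m p \<in> carrier_mat n n" for n by (rule pow_carrier_mat[OF X])
  have "(\<lambda>n. mtrace (X n ^\<^sub>m p - ?Y n) / of_nat n) \<longlonglongrightarrow> 0"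
  proof (rule tendsto_norm_zero_cancel, rule tendsto_sandwich[OF _ _ tendsto_const power_close])
    show "\<forall>\<^sub>F n in sequentially. norm (mtrace (X n ^\<^sub>m p - ?Y n) / of_nat n) \<le> mat_l1 (X n ^\<^sub>m p - ?Y n) / real n"
      unfolding norm_divide norm_of_nat
      by (intro always_eventually allI divide_right_mono cmod_mtrace_le[OF minus_carrier_mat[OF Y]]) simp
  qed simp
  moreover have "(\<lambda>n. mtrace (?Y n) / of_nat n) \<longlonglongrightarrow> of_real (integral {0..1} (\<lambda>x. \<alpha> x ^ p)) * lap_coeff p 0"
  proof -
    have "(\<lambda>n. (\<Sum>i<n. \<alpha> (real (i + 1) / real n) ^ p) / real n) \<longlonglongrightarrow> integral {0..1} (\<lambda>x. \<alpha> x ^ p)"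
      by (rule riemann_sum_tendsto) (intro continuous_intros continuous_on_subset[OF cont] subset_UNIV)
    then have "(\<lambda>n. of_real ((\<Sum>i<n. \<alpha> (real (i + 1) / real n) ^ p) / real n) * lap_coeff p 0) \<longlonglongrightarrow>
        of_real (integral {0..1} (\<lambda>x. \<alpha> x ^ p)) * lap_coeff p 0"
      by (intro tendsto_mult tendsto_of_real tendsto_const)
    moreover have "mtrace (?Y n) / of_nat n = of_real ((\<Sum>i<n. \<alpha> (real (i + 1) / real n) ^ p) / real n) * lap_coeff p 0" for n
      by (simp add: mtrace_def frozen_power_def sum_distrib_right)
    ultimately show ?thesis by (simp only:)
  qed
  ultimately have "(\<lambda>n. mtrace (X n ^\<^sub>m p - ?Y n) / of_nat n + mtrace (?Y n) / of_nat n) \<longlonglongrightarrow>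
      0 + of_real (integral {0..1} (\<lambda>x. \<alpha> x ^ p)) * lap_coeff p 0"
    by (rule tendsto_add)
  moreover have "mtrace (X n ^\<^sub>m p - ?Y n) / of_nat n + mtrace (?Y n) / of_nat n = mtrace (X n ^\<^sub>m p) / of_nat n" for n
    unfolding mtrace_minus[OF Xp Y] by (simp add: diff_divide_distrib)
  moreover have "symbol_mean glt_domain (\<lambda>x. of_real ((\<alpha> (fst x) * (2 - 2 * cos (snd x))) ^ p)) =
      of_real (integral {0..1} (\<lambda>x. \<alpha> x ^ p)) * lap_coeff p 0"
    unfolding lap_coeff_at_0 power_mult_distrib
    by (subst symbol_mean_product) (auto intro!: continuous_intros cont)
  ultimately show ?thesis by simp
qed

end

section \<open>The Hermitian case: from moments to continuous test functions\<close>

lemma continuous_integrable_glt_domain: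
  fixes f :: "real \<times> real \<Rightarrow> complex"
  assumes "continuous_on UNIV f"
  shows "integrable (lebesgue_on glt_domain) f"
  unfolding glt_domain_cbox by (rule continuous_imp_integrable[OF continuous_on_subset[OF assms subset_UNIV]])

lemma symbol_on_glt_domain:
  "f \<in> borel_measurable (lebesgue_on glt_domain) \<Longrightarrow> symbol_on glt_domain f"
  by (simp add: symbol_on_def emeasure_glt_domain del: emeasure_completion)

locale hermitian_sampled_laplacian = sampled_laplacian +
  assumes herm: "mat_adjoint (X n) = X n"
begin

abbreviation "symbol x \<equiv> \<alpha> (fst x) * (2 - 2 * cos (snd x))"

abbreviation "real_eigenvalues n \<equiv> image_mset Re (eigenvalues (X n))"

lemma symbol_continuous: "continuous_on UNIV (\<lambda>x. symbol x)"
  by (intro continuous_intros continuous_on_compose2[OF cont]) auto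

lemma op_bounded_X:
  assumes "1 \<le> n" shows "op_bounded (X n) R"
proof -
  have entry: "cmod (X n $$ (i, j)) = cmod (X n $$ (j, i))" if "i < n" "j < n" for i j
  proof -
    have "mat_adjoint (X n) $$ (i, j) = cnj (X n $$ (j, i))" using X[of n] that by simp
    then show ?thesis using herm[of n] by simp
  qed
  have col: "(\<Sum>i<n. cmod (X n $$ (i, j))) \<le> R" if "j < n" for j
    using row[OF that] entry[OF _ that] by simp
  have "0 \<le> (\<Sum>j<n. cmod (X n $$ (0, j)))" by (intro sum_nonneg) simp
  then have "0 \<le> R" using row[of 0 n] assms by simp
  then show ?thesis by (intro op_bounded_schur_test[OF X] row col)
qed

lemma power_sum_eigenvalues: "(\<Sum>t\<in>#real_eigenvalues n. complex_of_real t ^ p) = mtrace (X n ^\<^sub>m p)"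
proof -
  have "complex_of_real (Re x) = x" if "x \<in># eigenvalues (X n)" for x
    using eigenvalues_hermitian_real[OF X herm that] by (simp add: complex_eq_iff)
  then have "image_mset (\<lambda>x. complex_of_real (Re x) ^ p) (eigenvalues (X n)) = image_mset (\<lambda>x. x ^ p) (eigenvalues (X n))"
    by (intro image_mset_cong) simp
  then show ?thesis
    using mtrace_eigenvalues[OF pow_carrier_mat[OF X, of n p]] eigenvalues_power[OF X, of n p]
    by (simp add: image_mset.compositionality comp_def)
qed

lemma polynomial_tendsto:
  fixes c :: "nat \<Rightarrow> complex"
  shows "(\<lambda>n. (\<Sum>t\<in>#real_eigenvalues n. \<Sum>i<N. c i * of_real t ^ i) / of_nat n) \<longlonglongrightarrow>
    symbol_mean glt_domain (\<lambda>x. \<Sum>i<N. c i * of_real (symbol x) ^ i)"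
proof (induction N)
  case 0
  then show ?case by (simp add: symbol_mean_def)
next
  case (Suc N)
  have int: "integrable (lebesgue_on glt_domain) (\<lambda>x. \<Sum>i<N. c i * of_real (symbol x) ^ i)"
    "integrable (lebesgue_on glt_domain) (\<lambda>x. c N * of_real (symbol x) ^ N)"
    by (intro continuous_integrable_glt_domain continuous_intros symbol_continuous)+
  have "symbol_mean glt_domain (\<lambda>x. \<Sum>i<Suc N. c i * of_real (symbol x) ^ i) =
      symbol_mean glt_domain (\<lambda>x. \<Sum>i<N. c i * of_real (symbol x) ^ i) +
      c N * symbol_mean glt_domain (\<lambda>x. of_real (symbol x ^ N))"
    using int by (simp add: symbol_mean_def add_divide_distrib)
  moreover have "(\<Sum>t\<in>#real_eigenvalues n. \<Sum>i<Suc N. c i * of_real t ^ i) / of_nat n =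
      (\<Sum>t\<in>#real_eigenvalues n. \<Sum>i<N. c i * of_real t ^ i) / of_nat n + c N * (mtrace (X n ^\<^sub>m N) / of_nat n)" for n
    unfolding power_sum_eigenvalues[symmetric]
    by (simp add: sum_mset.distrib sum_mset_distrib_left add_divide_distrib image_mset.compositionality comp_def)
  ultimately show ?case
    using tendsto_add[OF Suc tendsto_mult[OF tendsto_const moment_tendsto[of N], of "c N"]] by simp
qed

text \<open>The method of moments: eigenvalues and symbol values lie in one compact interval, where
  polynomials approximate real and imaginary part of \<open>F\<close>. No decay of \<open>F\<close>
  is asked for, so resolvents may be inserted.\<close>

theorem eigenvalue_mean_tendsto:
  fixes F :: "real \<Rightarrow> complex"
  assumes F: "continuous_on UNIV F"
  shows "(\<lambda>n. (\<Sum>t\<in>#real_eigenvalues n. F t) / of_nat n) \<longlonglongrightarrow> symbol_mean glt_domain (\<lambda>x. F (symbol x))"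
proof (rule mean_convergence_uniform_limit)
  show "symbol_on glt_domain (\<lambda>x. complex_of_real (symbol x))"
    by (intro symbol_on_glt_domain continuous_measurable_lebesgue_on continuous_intros symbol_continuous)
  show "size (real_eigenvalues n) = n" for n using size_eigenvalues[OF X] by simp
  show "integrable (lebesgue_on glt_domain) (\<lambda>x. F (symbol x))"
    by (intro continuous_integrable_glt_domain continuous_on_compose2[OF F] symbol_continuous) auto
  fix e :: real assume e: "0 < e"
  obtain K where K: "0 \<le> K" "\<And>x. x \<in> {0..1} \<Longrightarrow> \<bar>\<alpha> x\<bar> \<le> K" using bounded_on_unit_interval[OF cont] by auto
  \<comment> \<open>\<open>R\<close> bounds the eigenvalues by the Schur test; \<open>4 * K\<close>
    bounds the symbol because \<open>2 - 2 cos\<close> is at most 4.\<close>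
  define B where "B = max R (4 * K)"
  have symbol_le: "symbol x \<in> {-B..B}" if "x \<in> glt_domain" for x
  proof -
    have "\<bar>2 - 2 * cos (snd x)\<bar> \<le> 4"
      using cos_ge_minus_one[of "snd x"] cos_le_one[of "snd x"] by linarith
    then have "\<bar>symbol x\<bar> \<le> K * 4"
      unfolding abs_mult using that K(2)[of "fst x"] K(1) by (intro mult_mono) auto
    then show ?thesis by (auto simp: B_def)
  qed
  have eig_le: "t \<in> {-B..B}" if "1 \<le> n" "t \<in># real_eigenvalues n" for n t
  proof -
    from that(2) obtain x where x: "x \<in># eigenvalues (X n)" "t = Re x" by auto
    then have "\<bar>t\<bar> \<le> R" using cmod_eigenvalue_le[OF X op_bounded_X[OF that(1)] x(1)] abs_Re_le_cmod[of x] by simp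
    then show ?thesis by (auto simp: B_def)
  qed
  have "\<exists>a N. \<forall>t\<in>{-B..B}. \<bar>G t - (\<Sum>i<N. a i * t ^ i)\<bar> \<le> e / 2" if G: "continuous_on UNIV G" for G :: "real \<Rightarrow> real"
  proof -
    obtain g where g: "real_polynomial_function g" "\<And>x. x \<in> {-B..B} \<Longrightarrow> \<bar>G x - g x\<bar> < e / 2"
      using Stone_Weierstrass_real_polynomial_function[of "{-B..B}" G "e / 2"] e continuous_on_subset[OF G] by auto
    obtain a N where aN: "g = (\<lambda>x. \<Sum>i\<le>N. a i * x ^ i)" using g(1) real_polynomial_function_iff_sum by auto
    have "\<forall>t\<in>{-B..B}. \<bar>G t - (\<Sum>i<Suc N. a i * t ^ i)\<bar> \<le> e / 2"
      using g(2) unfolding aN lessThan_Suc_atMost by (auto intro: less_imp_le)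
    then show ?thesis by blast
  qed
  note poly = this
  obtain a1 N1 where 1: "\<forall>t\<in>{-B..B}. \<bar>Re (F t) - (\<Sum>i<N1. a1 i * t ^ i)\<bar> \<le> e / 2"
    using poly[of "\<lambda>t. Re (F t)"] F by (auto intro: continuous_intros)
  obtain a2 N2 where 2: "\<forall>t\<in>{-B..B}. \<bar>Im (F t) - (\<Sum>i<N2. a2 i * t ^ i)\<bar> \<le> e / 2"
    using poly[of "\<lambda>t. Im (F t)"] F by (auto intro: continuous_intros)
  define N where "N = max N1 N2"
  \<comment> \<open>The coefficient sequences of the two real polynomials are padded with zeros and
    merged into one complex polynomial.\<close>
  define c where "c = (\<lambda>i. Complex (if i < N1 then a1 i else 0) (if i < N2 then a2 i else 0))"
  define g where "g = (\<lambda>t :: real. \<Sum>i<N. c i * of_real t ^ i)"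
  have sum_ext: "(\<Sum>i<N. (if i < N' then b i else 0) * t ^ i) = (\<Sum>i<N'. b i * t ^ i)"
    if "N' \<le> N" for N' and b :: "nat \<Rightarrow> real" and t
    using that by (intro sum.mono_neutral_cong_right) auto
  have Re_g: "Re (g t) = (\<Sum>i<N1. a1 i * t ^ i)" for t
    unfolding g_def using sum_ext[of N1 a1 t] by (simp add: N_def c_def flip: of_real_power)
  have Im_g: "Im (g t) = (\<Sum>i<N2. a2 i * t ^ i)" for t
    unfolding g_def using sum_ext[of N2 a2 t] by (simp add: N_def c_def flip: of_real_power)
  have fg: "cmod (F t - g t) \<le> e" if "t \<in> {-B..B}" for t
    using cmod_le[of "F t - g t"] 1 2 that by (force simp: Re_g Im_g)
  have "(\<lambda>n. (\<Sum>t\<in>#real_eigenvalues n. g t) / of_nat n) \<longlonglongrightarrow> symbol_mean glt_domain (\<lambda>x. g (symbol x))"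
    unfolding g_def by (rule polynomial_tendsto)
  moreover have "integrable (lebesgue_on glt_domain) (\<lambda>x. g (symbol x))"
    unfolding g_def by (intro continuous_integrable_glt_domain continuous_intros symbol_continuous)
  ultimately show "\<exists>g. (\<lambda>n. (\<Sum>t\<in>#real_eigenvalues n. g t) / of_nat n) \<longlonglongrightarrow> symbol_mean glt_domain (\<lambda>x. g (symbol x)) \<and>
      integrable (lebesgue_on glt_domain) (\<lambda>x. g (symbol x)) \<and> (\<forall>x\<in>glt_domain. cmod (F (symbol x) - g (symbol x)) \<le> e) \<and>
      (\<forall>n\<ge>1. \<forall>t\<in>#real_eigenvalues n. cmod (F t - g t) \<le> e)"
    using fg symbol_le eig_le by blast
qed

end

section \<open>The stiffness matrices\<close>

text \<open>Through the floor, disjointness of the cells and the band structure of the matrices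
  become statements about a single integer.\<close>

definition cell :: "nat \<Rightarrow> nat \<Rightarrow> real \<Rightarrow> real" where
  "cell n k x = of_bool (\<lfloor>x * real (n + 1)\<rfloor> = int k)"

text \<open>The slope of the hat function at the node \<open>mesh_point n (i + 1)\<close>, i.e. of the hat function that
  belongs to row and column \<open>i\<close> of the stiffness matrix.\<close>

definition slope :: "nat \<Rightarrow> nat \<Rightarrow> real \<Rightarrow> real" where
  "slope n i x = real (n + 1) * (cell n i x - cell n (i + 1) x)"

lemma cell_iff: "\<lfloor>x * real (n + 1)\<rfloor> = int k \<longleftrightarrow> x \<in> {mesh_point n k..<mesh_point n (k + 1)}"
  by (auto simp: floor_eq_iff mesh_point_def field_simps)

lemma cell_indicator: "cell n k x = indicator {mesh_point n k..<mesh_point n (k + 1)} x"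
  unfolding cell_def cell_iff by (simp add: indicator_def)

lemma cell_measurable [measurable]: "cell n k \<in> borel_measurable (lebesgue_on S)"
proof -
  have "cell n k = indicator {mesh_point n k..<mesh_point n (k + 1)}" by (rule ext) (rule cell_indicator)
  moreover have "indicator {mesh_point n k..<mesh_point n (k + 1)} \<in> borel_measurable (lebesgue_on S)"
    by (intro measurable_restrict_space1 measurable_completion) simp
  ultimately show ?thesis by simp
qed

lemma slope_measurable [measurable]: "slope n i \<in> borel_measurable (lebesgue_on S)"
  unfolding slope_def by measurable

lemma mesh_point_diff: "mesh_point n (k + 1) - mesh_point n k = 1 / real (n + 1)"
  by (simp add: mesh_point_def diff_divide_distrib[symmetric])

lemma hat_eq: "hat n (i + 1) x = cell n i x * ((x - mesh_point n i) * real (n + 1)) +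
    cell n (i + 1) x * ((mesh_point n (i + 2) - x) * real (n + 1))"
proof -
  have "mesh_point n (i + 2) - mesh_point n (i + 1) = 1 / real (n + 1)"
    using mesh_point_diff[of n "i + 1"] by simp
  then show ?thesis
    unfolding hat_def cell_indicator using mesh_point_diff[of n i]
    by (auto simp: indicator_def simp del: of_nat_add of_nat_Suc)
qed

lemma hat_measurable [measurable]: "hat n (i + 1) \<in> borel_measurable (lebesgue_on S)"
proof -
  have "(\<lambda>x. x) \<in> borel_measurable (lebesgue_on S)"
    by (rule continuous_measurable_lebesgue_on) (rule continuous_on_id)
  then show ?thesis unfolding hat_eq[abs_def] by measurable
qed

lemma hat_le: "\<bar>hat n (i + 1) x\<bar> \<le> cell n i x + cell n (i + 1) x"
proof -
  have mesh_mult: "mesh_point n k * real (n + 1) = real k" for k by (simp add: mesh_point_def)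
  have 1: "0 \<le> (x - mesh_point n i) * real (n + 1) \<and> (x - mesh_point n i) * real (n + 1) \<le> 1"
    if "\<lfloor>x * real (n + 1)\<rfloor> = int i"
    using that unfolding left_diff_distrib mesh_mult floor_eq_iff by auto
  have 2: "0 \<le> (mesh_point n (i + 2) - x) * real (n + 1) \<and> (mesh_point n (i + 2) - x) * real (n + 1) \<le> 1"
    if "\<lfloor>x * real (n + 1)\<rfloor> = int (i + 1)"
    using that unfolding left_diff_distrib mesh_mult floor_eq_iff by auto
  show ?thesis
  proof (cases "\<lfloor>x * real (n + 1)\<rfloor> = int i")
    case True
    then show ?thesis using 1[OF True] unfolding hat_eq cell_def by (simp only: of_bool_eq) simp
  next
    case False
    then show ?thesis using 2
      by (cases "\<lfloor>x * real (n + 1)\<rfloor> = int (i + 1)") (simp_all only: hat_eq cell_def of_bool_eq, simp_all)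
  qed
qed

lemma abs_slope_le: "\<bar>slope n i x\<bar> \<le> real (n + 1) * (cell n i x + cell n (i + 1) x)"
  unfolding slope_def abs_mult by (intro mult_mono) (auto simp: cell_def)

lemma sum_cells_le: "(\<Sum>i<n. cell m i x + cell m (i + 1) x) \<le> 2"
proof -
  have le1: "(\<Sum>i\<in>I. of_bool (f = int (i + k))) \<le> (1 :: real)" if "finite I" for I k f
  proof -
    have "(\<Sum>i\<in>I. of_bool (f = int (i + k))) = real (card {i \<in> I. f = int (i + k)})"
      using that by (simp add: of_bool_def sum.If_cases Int_def)
    also have "card {i \<in> I. f = int (i + k)} \<le> 1"
      using that by (intro card_le_Suc0_iff_eq[THEN iffD2, simplified One_nat_def[symmetric]]) auto
    finally show ?thesis by simp
  qed
  have "(\<Sum>i<n. cell m i x) \<le> 1" "(\<Sum>i<n. cell m (i + 1) x) \<le> 1"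
    unfolding cell_def using le1[of "{..<n}" "\<lfloor>x * real (m + 1)\<rfloor>" 0] le1[of "{..<n}" "\<lfloor>x * real (m + 1)\<rfloor>" 1] by auto
  then show ?thesis by (simp add: sum.distrib)
qed

lemma sum_abs_hat_le: "(\<Sum>i<n. \<bar>hat m (i + 1) x\<bar>) \<le> 2"
  by (rule order_trans[OF sum_mono[OF hat_le] sum_cells_le])

lemma sum_abs_slope_le: "(\<Sum>i<n. \<bar>slope m i x\<bar>) \<le> 2 * real (m + 1)"
proof -
  have "(\<Sum>i<n. \<bar>slope m i x\<bar>) \<le> real (m + 1) * (\<Sum>i<n. cell m i x + cell m (i + 1) x)"
    unfolding sum_distrib_left by (intro sum_mono abs_slope_le)
  also have "\<dots> \<le> real (m + 1) * 2" by (intro mult_left_mono sum_cells_le) simp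
  finally show ?thesis by simp
qed

lemma deriv_hat:
  assumes "x \<notin> range (mesh_point n)"
  shows "deriv (hat n (i + 1)) x = slope n i x"
proof -
  have mesh: "mesh_point n i < mesh_point n (i + 1)" "mesh_point n (i + 1) < mesh_point n (i + 2)"
    by (auto simp: mesh_point_def field_simps)
  have ne: "x \<noteq> mesh_point n i" "x \<noteq> mesh_point n (i + 1)" "x \<noteq> mesh_point n (i + 2)" using assms by auto
  consider "x < mesh_point n i" | "mesh_point n i < x" "x < mesh_point n (i + 1)"
    | "mesh_point n (i + 1) < x" "x < mesh_point n (i + 2)" | "mesh_point n (i + 2) < x"
    using ne by linarith
  then have "(hat n (i + 1) has_field_derivative slope n i x) (at x)"
  proof cases
    case 1
    have "((\<lambda>_. 0) has_field_derivative slope n i x) (at x)"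
      using 1 mesh by (auto simp: slope_def cell_indicator)
    then show ?thesis
      by (rule has_field_derivative_transform_within_open[of _ _ _ "{..<mesh_point n i}"])
        (use 1 mesh in \<open>auto simp: hat_eq[simplified] cell_indicator\<close>)
  next
    case 2
    have "((\<lambda>x. (x - mesh_point n i) * real (n + 1)) has_field_derivative slope n i x) (at x)"
      using 2 mesh by (auto simp: slope_def cell_indicator intro!: derivative_eq_intros)
    then show ?thesis
      by (rule has_field_derivative_transform_within_open[of _ _ _ "{mesh_point n i<..<mesh_point n (i + 1)}"])
        (use 2 mesh in \<open>auto simp: hat_eq[simplified] cell_indicator\<close>)
  next
    case 3
    have "((\<lambda>x. (mesh_point n (i + 2) - x) * real (n + 1)) has_field_derivative slope n i x) (at x)"
      using 3 mesh by (auto simp: slope_def cell_indicator intro!: derivative_eq_intros)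
    then show ?thesis
      by (rule has_field_derivative_transform_within_open[of _ _ _ "{mesh_point n (i + 1)<..<mesh_point n (i + 2)}"])
        (use 3 mesh in \<open>auto simp: hat_eq[simplified] cell_indicator\<close>)
  next
    case 4
    have "((\<lambda>_. 0) has_field_derivative slope n i x) (at x)"
      using 4 mesh by (auto simp: slope_def cell_indicator)
    then show ?thesis
      by (rule has_field_derivative_transform_within_open[of _ _ _ "{mesh_point n (i + 2)<..}"])
        (use 4 mesh in \<open>auto simp: hat_eq[simplified] cell_indicator\<close>)
  qed
  then show ?thesis by (rule DERIV_imp_deriv)
qed

text \<open>The mesh points form a countable set, so the unspecified values of \<open>deriv\<close>
  at the nodes cannot affect an integral.\<close>

lemma integral_mesh_cong:
  fixes f g :: "real \<Rightarrow> real"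
  assumes "\<And>x. x \<notin> range (mesh_point n) \<Longrightarrow> f x = g x"
  shows "(LINT x|lebesgue_on {0..1}. f x) = (LINT x|lebesgue_on {0..1}. g x)"
proof -
  have "(LINT x|lebesgue. indicator {0..1} x *\<^sub>R f x) = (LINT x|lebesgue. indicator {0..1} x *\<^sub>R g x)"
    by (rule integral_discrete_difference[of "range (mesh_point n)"]) (use assms in auto)
  then show ?thesis by (simp add: integral_restrict_space)
qed

abbreviation "unit_lebesgue \<equiv> lebesgue_on {0..1::real}"

lemma stiffness_matrix_entry:
  assumes "i < n" "j < n"
  shows "stiffness_matrix a b c n $$ (i, j) =
    (LINT x|unit_lebesgue. a x * slope n j x * slope n i x) +
    (LINT x|unit_lebesgue. b x * slope n j x * hat n (i + 1) x) +
    (LINT x|unit_lebesgue. c x * hat n (j + 1) x * hat n (i + 1) x)"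
proof -
  have "(LINT x|unit_lebesgue. a x * deriv (hat n (j + 1)) x * deriv (hat n (i + 1)) x) =
      (LINT x|unit_lebesgue. a x * slope n j x * slope n i x)"
    by (rule integral_mesh_cong[of n]) (simp only: deriv_hat not_False_eq_True)
  moreover have "(LINT x|unit_lebesgue. b x * deriv (hat n (j + 1)) x * hat n (i + 1) x) =
      (LINT x|unit_lebesgue. b x * slope n j x * hat n (i + 1) x)"
    by (rule integral_mesh_cong[of n]) (simp only: deriv_hat not_False_eq_True)
  ultimately show ?thesis
    using assms by (simp only: stiffness_matrix_def index_mat prod.case Let_def)
qed

lemma integrable_weighted:
  fixes a u v :: "real \<Rightarrow> real"
  assumes a: "integrable unit_lebesgue a"
    and [measurable]: "u \<in> borel_measurable unit_lebesgue" "v \<in> borel_measurable unit_lebesgue"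
    and bd: "\<And>x. \<bar>u x\<bar> \<le> U" "\<And>x. \<bar>v x\<bar> \<le> V"
  shows "integrable unit_lebesgue (\<lambda>x. a x * u x * v x)"
proof (rule Bochner_Integration.integrable_bound)
  note [measurable] = borel_measurable_integrable[OF a]
  have UV: "0 \<le> U" "0 \<le> V" using bd[of 0] by auto
  show "integrable unit_lebesgue (\<lambda>x. (U * V) * \<bar>a x\<bar>)" using a by simp
  show "(\<lambda>x. a x * u x * v x) \<in> borel_measurable unit_lebesgue" by measurable
  show "AE x in unit_lebesgue. norm (a x * u x * v x) \<le> norm ((U * V) * \<bar>a x\<bar>)"
  proof (rule AE_I2)
    fix x
    have "\<bar>u x\<bar> * \<bar>v x\<bar> \<le> U * V" using bd UV by (intro mult_mono) auto
    then have "\<bar>a x\<bar> * (\<bar>u x\<bar> * \<bar>v x\<bar>) \<le> \<bar>a x\<bar> * (U * V)" by (rule mult_left_mono) simp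
    then show "norm (a x * u x * v x) \<le> norm ((U * V) * \<bar>a x\<bar>)" using UV by (simp add: abs_mult mult_ac)
  qed
qed

text \<open>Under the integral the double sum factors into the two pointwise sums bounded by
  \<open>U\<close> and \<open>V\<close>. An L1 norm of the coefficient thereby bounds an entrywise
  matrix norm without a loss from counting entries.\<close>

lemma sum_abs_weighted_integrals_le:
  fixes a :: "real \<Rightarrow> real" and u v :: "nat \<Rightarrow> real \<Rightarrow> real"
  assumes a: "integrable unit_lebesgue a"
    and meas: "\<And>i. u i \<in> borel_measurable unit_lebesgue" "\<And>i. v i \<in> borel_measurable unit_lebesgue"
    and u: "\<And>x. (\<Sum>j<n. \<bar>u j x\<bar>) \<le> U" and v: "\<And>x. (\<Sum>i<n. \<bar>v i x\<bar>) \<le> V"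
  shows "(\<Sum>i<n. \<Sum>j<n. \<bar>LINT x|unit_lebesgue. a x * u j x * v i x\<bar>) \<le> U * V * (LINT x|unit_lebesgue. \<bar>a x\<bar>)"
proof -
  have UV: "0 \<le> U" "0 \<le> V" using order_trans[OF sum_nonneg u] order_trans[OF sum_nonneg v] by auto
  have bd: "\<bar>u j x\<bar> \<le> U" "\<bar>v j x\<bar> \<le> V" if "j < n" for j x
    using member_le_sum[of j "{..<n}" "\<lambda>j. \<bar>u j x\<bar>"] member_le_sum[of j "{..<n}" "\<lambda>j. \<bar>v j x\<bar>"] that u[of x] v[of x]
    by (auto intro: order_trans)
  have int: "integrable unit_lebesgue (\<lambda>x. \<bar>a x * u j x * v i x\<bar>)" if "i < n" "j < n" for i j
    by (intro integrable_abs integrable_weighted[OF a meas(1) meas(2) bd(1) bd(2)] that)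
  have "(\<Sum>i<n. \<Sum>j<n. \<bar>LINT x|unit_lebesgue. a x * u j x * v i x\<bar>) \<le>
      (\<Sum>i<n. \<Sum>j<n. LINT x|unit_lebesgue. \<bar>a x * u j x * v i x\<bar>)"
    by (intro sum_mono integral_abs_bound)
  also have "\<dots> = (LINT x|unit_lebesgue. (\<Sum>i<n. \<Sum>j<n. \<bar>a x * u j x * v i x\<bar>))"
  proof -
    have "(LINT x|unit_lebesgue. (\<Sum>i<n. \<Sum>j<n. \<bar>a x * u j x * v i x\<bar>)) =
        (\<Sum>i<n. LINT x|unit_lebesgue. (\<Sum>j<n. \<bar>a x * u j x * v i x\<bar>))"
      by (rule Bochner_Integration.integral_sum) (intro Bochner_Integration.integrable_sum int; simp)
    also have "\<dots> = (\<Sum>i<n. \<Sum>j<n. LINT x|unit_lebesgue. \<bar>a x * u j x * v i x\<bar>)"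
      by (intro sum.cong refl Bochner_Integration.integral_sum int) simp_all
    finally show ?thesis by (rule sym)
  qed
  also have "\<dots> \<le> (LINT x|unit_lebesgue. U * V * \<bar>a x\<bar>)"
  proof (rule integral_mono)
    show "integrable unit_lebesgue (\<lambda>x. \<Sum>i<n. \<Sum>j<n. \<bar>a x * u j x * v i x\<bar>)"
      using int by (intro Bochner_Integration.integrable_sum) auto
    show "integrable unit_lebesgue (\<lambda>x. U * V * \<bar>a x\<bar>)" using a by simp
    fix x
    have "(\<Sum>i<n. \<Sum>j<n. \<bar>a x * u j x * v i x\<bar>) = \<bar>a x\<bar> * ((\<Sum>j<n. \<bar>u j x\<bar>) * (\<Sum>i<n. \<bar>v i x\<bar>))"
      unfolding sum_product by (subst sum.swap) (simp add: sum_distrib_left abs_mult mult.assoc)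
    also have "\<dots> \<le> \<bar>a x\<bar> * (U * V)"
      using u[of x] v[of x] UV by (intro mult_left_mono mult_mono sum_nonneg) auto
    finally show "(\<Sum>i<n. \<Sum>j<n. \<bar>a x * u j x * v i x\<bar>) \<le> U * V * \<bar>a x\<bar>" by (simp add: mult_ac)
  qed
  finally show ?thesis by simp
qed

section \<open>Integrals of slopes and the band structure\<close>

lemma integral_cell:
  assumes "k \<le> n"
  shows "(LINT x|unit_lebesgue. cell n k x) = 1 / real (n + 1)"
proof -
  let ?I = "{mesh_point n k..<mesh_point n (k + 1)}"
  have "0 \<le> mesh_point n k" "mesh_point n (k + 1) \<le> 1" using assms by (simp_all add: mesh_point_def)
  then have sub: "?I \<subseteq> {0..1}" by auto
  have "(LINT x|unit_lebesgue. cell n k x) = (LINT x|lebesgue. indicator ?I x)"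
  proof -
    have "(LINT x|unit_lebesgue. cell n k x) = (LINT x|lebesgue. indicator {0..1} x *\<^sub>R cell n k x)"
      by (rule integral_restrict_space) simp
    also have "\<dots> = (LINT x|lebesgue. indicator ?I x)"
      unfolding cell_indicator
      by (rule Bochner_Integration.integral_cong) (use sub in \<open>auto simp: indicator_def\<close>)
    finally show ?thesis .
  qed
  also have "\<dots> = measure lebesgue ?I" by simp
  also have "\<dots> = mesh_point n (k + 1) - mesh_point n k" by (simp add: mesh_point_def divide_right_mono)
  finally show ?thesis by (simp only: mesh_point_diff)
qed

lemma integrable_cell: "integrable unit_lebesgue (cell n k)"
proof -
  have "finite_measure unit_lebesgue" by (intro finite_measureI) (simp add: emeasure_restrict_space)
  then show ?thesis
    by (rule finite_measure.integrable_const_bound[where B = 1]) (auto simp: cell_def)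
qed

text \<open>For the constant coefficient 1 the scaled matrix is exactly Toeplitz: the slopes
  contribute \<open>(n + 1)^2\<close>, a shared cell has length \<open>1 / (n + 1)\<close>, and the
  scaling removes the last factor. Equal indices share two cells; neighbours share one, where the
  signs are opposite.\<close>

lemma integral_slope_mult_slope:
  assumes "i < n" "j < n"
  shows "of_real ((LINT x|unit_lebesgue. slope n j x * slope n i x) / real (n + 1)) = lap_coeff 1 (int i - int j)"
proof -
  let ?N = "real (n + 1)"
  have cc: "cell n k x * cell n l x = of_bool (k = l) * cell n k x" for k l x
    by (auto simp: cell_def)
  have "slope n j x * slope n i x = ?N\<^sup>2 * (of_bool (j = i) * cell n j x - of_bool (j = i + 1) * cell n j x
      - of_bool (j + 1 = i) * cell n (j + 1) x + of_bool (j + 1 = i + 1) * cell n (j + 1) x)" for x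
    unfolding slope_def cc[symmetric] by (simp add: power2_eq_square algebra_simps del: of_nat_add of_nat_Suc)
  then have eq: "(LINT x|unit_lebesgue. slope n j x * slope n i x) =
      ?N\<^sup>2 * (of_bool (j = i) * (1 / ?N) - of_bool (j = i + 1) * (1 / ?N) - of_bool (j + 1 = i) * (1 / ?N) + of_bool (j + 1 = i + 1) * (1 / ?N))"
    using assms integrable_cell by (simp add: integral_cell del: of_nat_add of_nat_Suc of_bool_eq_iff)
  have "N\<^sup>2 * (p * (1 / N) - q * (1 / N) - r * (1 / N) + s * (1 / N)) / N = p - q - r + s"
    if "0 < N" for N p q r s :: real
    using that by (simp add: power2_eq_square field_simps)
  note cancel = this[of ?N]
  have "0 < ?N" by simp
  from cancel[OF this] have "(LINT x|unit_lebesgue. slope n j x * slope n i x) / ?N =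
      of_bool (j = i) - of_bool (j = i + 1) - of_bool (j + 1 = i) + of_bool (j + 1 = i + 1)"
    by (simp only: eq)
  then show ?thesis by (auto simp: lap_coeff_1[unfolded One_nat_def])
qed

lemma integral_abs_slope_le:
  assumes "i < n" shows "(LINT x|unit_lebesgue. \<bar>slope n i x\<bar>) \<le> 2"
proof -
  have fin: "finite_measure unit_lebesgue" by (intro finite_measureI) (simp add: emeasure_restrict_space)
  have "integrable unit_lebesgue (\<lambda>x. \<bar>slope n i x\<bar>)"
    unfolding slope_def by (intro integrable_abs integrable_mult_right Bochner_Integration.integrable_diff integrable_cell)
  then have "(LINT x|unit_lebesgue. \<bar>slope n i x\<bar>) \<le> (LINT x|unit_lebesgue. real (n + 1) * (cell n i x + cell n (i + 1) x))"
    using integrable_cell by (intro integral_mono abs_slope_le) auto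
  also have "\<dots> = 2"
    using assms integrable_cell by (simp add: integral_cell del: of_nat_add of_nat_Suc)
  finally show ?thesis .
qed

lemma abs_slope_le_const: "\<bar>slope n i x\<bar> \<le> real (n + 1)"
proof -
  have "\<bar>cell n i x - cell n (i + 1) x\<bar> \<le> 1" by (simp add: cell_def)
  then show ?thesis unfolding slope_def abs_mult by (simp add: mult_left_le)
qed

lemma slope_nonzeroD:
  assumes "slope n i x \<noteq> 0"
  shows "real i \<le> x * real (n + 1)" "x * real (n + 1) < real i + 2"
proof -
  have "\<lfloor>x * real (n + 1)\<rfloor> = int i \<or> \<lfloor>x * real (n + 1)\<rfloor> = int (i + 1)"
    using assms by (auto simp: slope_def cell_def)
  then show "real i \<le> x * real (n + 1)" "x * real (n + 1) < real i + 2"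
    unfolding floor_eq_iff by auto
qed

lemma slope_mult_eq_0:
  assumes "1 < \<bar>int i - int j\<bar>" shows "slope n j x * slope n i x = 0"
  using assms by (auto simp: slope_def cell_def)

lemma slope_mult_hat_eq_0:
  assumes "1 < \<bar>int i - int j\<bar>" shows "slope n j x * hat n (i + 1) x = 0"
  using assms by (auto simp: slope_def hat_eq[simplified] cell_def)

lemma hat_mult_hat_eq_0:
  assumes "1 < \<bar>int i - int j\<bar>" shows "hat n (j + 1) x * hat n (i + 1) x = 0"
  using assms by (auto simp: hat_eq[simplified] cell_def)

lemma integrable_slope: "integrable unit_lebesgue (slope n i)"
  unfolding slope_def by (intro integrable_mult_right Bochner_Integration.integrable_diff integrable_cell)

text \<open>One slope is at most \<open>n + 1\<close>, which the scaling cancels, and the other has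
  L1 norm at most 2. The bound \<open>B\<close> concerns only the support of row \<open>i\<close>,
  so it applies to a coefficient minus its sample for that row.\<close>

lemma diffusion_entry_le:
  assumes i: "i < n" and b: "integrable unit_lebesgue b" and B: "0 \<le> B"
    and bd: "\<And>x. x \<in> {0..1} \<Longrightarrow> slope n i x \<noteq> 0 \<Longrightarrow> \<bar>b x\<bar> \<le> B"
  shows "\<bar>(LINT x|unit_lebesgue. b x * slope n j x * slope n i x) / real (n + 1)\<bar> \<le> 2 * B"
proof -
  have "\<bar>LINT x|unit_lebesgue. b x * slope n j x * slope n i x\<bar> \<le> (LINT x|unit_lebesgue. \<bar>b x * slope n j x * slope n i x\<bar>)"
    by (rule integral_abs_bound)
  also have "\<dots> \<le> (LINT x|unit_lebesgue. B * real (n + 1) * \<bar>slope n i x\<bar>)"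
  proof (rule integral_mono)
    show "integrable unit_lebesgue (\<lambda>x. \<bar>b x * slope n j x * slope n i x\<bar>)"
      by (intro integrable_abs integrable_weighted[OF b _ _ abs_slope_le_const abs_slope_le_const] slope_measurable)
    show "integrable unit_lebesgue (\<lambda>x. B * real (n + 1) * \<bar>slope n i x\<bar>)"
      by (intro integrable_mult_right integrable_abs integrable_slope)
    fix x assume "x \<in> space unit_lebesgue"
    then have x: "x \<in> {0..1}" by simp
    show "\<bar>b x * slope n j x * slope n i x\<bar> \<le> B * real (n + 1) * \<bar>slope n i x\<bar>"
    proof (cases "slope n i x = 0")
      case False
      show ?thesis
        unfolding abs_mult using bd[OF x False] abs_slope_le_const[of n j x] B by (intro mult_mono) auto
    qed simp
  qed
  also have "\<dots> = B * real (n + 1) * (LINT x|unit_lebesgue. \<bar>slope n i x\<bar>)" by simp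
  also have "\<dots> \<le> B * real (n + 1) * 2" using B by (intro mult_left_mono integral_abs_slope_le i) auto
  finally show ?thesis by (simp add: abs_divide divide_le_eq mult_ac del: of_nat_add of_nat_Suc)
qed

section \<open>Pure diffusion with a continuous coefficient\<close>

definition diffusion_matrix :: "(real \<Rightarrow> real) \<Rightarrow> nat \<Rightarrow> complex mat" where
  "diffusion_matrix \<alpha> n = Matrix.mat n n (\<lambda>(i, j).
     of_real ((LINT x|unit_lebesgue. \<alpha> x * slope n j x * slope n i x) / real (n + 1)))"

lemma continuous_integrable_unit: "continuous_on UNIV \<alpha> \<Longrightarrow> integrable unit_lebesgue (\<alpha> :: real \<Rightarrow> real)"
  by (rule continuous_imp_integrable_real) (rule continuous_on_subset, auto)

lemma diffusion_matrix_sampled_laplacian: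
  assumes cont: "continuous_on UNIV \<alpha>"
  shows "\<exists>d R. hermitian_sampled_laplacian \<alpha> (diffusion_matrix \<alpha>) d R"
proof -
  obtain K where K: "0 \<le> K" "\<And>x. x \<in> {0..1} \<Longrightarrow> \<bar>\<alpha> x\<bar> \<le> K"
    using bounded_on_unit_interval[OF cont] by auto
  obtain w where w: "w \<longlonglongrightarrow> 0" "\<And>n. 0 \<le> w n"
    "\<And>n x y. x \<in> {0..1} \<Longrightarrow> y \<in> {0..1} \<Longrightarrow> \<bar>x - y\<bar> \<le> 2 / real n \<Longrightarrow> \<bar>\<alpha> x - \<alpha> y\<bar> \<le> w n"
    using uniform_modulus[OF cont, of 2] by auto
  note int = continuous_integrable_unit[OF cont]
  have band: "diffusion_matrix \<alpha> n $$ (i, j) = 0" if "i < n" "j < n" "1 < \<bar>int i - int j\<bar>" for n i j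
    using that by (simp add: diffusion_matrix_def mult.assoc slope_mult_eq_0[OF that(3)])
  have "hermitian_sampled_laplacian \<alpha> (diffusion_matrix \<alpha>) (\<lambda>n. 2 * w n) (3 * (2 * K))"
  proof
    show "diffusion_matrix \<alpha> n \<in> carrier_mat n n" for n by (simp add: diffusion_matrix_def)
    show "(\<lambda>n. 2 * w n) \<longlonglongrightarrow> 0" using tendsto_mult[OF tendsto_const w(1), of 2] by simp
    show "mat_adjoint (diffusion_matrix \<alpha> n) = diffusion_matrix \<alpha> n" for n
      by (rule eq_matI) (auto simp: diffusion_matrix_def mult_ac)
    show "cmod (diffusion_matrix \<alpha> n $$ (i, j) - of_real (\<alpha> (real (i + 1) / real n)) * lap_coeff 1 (int i - int j)) \<le> 2 * w n"
      if ij: "i < n" "j < n" for n i j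
    proof -
      let ?c = "\<alpha> (real (i + 1) / real n)"
      have "diffusion_matrix \<alpha> n $$ (i, j) - of_real ?c * lap_coeff 1 (int i - int j) =
          of_real ((LINT x|unit_lebesgue. \<alpha> x * slope n j x * slope n i x) / real (n + 1) -
            ?c * ((LINT x|unit_lebesgue. slope n j x * slope n i x) / real (n + 1)))"
        unfolding integral_slope_mult_slope[OF ij, symmetric] using ij by (simp add: diffusion_matrix_def)
      also have "(LINT x|unit_lebesgue. \<alpha> x * slope n j x * slope n i x) / real (n + 1) -
            ?c * ((LINT x|unit_lebesgue. slope n j x * slope n i x) / real (n + 1)) =
          (LINT x|unit_lebesgue. (\<alpha> x - ?c) * slope n j x * slope n i x) / real (n + 1)"
      proof -
        have i1: "integrable unit_lebesgue (\<lambda>x. \<alpha> x * slope n j x * slope n i x)"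
          by (intro integrable_weighted[OF int _ _ abs_slope_le_const abs_slope_le_const] slope_measurable)
        have i2: "integrable unit_lebesgue (\<lambda>x. ?c * slope n j x * slope n i x)"
          by (intro integrable_weighted[OF _ _ _ abs_slope_le_const abs_slope_le_const] slope_measurable
              continuous_integrable_unit continuous_on_const)
        have "(LINT x|unit_lebesgue. (\<alpha> x - ?c) * slope n j x * slope n i x) =
            (LINT x|unit_lebesgue. \<alpha> x * slope n j x * slope n i x) - (LINT x|unit_lebesgue. ?c * slope n j x * slope n i x)"
          unfolding left_diff_distrib by (rule Bochner_Integration.integral_diff[OF i1 i2])
        then show ?thesis by (simp add: mult.assoc diff_divide_distrib)
      qed
      finally have "cmod (diffusion_matrix \<alpha> n $$ (i, j) - of_real ?c * lap_coeff 1 (int i - int j)) =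
          \<bar>(LINT x|unit_lebesgue. (\<alpha> x - ?c) * slope n j x * slope n i x) / real (n + 1)\<bar>"
        by (simp only: norm_of_real)
      also have "\<dots> \<le> 2 * w n"
      proof (rule diffusion_entry_le[OF ij(1) _ w(2)])
        show "integrable unit_lebesgue (\<lambda>x. \<alpha> x - ?c)"
          by (intro continuous_integrable_unit continuous_intros cont)
        fix x :: real assume x: "x \<in> {0..1}" "slope n i x \<noteq> 0"
        show "\<bar>\<alpha> x - ?c\<bar> \<le> w n"
        proof (rule w(3)[OF x(1)])
          show "real (i + 1) / real n \<in> {0..1}" using ij(1) by auto
          have n0: "0 < real n" using ij(1) by simp
          have xn: "0 \<le> x" "x \<le> 1" using x(1) by auto
          have i1: "real i + 1 \<le> real n" using ij(1) by linarith
          \<comment> \<open>Nodes are spaced by \<open>1 / (n + 1)\<close> while samples are taken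
            at \<open>(i + 1) / n\<close>. The support gives
            \<open>i \<le> x (n + 1) < i + 2\<close>; subtracting \<open>x\<close>, which lies
            between 0 and 1, costs at most one more, hence 2.\<close>
          have "\<bar>x * real n - (real i + 1)\<bar> \<le> 2"
            using slope_nonzeroD[OF x(2)] xn by (simp add: algebra_simps abs_le_iff)
          then have "\<bar>(x * real n - (real i + 1)) / real n\<bar> \<le> 2 / real n"
            unfolding abs_divide using n0 by (simp add: divide_right_mono)
          then show "\<bar>x - real (i + 1) / real n\<bar> \<le> 2 / real n"
            using n0 by (simp add: diff_divide_distrib add_divide_distrib)
        qed
      qed
      finally show ?thesis .
    qed
    show "(\<Sum>j<n. cmod (diffusion_matrix \<alpha> n $$ (k, j))) \<le> 3 * (2 * K)" if k: "k < n" for n k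
    proof -
      have "(\<Sum>j<n. cmod (diffusion_matrix \<alpha> n $$ (k, j))) \<le> (2 * real 1 + 1) * (2 * K)"
      proof (rule sum_near_le[where c = "int k"])
        fix j assume j: "j < n"
        have "cmod (diffusion_matrix \<alpha> n $$ (k, j)) = \<bar>(LINT x|unit_lebesgue. \<alpha> x * slope n j x * slope n k x) / real (n + 1)\<bar>"
          using k j by (simp only: diffusion_matrix_def index_mat prod.case norm_of_real)
        also have "\<dots> \<le> 2 * K" by (rule diffusion_entry_le[OF k int K(1) K(2)])
        finally show "cmod (diffusion_matrix \<alpha> n $$ (k, j)) \<le> 2 * K" .
        show "cmod (diffusion_matrix \<alpha> n $$ (k, j)) = 0" if "int 1 < \<bar>int k - int j\<bar>"
          using band[OF k j] that by simp
      qed (use K in simp)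
      then show ?thesis by simp
    qed
  qed (use cont band w(2) in auto)
  then show ?thesis by blast
qed

section \<open>The full scaled stiffness matrix: distance from pure diffusion and skew part\<close>

definition fem_matrix :: "(real \<Rightarrow> real) \<Rightarrow> (real \<Rightarrow> real) \<Rightarrow> (real \<Rightarrow> real) \<Rightarrow> nat \<Rightarrow> complex mat" where
  "fem_matrix a b c n = map_mat complex_of_real ((1 / real (n + 1)) \<cdot>\<^sub>m stiffness_matrix a b c n)"

lemma fem_matrix_carrier [simp]: "fem_matrix a b c n \<in> carrier_mat n n"
  by (simp add: fem_matrix_def stiffness_matrix_def)

lemma fem_matrix_entry:
  assumes "i < n" "j < n"
  shows "fem_matrix a b c n $$ (i, j) = of_real (((LINT x|unit_lebesgue. a x * slope n j x * slope n i x) +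
    (LINT x|unit_lebesgue. b x * slope n j x * hat n (i + 1) x) +
    (LINT x|unit_lebesgue. c x * hat n (j + 1) x * hat n (i + 1) x)) / real (n + 1))"
proof -
  have "stiffness_matrix a b c n \<in> carrier_mat n n" by (simp add: stiffness_matrix_def)
  then have "fem_matrix a b c n $$ (i, j) = of_real (stiffness_matrix a b c n $$ (i, j) / real (n + 1))"
    using assms by (simp add: fem_matrix_def)
  then show ?thesis by (simp only: stiffness_matrix_entry[OF assms])
qed

lemma fem_matrix_band:
  assumes "i < n" "j < n" "1 < \<bar>int i - int j\<bar>" shows "fem_matrix a b c n $$ (i, j) = 0"
  unfolding fem_matrix_entry[OF assms(1,2)] mult.assoc
  by (simp only: slope_mult_eq_0[OF assms(3)] slope_mult_hat_eq_0[OF assms(3)] hat_mult_hat_eq_0[OF assms(3)]) simp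

lemma advection_sum_le:
  assumes "integrable unit_lebesgue b"
  shows "(\<Sum>i<n. \<Sum>j<n. \<bar>(LINT x|unit_lebesgue. b x * slope n j x * hat n (i + 1) x) / real (n + 1)\<bar>)
    \<le> 4 * (LINT x|unit_lebesgue. \<bar>b x\<bar>)"
proof -
  have "(\<Sum>i<n. \<Sum>j<n. \<bar>LINT x|unit_lebesgue. b x * slope n j x * hat n (i + 1) x\<bar>)
      \<le> 2 * real (n + 1) * 2 * (LINT x|unit_lebesgue. \<bar>b x\<bar>)"
    by (intro sum_abs_weighted_integrals_le assms slope_measurable hat_measurable sum_abs_slope_le sum_abs_hat_le)
  then show ?thesis
    by (simp add: abs_divide divide_le_eq mult_ac flip: sum_divide_distrib del: of_nat_add of_nat_Suc)
qed

text \<open>Pointwise, slopes sum to at most \<open>2 (n + 1)\<close> and hats to at most 2; the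
  constants are products of two of these divided by \<open>n + 1\<close>. Only the diffusion term
  grows with \<open>n\<close>, and it carries the L1 distance of the coefficients.\<close>

theorem fem_matrix_perturbation:
  assumes a: "integrable unit_lebesgue a" and b: "integrable unit_lebesgue b" and c: "integrable unit_lebesgue c"
    and \<alpha>: "integrable unit_lebesgue \<alpha>"
  shows "mat_l1 (fem_matrix a b c n - diffusion_matrix \<alpha> n) \<le> 4 * real (n + 1) * (LINT x|unit_lebesgue. \<bar>a x - \<alpha> x\<bar>) +
    4 * (LINT x|unit_lebesgue. \<bar>b x\<bar>) + 4 * (LINT x|unit_lebesgue. \<bar>c x\<bar>)"
proof -
  let ?N = "real (n + 1)"
  let ?I1 = "\<lambda>i j. LINT x|unit_lebesgue. (a x - \<alpha> x) * slope n j x * slope n i x"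
  let ?I2 = "\<lambda>i j. LINT x|unit_lebesgue. b x * slope n j x * hat n (i + 1) x"
  let ?I3 = "\<lambda>i j. LINT x|unit_lebesgue. c x * hat n (j + 1) x * hat n (i + 1) x"
  have entry: "cmod ((fem_matrix a b c n - diffusion_matrix \<alpha> n) $$ (i, j)) \<le> \<bar>?I1 i j\<bar> / ?N + \<bar>?I2 i j / ?N\<bar> + \<bar>?I3 i j\<bar> / ?N"
    if ij: "i < n" "j < n" for i j
  proof -
    have i1: "integrable unit_lebesgue (\<lambda>x. g x * slope n j x * slope n i x)" if "integrable unit_lebesgue g" for g
      by (intro integrable_weighted[OF that _ _ abs_slope_le_const abs_slope_le_const] slope_measurable)
    have "?I1 i j = (LINT x|unit_lebesgue. a x * slope n j x * slope n i x) - (LINT x|unit_lebesgue. \<alpha> x * slope n j x * slope n i x)"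
      unfolding left_diff_distrib by (rule Bochner_Integration.integral_diff[OF i1[OF a] i1[OF \<alpha>]])
    then have "(fem_matrix a b c n - diffusion_matrix \<alpha> n) $$ (i, j) = of_real (?I1 i j / ?N + ?I2 i j / ?N + ?I3 i j / ?N)"
      using ij fem_matrix_entry[OF ij, of a b c]
      by (simp add: diffusion_matrix_def add_divide_distrib diff_divide_distrib del: of_nat_add of_nat_Suc)
    then have "cmod ((fem_matrix a b c n - diffusion_matrix \<alpha> n) $$ (i, j)) = \<bar>?I1 i j / ?N + ?I2 i j / ?N + ?I3 i j / ?N\<bar>"
      by (simp only: norm_of_real)
    also have "\<dots> \<le> \<bar>?I1 i j / ?N\<bar> + \<bar>?I2 i j / ?N\<bar> + \<bar>?I3 i j / ?N\<bar>" by linarith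
    finally show ?thesis by (simp add: abs_divide)
  qed
  have carr: "fem_matrix a b c n - diffusion_matrix \<alpha> n \<in> carrier_mat n n"
    by (rule minus_carrier_mat) (simp add: diffusion_matrix_def)
  have S1: "(\<Sum>i<n. \<Sum>j<n. \<bar>?I1 i j\<bar>) / ?N \<le> 4 * ?N * (LINT x|unit_lebesgue. \<bar>a x - \<alpha> x\<bar>)"
  proof -
    have "(\<Sum>i<n. \<Sum>j<n. \<bar>?I1 i j\<bar>) \<le> 2 * ?N * (2 * ?N) * (LINT x|unit_lebesgue. \<bar>a x - \<alpha> x\<bar>)"
      using a \<alpha> by (intro sum_abs_weighted_integrals_le slope_measurable sum_abs_slope_le) auto
    then show ?thesis by (simp add: divide_le_eq mult_ac del: of_nat_add of_nat_Suc)
  qed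
  have S2: "(\<Sum>i<n. \<Sum>j<n. \<bar>?I2 i j / ?N\<bar>) \<le> 4 * (LINT x|unit_lebesgue. \<bar>b x\<bar>)"
    by (rule advection_sum_le[OF b])
  have S3: "(\<Sum>i<n. \<Sum>j<n. \<bar>?I3 i j\<bar>) / ?N \<le> 4 * (LINT x|unit_lebesgue. \<bar>c x\<bar>)"
  proof -
    have "(\<Sum>i<n. \<Sum>j<n. \<bar>?I3 i j\<bar>) \<le> 2 * 2 * (LINT x|unit_lebesgue. \<bar>c x\<bar>)"
      by (intro sum_abs_weighted_integrals_le c hat_measurable sum_abs_hat_le)
    also have "\<dots> \<le> 4 * (LINT x|unit_lebesgue. \<bar>c x\<bar>) * ?N"
    proof -
      have "0 \<le> (LINT x|unit_lebesgue. \<bar>c x\<bar>)" by (rule Bochner_Integration.integral_nonneg) simp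
      then have "4 * (LINT x|unit_lebesgue. \<bar>c x\<bar>) * 1 \<le> 4 * (LINT x|unit_lebesgue. \<bar>c x\<bar>) * ?N"
        by (intro mult_left_mono) auto
      then show ?thesis by simp
    qed
    finally show ?thesis by (simp add: divide_le_eq del: of_nat_add of_nat_Suc)
  qed
  have "mat_l1 (fem_matrix a b c n - diffusion_matrix \<alpha> n) =
      (\<Sum>i<n. \<Sum>j<n. cmod ((fem_matrix a b c n - diffusion_matrix \<alpha> n) $$ (i, j)))"
    unfolding mat_l1_def using carr by (simp only: carrier_matD)
  also have "\<dots> \<le> (\<Sum>i<n. \<Sum>j<n. \<bar>?I1 i j\<bar> / ?N + \<bar>?I2 i j / ?N\<bar> + \<bar>?I3 i j\<bar> / ?N)"
    by (intro sum_mono entry) auto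
  also have "\<dots> = (\<Sum>i<n. \<Sum>j<n. \<bar>?I1 i j\<bar>) / ?N + (\<Sum>i<n. \<Sum>j<n. \<bar>?I2 i j / ?N\<bar>) + (\<Sum>i<n. \<Sum>j<n. \<bar>?I3 i j\<bar>) / ?N"
    by (simp only: sum.distrib sum_divide_distrib)
  finally show ?thesis using S1 S2 S3 by linarith
qed

text \<open>Diffusion and reaction are symmetric and cancel against the adjoint, which leaves twice
  the advection bound.\<close>

lemma fem_matrix_skew_part:
  assumes b: "integrable unit_lebesgue b"
  shows "mat_l1 (fem_matrix a b c n - mat_adjoint (fem_matrix a b c n)) \<le> 8 * (LINT x|unit_lebesgue. \<bar>b x\<bar>)"
proof -
  let ?A = "fem_matrix a b c n"
  let ?J = "\<lambda>i j. (LINT x|unit_lebesgue. b x * slope n j x * hat n (i + 1) x) / real (n + 1)"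
  have entry: "cmod ((?A - mat_adjoint ?A) $$ (i, j)) \<le> \<bar>?J i j\<bar> + \<bar>?J j i\<bar>" if ij: "i < n" "j < n" for i j
  proof -
    have dims: "dim_row ?A = n" "dim_col ?A = n" using fem_matrix_carrier[of a b c n] by (simp_all only: carrier_matD)
    have "(?A - mat_adjoint ?A) $$ (i, j) = ?A $$ (i, j) - cnj (?A $$ (j, i))"
      using ij dims by simp
    also have "\<dots> = of_real (?J i j - ?J j i)"
      unfolding fem_matrix_entry[OF ij] fem_matrix_entry[OF ij(2,1)]
      by (simp add: add_divide_distrib mult_ac del: of_nat_add of_nat_Suc)
    finally have "cmod ((?A - mat_adjoint ?A) $$ (i, j)) = \<bar>?J i j - ?J j i\<bar>" by (simp only: norm_of_real)
    then show ?thesis by linarith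
  qed
  have "mat_l1 (?A - mat_adjoint ?A) = (\<Sum>i<n. \<Sum>j<n. cmod ((?A - mat_adjoint ?A) $$ (i, j)))"
    unfolding mat_l1_def using minus_carrier_mat[OF mat_adjoint_carrier[OF fem_matrix_carrier]]
    by (simp only: carrier_matD[OF minus_carrier_mat[OF mat_adjoint_carrier[OF fem_matrix_carrier]]])
  also have "\<dots> \<le> (\<Sum>i<n. \<Sum>j<n. \<bar>?J i j\<bar> + \<bar>?J j i\<bar>)" by (intro sum_mono entry) auto
  also have "\<dots> = (\<Sum>i<n. \<Sum>j<n. \<bar>?J i j\<bar>) + (\<Sum>i<n. \<Sum>j<n. \<bar>?J j i\<bar>)" by (simp only: sum.distrib)
  also have "(\<Sum>i<n. \<Sum>j<n. \<bar>?J j i\<bar>) = (\<Sum>i<n. \<Sum>j<n. \<bar>?J i j\<bar>)" by (rule sum.swap)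
  finally show ?thesis using advection_sum_le[OF b, of n] by linarith
qed

section \<open>Distribution of the stiffness matrices\<close>

text \<open>A diagonal argument: for each \<open>m\<close> closeness is asked only from some
  \<open>n\<close> on. It is the scalar counterpart of an approximating class of sequences.\<close>

lemma tendsto_of_approximations:
  fixes u :: "nat \<Rightarrow> complex" and v :: "nat \<Rightarrow> nat \<Rightarrow> complex"
  assumes v: "\<And>m. v m \<longlonglongrightarrow> L m" and L: "L \<longlonglongrightarrow> l" and \<eta>: "\<eta> \<longlonglongrightarrow> (0 :: real)"
    and uv: "\<And>m. \<forall>\<^sub>F n in sequentially. cmod (u n - v m n) \<le> \<eta> m"
  shows "u \<longlonglongrightarrow> l"
  unfolding tendsto_iff
proof (intro allI impI)
  fix e :: real assume e: "0 < e"
  then have "\<forall>\<^sub>F m in sequentially. \<eta> m < e / 3" "\<forall>\<^sub>F m in sequentially. dist (L m) l < e / 3"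
    using order_tendstoD(2)[OF \<eta>, of "e / 3"] tendstoD[OF L, of "e / 3"] by auto
  then have "\<forall>\<^sub>F m in sequentially. \<eta> m < e / 3 \<and> dist (L m) l < e / 3" by (rule eventually_conj)
  then obtain m where m: "\<eta> m < e / 3" "dist (L m) l < e / 3" by (auto simp: eventually_sequentially)
  have "\<forall>\<^sub>F n in sequentially. dist (v m n) (L m) < e / 3" using tendstoD[OF v, of "e / 3"] e by simp
  with uv[of m] show "\<forall>\<^sub>F n in sequentially. dist (u n) l < e"
  proof eventually_elim
    case (elim n)
    have "dist (u n) l \<le> dist (u n) (v m n) + dist (v m n) (L m) + dist (L m) l"
      using dist_triangle[of "u n" l "v m n"] dist_triangle[of "v m n" l "L m"] by linarith
    then show ?case using elim m by (simp add: dist_norm)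
  qed
qed

lemma im_bounded_mono:
  assumes "im_bounded A c" "c \<le> c'" shows "im_bounded A c'"
  using assms unfolding im_bounded_def by (meson mult_right_mono order_trans zero_le_power2)

lemma cmod_sum_mset_le:
  fixes f :: "'a \<Rightarrow> complex"
  assumes "\<And>x. x \<in># A \<Longrightarrow> cmod (f x) \<le> g x"
  shows "cmod (\<Sum>x\<in>#A. f x) \<le> (\<Sum>x\<in>#A. g x)"
  using assms by (induction A) (auto intro!: norm_triangle_le add_mono)

lemma sum_mset_minus:
  fixes f g :: "'a \<Rightarrow> complex"
  shows "(\<Sum>x\<in>#A. f x) - (\<Sum>x\<in>#A. g x) = (\<Sum>x\<in>#A. f x - g x)"
  by (induction A) (auto simp: algebra_simps)

lemma tendsto_diff_of_abs_le:
  fixes u v :: "nat \<Rightarrow> complex"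
  assumes v: "v \<longlonglongrightarrow> l" and uv: "\<And>n. 1 \<le> n \<Longrightarrow> cmod (u n - v n) \<le> K / real n"
  shows "u \<longlonglongrightarrow> l"
proof -
  have "(\<lambda>n. u n - v n) \<longlonglongrightarrow> 0"
  proof (rule tendsto_norm_zero_cancel, rule tendsto_sandwich[OF _ _ tendsto_const])
    show "\<forall>\<^sub>F n in sequentially. norm (u n - v n) \<le> K * (1 / real n)"
      using eventually_ge_at_top[of 1] by eventually_elim (simp add: uv)
    show "(\<lambda>n. K * (1 / real n)) \<longlonglongrightarrow> 0"
      using tendsto_mult[OF tendsto_const lim_1_over_n, of K] by simp
  qed simp
  from tendsto_add[OF this v] show ?thesis by simp
qed

lemma Cc_bounded:
  fixes F :: "complex \<Rightarrow> complex"
  assumes F: "F \<in> Cc"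
  shows "\<exists>B\<ge>0. \<forall>x. cmod (F x) \<le> B"
proof -
  have c: "continuous_on UNIV F" and b: "bounded {x. F x \<noteq> 0}" using F by (auto simp: Cc_def)
  obtain K where K: "\<And>x. F x \<noteq> 0 \<Longrightarrow> cmod x \<le> K" using b unfolding bounded_iff by auto
  have "compact (F ` cball 0 K)" by (rule compact_continuous_image[OF continuous_on_subset[OF c]]) auto
  then obtain B where "\<forall>x\<in>cball 0 K. cmod (F x) \<le> B" unfolding compact_eq_bounded_closed bounded_iff by auto
  then have "cmod (F x) \<le> max B 0" for x
    using K[of x] by (cases "F x = 0") (auto simp: le_max_iff_disj)
  then show ?thesis by (intro exI[of _ "max B 0"]) auto
qed

text \<open>\<open>K\<close> bounds the support of \<open>F\<close>. On the ball of radius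
  \<open>K + C\<close> uniform continuity applies; outside it \<open>|Re x|\<close> exceeds
  \<open>K\<close> as well, so both values vanish.\<close>

lemma Cc_uniform:
  fixes F :: "complex \<Rightarrow> complex"
  assumes F: "F \<in> Cc" and e: "0 < e" and C: "0 \<le> C"
  shows "\<exists>d>0. \<forall>x. \<bar>Im x\<bar> \<le> C \<longrightarrow> \<bar>Im x\<bar> < d \<longrightarrow> cmod (F x - F (of_real (Re x))) < e"
proof -
  have c: "continuous_on UNIV F" and b: "bounded {x. F x \<noteq> 0}" using F by (auto simp: Cc_def)
  obtain K where K: "\<And>x. F x \<noteq> 0 \<Longrightarrow> cmod x \<le> K" using b unfolding bounded_iff by auto
  have "uniformly_continuous_on (cball 0 (K + C)) F"
    by (rule compact_uniformly_continuous[OF continuous_on_subset[OF c]]) auto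
  then obtain d where d: "0 < d" "\<And>x y. x \<in> cball 0 (K + C) \<Longrightarrow> y \<in> cball 0 (K + C) \<Longrightarrow> dist x y < d \<Longrightarrow> dist (F x) (F y) < e"
    unfolding uniformly_continuous_on_def using e by metis
  have "cmod (F x - F (of_real (Re x))) < e" if x: "\<bar>Im x\<bar> \<le> C" "\<bar>Im x\<bar> < d" for x
  proof (cases "cmod x \<le> K + C")
    case True
    have "x - of_real (Re x) = \<i> * of_real (Im x)" by (simp add: complex_eq_iff)
    then have "dist x (of_real (Re x)) = \<bar>Im x\<bar>" by (simp add: dist_norm norm_mult)
    then show ?thesis
      using d(2)[of x "of_real (Re x)"] x True abs_Re_le_cmod[of x] by (simp add: dist_norm)
  next
    case False
    have "cmod x \<le> \<bar>Re x\<bar> + \<bar>Im x\<bar>" by (rule cmod_le)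
    then have "K < \<bar>Re x\<bar>" using False x by linarith
    then have "F (of_real (Re x)) = 0" using K[of "of_real (Re x)"] by auto
    moreover have "F x = 0" using K[of x] False C by auto
    ultimately show ?thesis using e by simp
  qed
  then show ?thesis using d(1) by blast
qed

text \<open>Markov's inequality with threshold \<open>sqrt \<eta>\<close>: at most
  \<open>sqrt \<eta> * n\<close> columns have a larger sum, and they form \<open>R\<close>. In
  \<open>N\<close> every column sum, hence every entry, is at most \<open>sqrt \<eta>\<close>; three
  entries per row and the Schur test give the norm bound.\<close>

lemma tridiagonal_acs_splitting:
  assumes E: "E \<in> carrier_mat n n"
    and band: "\<And>i j. i < n \<Longrightarrow> j < n \<Longrightarrow> 1 < \<bar>int i - int j\<bar> \<Longrightarrow> E $$ (i, j) = 0"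
    and l1: "mat_l1 E \<le> \<eta> * real n" and \<eta>: "0 < \<eta>"
  shows "\<exists>R\<in>carrier_mat n n. \<exists>N\<in>carrier_mat n n. E = R + N \<and>
    real (vec_space.rank n R) \<le> sqrt \<eta> * real n \<and> spectral_norm N \<le> 3 * sqrt \<eta>"
proof -
  let ?s = "\<lambda>j. \<Sum>i<n. cmod (E $$ (i, j))"
  define J where "J = {j. j < n \<and> sqrt \<eta> < ?s j}"
  define R where "R = Matrix.mat n n (\<lambda>(i, j). if j \<in> J then E $$ (i, j) else 0)"
  define N where "N = Matrix.mat n n (\<lambda>(i, j). if j \<in> J then 0 else E $$ (i, j))"
  have R: "R \<in> carrier_mat n n" and N: "N \<in> carrier_mat n n" by (simp_all add: R_def N_def)
  have sq: "0 < sqrt \<eta>" using \<eta> by simp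
  have "sqrt \<eta> * real (card J) \<le> (\<Sum>j\<in>J. ?s j)"
    using sum_mono[of J "\<lambda>_. sqrt \<eta>" ?s] by (auto simp: J_def mult.commute)
  also have "\<dots> \<le> (\<Sum>j<n. ?s j)" by (intro sum_mono2) (auto simp: J_def intro: sum_nonneg)
  also have "\<dots> = mat_l1 E" using E by (subst sum.swap) (simp add: mat_l1_def)
  also have "\<dots> \<le> sqrt \<eta> * (sqrt \<eta> * real n)" using l1 \<eta> by (simp flip: mult.assoc)
  finally have cardJ: "real (card J) \<le> sqrt \<eta> * real n" using sq by simp
  have "vec_space.rank n R \<le> card J"
    by (rule rank_le_nonzero_columns[OF R]) (auto simp: J_def R_def)
  then have rank: "real (vec_space.rank n R) \<le> sqrt \<eta> * real n" using cardJ by linarith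
  have col: "(\<Sum>i<n. cmod (N $$ (i, j))) \<le> sqrt \<eta>" if "j < n" for j
    using that sq by (cases "j \<in> J") (auto simp: N_def J_def)
  have entry: "cmod (N $$ (i, j)) \<le> sqrt \<eta>" if "i < n" "j < n" for i j
    using member_le_sum[of i "{..<n}" "\<lambda>i. cmod (N $$ (i, j))"] col[OF that(2)] that(1) by auto
  have row: "(\<Sum>j<n. cmod (N $$ (i, j))) \<le> 3 * sqrt \<eta>" if i: "i < n" for i
  proof -
    have "(\<Sum>j<n. cmod (N $$ (i, j))) \<le> (2 * real 1 + 1) * sqrt \<eta>"
      using i entry[OF i] sq band[OF i]
      by (intro sum_near_le[where c = "int i"]) (auto simp: N_def)
    then show ?thesis by simp
  qed
  have "op_bounded N (3 * sqrt \<eta>)"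
  proof (rule op_bounded_schur_test[OF N])
    show "(\<Sum>i<n. cmod (N $$ (i, j))) \<le> 3 * sqrt \<eta>" if "j < n" for j
      using col[OF that] sq by linarith
  qed (use row sq in auto)
  then have "spectral_norm N \<le> 3 * sqrt \<eta>" using spectral_norm_le[OF N] sq by simp
  moreover have "E = R + N" using E by (intro eq_matI) (auto simp: R_def N_def)
  ultimately show ?thesis using R N rank by blast
qed

section \<open>From continuous to integrable diffusion coefficients\<close>

locale fem =
  fixes a b c :: "real \<Rightarrow> real" and \<alpha> :: "nat \<Rightarrow> real \<Rightarrow> real"
  assumes a: "integrable unit_lebesgue a" and b: "integrable unit_lebesgue b" and c: "integrable unit_lebesgue c"
    and cont: "continuous_on UNIV (\<alpha> m)"
    and L1: "(\<lambda>m. LINT x|unit_lebesgue. \<bar>a x - \<alpha> m x\<bar>) \<longlonglongrightarrow> 0"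
    and lim: "AE x in unit_lebesgue. (\<lambda>m. \<alpha> m x) \<longlonglongrightarrow> a x"
begin

abbreviation "A n \<equiv> fem_matrix a b c n"
abbreviation "X m n \<equiv> diffusion_matrix (\<alpha> m) n"

definition lower_order where
  "lower_order = 4 * (LINT x|unit_lebesgue. \<bar>b x\<bar>) + 4 * (LINT x|unit_lebesgue. \<bar>c x\<bar>)"

text \<open>The 8 comes from \<open>4 * (n + 1) \<le> 8 * n\<close>. The summand
  \<open>1 / real (Suc m)\<close> absorbs \<open>lower_order / n\<close> for large \<open>n\<close>
  and keeps \<open>err m\<close> positive, as the splitting into small rank and small norm
  demands.\<close>

definition err :: "nat \<Rightarrow> real" where
  "err m = 8 * (LINT x|unit_lebesgue. \<bar>a x - \<alpha> m x\<bar>) + 1 / real (Suc m)"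

definition fem_symbol where "fem_symbol p = a (fst p) * (2 - 2 * cos (snd p))"
definition approx_symbol where "approx_symbol m p = \<alpha> m (fst p) * (2 - 2 * cos (snd p))"

lemma err_pos: "0 < err m"
  unfolding err_def by (intro add_nonneg_pos mult_nonneg_nonneg Bochner_Integration.integral_nonneg) auto

lemma err_tendsto: "err \<longlonglongrightarrow> 0"
proof -
  have "(\<lambda>m. 8 * (LINT x|unit_lebesgue. \<bar>a x - \<alpha> m x\<bar>) + 1 / real (Suc m)) \<longlonglongrightarrow> 8 * 0 + 0"
    using LIMSEQ_inverse_real_of_nat by (intro tendsto_add tendsto_mult tendsto_const L1) (simp add: inverse_eq_divide)
  then show ?thesis unfolding err_def[abs_def] by simp
qed

lemma X_carrier [simp]: "X m n \<in> carrier_mat n n"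
  by (simp add: diffusion_matrix_def)

lemma mat_l1_small: "\<forall>\<^sub>F n in sequentially. mat_l1 (A n - X m n) / real n \<le> err m"
proof -
  have "(\<lambda>n. lower_order * (1 / real n)) \<longlonglongrightarrow> lower_order * 0" by (intro tendsto_mult tendsto_const lim_1_over_n)
  then have "\<forall>\<^sub>F n in sequentially. lower_order * (1 / real n) < 1 / real (Suc m)"
    by (intro order_tendstoD(2)[of _ 0]) auto
  then show ?thesis
    using eventually_ge_at_top[of 1]
  proof eventually_elim
    case (elim n)
    let ?I = "LINT x|unit_lebesgue. \<bar>a x - \<alpha> m x\<bar>"
    have I: "0 \<le> ?I" by (rule Bochner_Integration.integral_nonneg) simp
    have n: "0 < real n" using elim by simp
    have "mat_l1 (A n - X m n) \<le> 4 * real (n + 1) * ?I + lower_order"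
      using fem_matrix_perturbation[OF a b c continuous_integrable_unit[OF cont[of m]], of n]
      by (simp add: lower_order_def)
    also have "\<dots> \<le> 8 * real n * ?I + lower_order"
      using elim I by (intro add_right_mono mult_right_mono) auto
    finally have "mat_l1 (A n - X m n) / real n \<le> (8 * real n * ?I + lower_order) / real n"
      using n by (simp add: divide_right_mono)
    also have "\<dots> = 8 * ?I + lower_order * (1 / real n)" using n by (simp add: add_divide_distrib)
    finally show ?case using elim by (simp add: err_def)
  qed
qed

lemma X_sampled: "\<exists>d R. hermitian_sampled_laplacian (\<alpha> m) (diffusion_matrix (\<alpha> m)) d R"
  by (rule diffusion_matrix_sampled_laplacian[OF cont])

lemma X_hermitian: "mat_adjoint (X m n) = X m n"
  using X_sampled[of m] unfolding hermitian_sampled_laplacian_def hermitian_sampled_laplacian_axioms_def by blast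

lemma X_mean_tendsto:
  fixes F :: "real \<Rightarrow> complex"
  assumes "continuous_on UNIV F"
  shows "(\<lambda>n. (\<Sum>x\<in>#eigenvalues (X m n). F (Re x)) / of_nat n) \<longlonglongrightarrow> symbol_mean glt_domain (\<lambda>p. F (approx_symbol m p))"
proof -
  obtain d R where "hermitian_sampled_laplacian (\<alpha> m) (diffusion_matrix (\<alpha> m)) d R" using X_sampled by blast
  then interpret S: hermitian_sampled_laplacian "\<alpha> m" "diffusion_matrix (\<alpha> m)" d R .
  show ?thesis
    using S.eigenvalue_mean_tendsto[OF assms] by (simp add: approx_symbol_def image_mset.compositionality comp_def)
qed

lemma X_eigenvalue_real: "x \<in># eigenvalues (X m n) \<Longrightarrow> of_real (Re x) = x"
  using eigenvalues_hermitian_real[OF X_carrier X_hermitian] by (simp add: complex_eq_iff)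

lemma fem_symbol_measurable: "fem_symbol \<in> borel_measurable (lebesgue_on glt_domain)"
proof -
  have "(\<lambda>p. a (fst p)) \<in> borel_measurable (lebesgue_on glt_domain)"
    by (rule fst_measurable_glt_domain[OF borel_measurable_integrable[OF a]])
  moreover have "(\<lambda>p :: real \<times> real. 2 - 2 * cos (snd p)) \<in> borel_measurable (lebesgue_on glt_domain)"
    by (intro continuous_measurable_lebesgue_on continuous_intros)
  ultimately show ?thesis unfolding fem_symbol_def[abs_def] by (rule borel_measurable_times)
qed

lemma approx_symbol_continuous: "continuous_on UNIV (approx_symbol m)"
  unfolding approx_symbol_def[abs_def] by (intro continuous_intros continuous_on_compose2[OF cont]) auto

lemma approx_symbol_tendsto: "AE p in lebesgue_on glt_domain. (\<lambda>m. approx_symbol m p) \<longlonglongrightarrow> fem_symbol p"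
  using AE_glt_domain_fst[OF lim]
proof eventually_elim
  case (elim p)
  then show ?case unfolding approx_symbol_def fem_symbol_def by (intro tendsto_mult tendsto_const)
qed

lemma symbol_mean_approx_tendsto:
  fixes F :: "real \<Rightarrow> complex"
  assumes F: "continuous_on UNIV F" and B: "\<And>t. cmod (F t) \<le> B"
  shows "(\<lambda>m. symbol_mean glt_domain (\<lambda>p. F (approx_symbol m p))) \<longlonglongrightarrow> symbol_mean glt_domain (\<lambda>p. F (fem_symbol p))"
proof (rule symbol_mean_tendsto[where B = B])
  show "(\<lambda>p. F (approx_symbol m p)) \<in> borel_measurable (lebesgue_on glt_domain)" for m
    by (intro continuous_measurable_lebesgue_on continuous_on_compose2[OF F approx_symbol_continuous]) auto
  show "(\<lambda>p. F (fem_symbol p)) \<in> borel_measurable (lebesgue_on glt_domain)"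
    by (rule measurable_compose[OF fem_symbol_measurable borel_measurable_continuous_onI[OF F]])
  show "AE p in lebesgue_on glt_domain. (\<lambda>m. F (approx_symbol m p)) \<longlonglongrightarrow> F (fem_symbol p)"
    using approx_symbol_tendsto
  proof eventually_elim
    case (elim p)
    then show ?case
      using F by (intro isCont_tendsto_compose[of "fem_symbol p" F]) (auto simp: continuous_on_eq_continuous_at)
  qed
  show "emeasure lebesgue glt_domain < \<infinity>" by (simp add: emeasure_glt_domain del: emeasure_completion)
qed (use B in auto)

section \<open>Eigenvalue distribution\<close>

lemma resolvent_continuous: "Im z \<noteq> 0 \<Longrightarrow> continuous_on UNIV (\<lambda>t. 1 / (complex_of_real t - z))"
  by (intro continuous_intros) (auto simp: complex_eq_iff)

text \<open>Half the bound of \<open>fem_matrix_skew_part\<close>. It bounds, uniformly in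
  \<open>n\<close>, both the half-width of the strip and the sum of the moduli of the imaginary
  parts of the eigenvalues.\<close>

definition skew where "skew = 4 * (LINT x|unit_lebesgue. \<bar>b x\<bar>)"

lemma skew_nonneg: "0 \<le> skew"
  unfolding skew_def by (intro mult_nonneg_nonneg Bochner_Integration.integral_nonneg) auto

lemma A_im_bounded: "im_bounded (A n) skew"
proof (rule im_bounded_mono[OF im_bounded_mat_l1[OF fem_matrix_carrier]])
  show "mat_l1 (A n - mat_adjoint (A n)) / 2 \<le> skew"
    using fem_matrix_skew_part[OF b, of a c n] unfolding skew_def by linarith
qed

lemma sum_abs_Im_A: "(\<Sum>x\<in>#eigenvalues (A n). \<bar>Im x\<bar>) \<le> skew"
  using sum_abs_Im_eigenvalues_le[OF fem_matrix_carrier, of a b c n] fem_matrix_skew_part[OF b, of a c n]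
  unfolding skew_def by linarith

lemma A_abs_Im_le:
  assumes "x \<in># eigenvalues (A n)" shows "\<bar>Im x\<bar> \<le> skew"
proof -
  obtain M where M: "eigenvalues (A n) = add_mset x M" using multi_member_split[OF assms] by blast
  have "0 \<le> (\<Sum>y\<in>#M. \<bar>Im y\<bar>)" by (induction M) auto
  then show ?thesis using sum_abs_Im_A[of n] by (simp add: M)
qed

text \<open>From height \<open>skew + 1\<close> on, the squared distance to the strip is at least 1,
  so the normalised traces for \<open>A n\<close> and \<open>X m n\<close> eventually differ by at
  most \<open>err m\<close>. The limit in \<open>m\<close> rests on the boundedness of the
  resolvent, as \<open>fem_symbol\<close> may be unbounded.\<close>

lemma A_resolvent_tendsto:
  assumes z: "skew + 1 \<le> \<bar>Im z\<bar>"
  shows "(\<lambda>n. (\<Sum>x\<in>#eigenvalues (A n). 1 / (x - z)) / of_nat n) \<longlonglongrightarrow>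
    symbol_mean glt_domain (\<lambda>p. 1 / (of_real (fem_symbol p) - z))"
proof (rule tendsto_of_approximations)
  have Imz: "Im z \<noteq> 0" "skew < \<bar>Im z\<bar>" "1 \<le> \<bar>Im z\<bar>" using z skew_nonneg by auto
  show "(\<lambda>n. (\<Sum>x\<in>#eigenvalues (X m n). 1 / (of_real (Re x) - z)) / of_nat n) \<longlonglongrightarrow>
      symbol_mean glt_domain (\<lambda>p. 1 / (of_real (approx_symbol m p) - z))" for m
    by (rule X_mean_tendsto[OF resolvent_continuous[OF Imz(1)]])
  show "(\<lambda>m. symbol_mean glt_domain (\<lambda>p. 1 / (of_real (approx_symbol m p) - z))) \<longlonglongrightarrow>
      symbol_mean glt_domain (\<lambda>p. 1 / (of_real (fem_symbol p) - z))"
    using cmod_resolvent_le[of 1 z] Imz(3)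
    by (intro symbol_mean_approx_tendsto[OF resolvent_continuous[OF Imz(1)], where B = "1 / 1"]) simp
  show "err \<longlonglongrightarrow> 0" by (rule err_tendsto)
  fix m
  show "\<forall>\<^sub>F n in sequentially. cmod ((\<Sum>x\<in>#eigenvalues (A n). 1 / (x - z)) / of_nat n -
      (\<Sum>x\<in>#eigenvalues (X m n). 1 / (of_real (Re x) - z)) / of_nat n) \<le> err m"
    using mat_l1_small[of m]
  proof eventually_elim
    case (elim n)
    have eq: "(\<Sum>x\<in>#eigenvalues (X m n). 1 / (of_real (Re x) - z)) = (\<Sum>x\<in>#eigenvalues (X m n). 1 / (x - z))"
      by (intro arg_cong[where f = sum_mset] image_mset_cong) (simp add: X_eigenvalue_real)
    have "cmod ((\<Sum>x\<in>#eigenvalues (A n). 1 / (x - z)) - (\<Sum>x\<in>#eigenvalues (X m n). 1 / (x - z)))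
        \<le> mat_l1 (A n - X m n) / (\<bar>Im z\<bar> - skew)\<^sup>2"
      using im_bounded_mono[OF im_bounded_hermitian[OF X_carrier X_hermitian] skew_nonneg]
      by (intro resolvent_trace_perturbation[OF fem_matrix_carrier X_carrier A_im_bounded _ Imz(2)])
    also have "\<dots> \<le> mat_l1 (A n - X m n) / 1"
      using z one_le_power[of "\<bar>Im z\<bar> - skew" 2] by (intro divide_left_mono) auto
    finally have "cmod ((\<Sum>x\<in>#eigenvalues (A n). 1 / (x - z)) - (\<Sum>x\<in>#eigenvalues (X m n). 1 / (x - z))) / real n
        \<le> mat_l1 (A n - X m n) / real n"
      by (simp add: divide_right_mono)
    then show ?case using elim unfolding eq by (simp add: diff_divide_distrib[symmetric] norm_divide)
  qed
qed

text \<open>Both denominators have modulus at least 1, so replacing an eigenvalue by its real part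
  costs at most its imaginary part. These costs add up to at most \<open>skew\<close>, which
  vanishes after division by \<open>n\<close>.\<close>

lemma A_real_resolvent_tendsto:
  assumes z: "skew + 1 \<le> \<bar>Im z\<bar>"
  shows "(\<lambda>n. (\<Sum>t\<in>#image_mset Re (eigenvalues (A n)). 1 / (of_real t - z)) / of_nat n) \<longlonglongrightarrow>
    symbol_mean glt_domain (\<lambda>p. 1 / (of_real (fem_symbol p) - z))"
proof (rule tendsto_diff_of_abs_le[OF A_resolvent_tendsto[OF z]])
  fix n :: nat assume n: "1 \<le> n"
  have "cmod (1 / (of_real (Re x) - z) - 1 / (x - z)) \<le> \<bar>Im x\<bar>" if x: "x \<in># eigenvalues (A n)" for x
  proof -
    have 1: "1 \<le> cmod (of_real (Re x) - z)"
      using abs_Im_le_cmod[of "of_real (Re x) - z"] z skew_nonneg by simp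
    have 2: "1 \<le> cmod (x - z)"
      using abs_Im_le_cmod[of "x - z"] z A_abs_Im_le[OF x] by simp
    have nz: "of_real (Re x) - z \<noteq> 0" "x - z \<noteq> 0" using 1 2 by auto
    have "1 / (of_real (Re x) - z) - 1 / (x - z) = (x - of_real (Re x)) / ((of_real (Re x) - z) * (x - z))"
      using nz by (simp add: diff_frac_eq)
    also have "x - of_real (Re x) = \<i> * of_real (Im x)" by (simp add: complex_eq_iff)
    finally have "cmod (1 / (of_real (Re x) - z) - 1 / (x - z)) = \<bar>Im x\<bar> / (cmod (of_real (Re x) - z) * cmod (x - z))"
      by (simp add: norm_divide norm_mult)
    also have "\<dots> \<le> \<bar>Im x\<bar> / 1"
      using mult_mono[OF 1 2] by (intro divide_left_mono) auto
    finally show ?thesis by simp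
  qed
  then have "cmod (\<Sum>x\<in>#eigenvalues (A n). 1 / (of_real (Re x) - z) - 1 / (x - z)) \<le> skew"
    using cmod_sum_mset_le[of "eigenvalues (A n)" _ "\<lambda>x. \<bar>Im x\<bar>"] sum_abs_Im_A[of n] by (meson order_trans)
  then show "cmod ((\<Sum>t\<in>#image_mset Re (eigenvalues (A n)). 1 / (of_real t - z)) / of_nat n -
      (\<Sum>x\<in>#eigenvalues (A n). 1 / (x - z)) / of_nat n) \<le> skew / real n"
    by (simp add: diff_divide_distrib[symmetric] sum_mset_minus norm_divide divide_right_mono
        image_mset.compositionality comp_def)
qed

lemma symbol_on_fem_symbol: "symbol_on glt_domain (\<lambda>p. complex_of_real (fem_symbol p))"
  by (intro symbol_on_glt_domain measurable_compose[OF fem_symbol_measurable]) measurable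

text \<open>The real parts have the right distribution because \<open>F\<close> restricted to the
  line lies in the resolvent algebra. Returning to the complex eigenvalues is cheap because the sum
  of their imaginary parts stays bounded while \<open>n\<close> grows.\<close>

theorem A_eigenvalue_mean_tendsto:
  fixes F :: "complex \<Rightarrow> complex"
  assumes F: "F \<in> Cc"
  shows "(\<lambda>n. (\<Sum>x\<in>#eigenvalues (A n). F x) / of_nat n) \<longlonglongrightarrow> symbol_mean glt_domain (\<lambda>p. F (of_real (fem_symbol p)))"
proof -
  have c: "continuous_on UNIV F" and bd: "bounded {x. F x \<noteq> 0}" using F by (auto simp: Cc_def)
  have M: "0 < skew + 1" using skew_nonneg by simp
  have FR: "(\<lambda>t. F (complex_of_real t)) \<in> Cc"
  proof -
    obtain K where K: "\<And>x. F x \<noteq> 0 \<Longrightarrow> cmod x \<le> K" using bd unfolding bounded_iff by auto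
    have "\<bar>t\<bar> \<le> K" if "F (complex_of_real t) \<noteq> 0" for t using K[OF that] by simp
    then have "bounded {t. F (complex_of_real t) \<noteq> 0}" unfolding bounded_iff by auto
    moreover have "continuous_on UNIV (\<lambda>t. F (complex_of_real t))"
      by (rule continuous_on_compose2[OF c]) (auto intro: continuous_intros)
    ultimately show ?thesis by (simp add: Cc_def)
  qed
  have real: "(\<lambda>n. (\<Sum>t\<in>#image_mset Re (eigenvalues (A n)). F (of_real t)) / of_nat n) \<longlonglongrightarrow>
      symbol_mean glt_domain (\<lambda>p. F (of_real (fem_symbol p)))"
    by (rule resolvent_convergence[OF M symbol_on_fem_symbol _ A_real_resolvent_tendsto Cc_in_resolvent_algebra[OF M FR]])
      (simp_all add: size_eigenvalues[OF fem_matrix_carrier])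
  obtain B where B: "0 \<le> B" "\<And>x. cmod (F x) \<le> B" using Cc_bounded[OF F] by auto
  have "(\<lambda>n. (\<Sum>x\<in>#eigenvalues (A n). F x) / of_nat n - (\<Sum>x\<in>#eigenvalues (A n). F (of_real (Re x))) / of_nat n) \<longlonglongrightarrow> 0"
  proof (rule LIMSEQ_I)
    fix e :: real assume e: "0 < e"
    then obtain d where d: "0 < d" "\<And>x. \<bar>Im x\<bar> \<le> skew \<Longrightarrow> \<bar>Im x\<bar> < d \<Longrightarrow> cmod (F x - F (of_real (Re x))) < e / 2"
      using Cc_uniform[OF F half_gt_zero[OF e] skew_nonneg] by blast
    obtain n0 :: nat where n0: "2 * (2 * B / d * skew) / e < real n0" using reals_Archimedean2 by blast
    have "cmod ((\<Sum>x\<in>#eigenvalues (A n). F x) / of_nat n - (\<Sum>x\<in>#eigenvalues (A n). F (of_real (Re x))) / of_nat n) < e"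
      if n: "max n0 1 \<le> n" for n
    proof -
      \<comment> \<open>Near the axis uniform continuity gives \<open>e / 2\<close>. Elsewhere
        \<open>|Im x| / d\<close> is at least 1, so the trivial bound \<open>2 * B\<close> can be
        charged to the imaginary part, whose sum is bounded.\<close>
      have pt: "cmod (F x - F (of_real (Re x))) \<le> e / 2 + 2 * B / d * \<bar>Im x\<bar>" if x: "x \<in># eigenvalues (A n)" for x
      proof (cases "\<bar>Im x\<bar> < d")
        case True
        have "0 \<le> 2 * B / d * \<bar>Im x\<bar>" using B d by simp
        then show ?thesis using d(2)[OF A_abs_Im_le[OF x] True] by linarith
      next
        case False
        have "cmod (F x - F (of_real (Re x))) \<le> B + B"
          by (rule order_trans[OF norm_triangle_ineq4 add_mono[OF B(2) B(2)]])
        also have "B + B \<le> 2 * B / d * \<bar>Im x\<bar>"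
        proof -
          have "2 * B * d \<le> 2 * B * \<bar>Im x\<bar>" using False B(1) by (intro mult_left_mono) auto
          then show ?thesis using d(1) by (simp add: field_simps)
        qed
        finally show ?thesis using e by simp
      qed
      have "cmod (\<Sum>x\<in>#eigenvalues (A n). F x - F (of_real (Re x))) \<le> (\<Sum>x\<in>#eigenvalues (A n). e / 2 + 2 * B / d * \<bar>Im x\<bar>)"
        by (rule cmod_sum_mset_le[OF pt])
      also have "\<dots> = real n * (e / 2) + 2 * B / d * (\<Sum>x\<in>#eigenvalues (A n). \<bar>Im x\<bar>)"
        by (simp add: sum_mset.distrib sum_mset_distrib_left size_eigenvalues[OF fem_matrix_carrier] image_mset.compositionality comp_def)
      also have "\<dots> \<le> real n * (e / 2) + 2 * B / d * skew"
        using B d sum_abs_Im_A[of n] by (intro add_left_mono mult_left_mono) auto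
      also have "\<dots> < real n * (e / 2) + real n * (e / 2)"
      proof -
        have "2 * (2 * B / d * skew) / e < real n" using n0 n by linarith
        then have "2 * (2 * B / d * skew) < real n * e" using e by (simp only: pos_divide_less_eq)
        then show ?thesis by linarith
      qed
      also have "real n * (e / 2) + real n * (e / 2) = real n * e" by (simp flip: distrib_left)
      finally have "cmod (\<Sum>x\<in>#eigenvalues (A n). F x - F (of_real (Re x))) < real n * e" .
      then show ?thesis
        using n by (simp add: diff_divide_distrib[symmetric] sum_mset_minus norm_divide divide_less_eq mult.commute)
    qed
    then show "\<exists>no. \<forall>n\<ge>no. norm ((\<Sum>x\<in>#eigenvalues (A n). F x) / of_nat n - (\<Sum>x\<in>#eigenvalues (A n). F (of_real (Re x))) / of_nat n - 0) < e"
      by (intro exI[of _ "max n0 1"]) simp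
  qed
  from tendsto_add[OF this real] show ?thesis by (simp add: image_mset.compositionality comp_def)
qed

section \<open>Singular value distribution\<close>

lemma square_resolvent_continuous: "Im w \<noteq> 0 \<Longrightarrow> continuous_on UNIV (\<lambda>t. 1 / (complex_of_real (t\<^sup>2) - w))"
  by (intro continuous_intros) (auto simp: complex_eq_iff)

text \<open>For the Hermitian \<open>X m n\<close> the Gram resolvent is the bounded continuous
  function \<open>1 / (t^2 - w)\<close> of its real eigenvalues, whose means are known; the
  perturbation constant \<open>K\<close> depends on \<open>w\<close> alone.\<close>

lemma singular_resolvent_tendsto:
  assumes w: "1 \<le> \<bar>Im w\<bar>"
  shows "(\<lambda>n. (\<Sum>x\<in>#eigenvalues (mat_adjoint (A n) * A n). 1 / (x - w)) / of_nat n) \<longlonglongrightarrow>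
    symbol_mean glt_domain (\<lambda>p. 1 / (of_real ((fem_symbol p)\<^sup>2) - w))"
proof (rule tendsto_of_approximations)
  have Imw: "Im w \<noteq> 0" using w by auto
  define K where "K = 2 * sqrt (1 / \<bar>Im w\<bar> + cmod w / (Im w)\<^sup>2) / \<bar>Im w\<bar>"
  have K: "0 \<le> K" by (simp add: K_def)
  show "(\<lambda>n. (\<Sum>x\<in>#eigenvalues (X m n). 1 / (of_real ((Re x)\<^sup>2) - w)) / of_nat n) \<longlonglongrightarrow>
      symbol_mean glt_domain (\<lambda>p. 1 / (of_real ((approx_symbol m p)\<^sup>2) - w))" for m
    by (rule X_mean_tendsto[OF square_resolvent_continuous[OF Imw]])
  show "(\<lambda>m. symbol_mean glt_domain (\<lambda>p. 1 / (of_real ((approx_symbol m p)\<^sup>2) - w))) \<longlonglongrightarrow>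
      symbol_mean glt_domain (\<lambda>p. 1 / (of_real ((fem_symbol p)\<^sup>2) - w))"
  proof (rule symbol_mean_approx_tendsto[OF square_resolvent_continuous[OF Imw]])
    show "cmod (1 / (complex_of_real (t\<^sup>2) - w)) \<le> 1 / 1" for t
      by (rule cmod_resolvent_le) (use w in auto)
  qed
  show "(\<lambda>m. err m * K) \<longlonglongrightarrow> 0" using tendsto_mult[OF err_tendsto tendsto_const[of K]] by simp
  fix m
  show "\<forall>\<^sub>F n in sequentially. cmod ((\<Sum>x\<in>#eigenvalues (mat_adjoint (A n) * A n). 1 / (x - w)) / of_nat n -
      (\<Sum>x\<in>#eigenvalues (X m n). 1 / (of_real ((Re x)\<^sup>2) - w)) / of_nat n) \<le> err m * K"
    using mat_l1_small[of m]
  proof eventually_elim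
    case (elim n)
    have eq: "(\<Sum>x\<in>#eigenvalues (X m n). 1 / (of_real ((Re x)\<^sup>2) - w)) = (\<Sum>x\<in>#eigenvalues (X m n). 1 / (x\<^sup>2 - w))"
      by (intro arg_cong[where f = sum_mset] image_mset_cong) (simp add: X_eigenvalue_real)
    have "cmod ((\<Sum>x\<in>#eigenvalues (mat_adjoint (A n) * A n). 1 / (x - w)) - (\<Sum>x\<in>#eigenvalues (X m n). 1 / (x\<^sup>2 - w)))
        \<le> mat_l1 (A n - X m n) * K"
      unfolding K_def by (rule singular_resolvent_trace_perturbation[OF fem_matrix_carrier X_carrier X_hermitian Imw])
    then have "cmod ((\<Sum>x\<in>#eigenvalues (mat_adjoint (A n) * A n). 1 / (x - w)) - (\<Sum>x\<in>#eigenvalues (X m n). 1 / (x\<^sup>2 - w))) / real n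
        \<le> mat_l1 (A n - X m n) * K / real n"
      by (rule divide_right_mono) simp
    also have "\<dots> = mat_l1 (A n - X m n) / real n * K" by simp
    also have "\<dots> \<le> err m * K" by (rule mult_right_mono[OF elim K])
    finally show ?case unfolding eq by (simp add: diff_divide_distrib[symmetric] norm_divide)
  qed
qed

lemma gram_carrier: "mat_adjoint (A n) * A n \<in> carrier_mat n n"
  by (rule mult_carrier_mat[OF mat_adjoint_carrier[OF fem_matrix_carrier] fem_matrix_carrier])

lemma gram_eigenvalue_real:
  assumes "x \<in># eigenvalues (mat_adjoint (A n) * A n)" shows "of_real (Re x) = x"
proof -
  obtain u where u: "\<forall>k<n. u k \<in> carrier_vec n"
    and ev: "eigenvalues (mat_adjoint (A n) * A n) =
      image_mset (\<lambda>k. ((mat_adjoint (A n) * A n) *\<^sub>v u k) \<bullet>c u k) (mset_set {..<n})"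
    using unitary_schur_columns[OF gram_carrier] by blast
  obtain k where "k < n" "x = ((mat_adjoint (A n) * A n) *\<^sub>v u k) \<bullet>c u k" using assms unfolding ev by auto
  then have "x = of_real ((l2_norm (A n *\<^sub>v u k))\<^sup>2)"
    using adjoint_mult_self_cscalar[OF fem_matrix_carrier] u by (simp only:)
  then show ?thesis by (simp only: Re_complex_of_real)
qed

text \<open>Resolvents determine the distribution of the eigenvalues of the Gram matrix. The square
  root is moved into the test function, and on the symbol \<open>sqrt (x^2)\<close> is the absolute
  value.\<close>

theorem A_singular_value_mean_tendsto:
  fixes F :: "real \<Rightarrow> complex"
  assumes F: "F \<in> Cc"
  shows "(\<lambda>n. (\<Sum>s\<in>#singular_values (A n). F s) / of_nat n) \<longlonglongrightarrow> symbol_mean glt_domain (\<lambda>p. F \<bar>fem_symbol p\<bar>)"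
proof -
  have c: "continuous_on UNIV F" and bd: "bounded {x. F x \<noteq> 0}" using F by (auto simp: Cc_def)
  \<comment> \<open>On negative reals \<open>sqrt\<close> is the odd extension, so the composition
    is continuous on the whole line and its support is bounded on both sides.\<close>
  have FS: "(\<lambda>t. F (sqrt t)) \<in> Cc"
  proof -
    obtain K where K: "\<And>x. F x \<noteq> 0 \<Longrightarrow> \<bar>x\<bar> \<le> K" using bd unfolding bounded_iff by auto
    have "\<bar>t\<bar> \<le> K\<^sup>2" if "F (sqrt t) \<noteq> 0" for t
    proof -
      have "\<bar>t\<bar> = \<bar>sqrt t\<bar>\<^sup>2" using real_sqrt_mult_self[of t] by (simp only: power2_abs) (simp only: power2_eq_square)
      then show ?thesis using power_mono[OF K[OF that], of 2] by simp
    qed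
    then have "bounded {t. F (sqrt t) \<noteq> 0}" unfolding bounded_iff by auto
    moreover have "continuous_on UNIV (\<lambda>t. F (sqrt t))"
      by (rule continuous_on_compose2[OF c]) (auto intro: continuous_intros)
    ultimately show ?thesis by (simp add: Cc_def)
  qed
  have M: "0 < (1 :: real)" by simp
  have sym2: "symbol_on glt_domain (\<lambda>p. complex_of_real ((fem_symbol p)\<^sup>2))"
    by (intro symbol_on_glt_domain measurable_compose[OF fem_symbol_measurable]) measurable
  have res: "(\<lambda>n. (\<Sum>t\<in>#image_mset Re (eigenvalues (mat_adjoint (A n) * A n)). 1 / (of_real t - w)) / of_nat n) \<longlonglongrightarrow>
      symbol_mean glt_domain (\<lambda>p. 1 / (of_real ((fem_symbol p)\<^sup>2) - w))" if "1 \<le> \<bar>Im w\<bar>" for w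
  proof -
    have "(\<Sum>t\<in>#image_mset Re (eigenvalues (mat_adjoint (A n) * A n)). 1 / (of_real t - w)) =
        (\<Sum>x\<in>#eigenvalues (mat_adjoint (A n) * A n). 1 / (x - w))" for n
      unfolding image_mset.compositionality comp_def
      by (intro arg_cong[where f = sum_mset] image_mset_cong) (simp add: gram_eigenvalue_real)
    then show ?thesis using singular_resolvent_tendsto[OF that] by (simp only:)
  qed
  have "(\<lambda>n. (\<Sum>t\<in>#image_mset Re (eigenvalues (mat_adjoint (A n) * A n)). F (sqrt t)) / of_nat n) \<longlonglongrightarrow>
      symbol_mean glt_domain (\<lambda>p. F (sqrt ((fem_symbol p)\<^sup>2)))"
    by (rule resolvent_convergence[OF M sym2 _ res Cc_in_resolvent_algebra[OF M FS]])
      (simp_all add: size_eigenvalues[OF gram_carrier])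
  then show ?thesis
    by (simp add: singular_values_def image_mset.compositionality comp_def)
qed

section \<open>The GLT relation\<close>

definition glt_approx :: "nat \<Rightarrow> nat \<Rightarrow> complex mat" where
  "glt_approx m n = Matrix.mat n n (\<lambda>rs. \<Sum>i=1..1::nat. (diag_sampling n (\<lambda>x. complex_of_real (\<alpha> m x)) *
     toeplitz n (\<lambda>\<theta>. complex_of_real ((2 - 2 * cos \<theta>) ^ 1))) $$ rs)"

text \<open>The diagonal factor scales rows, so this is the very matrix that \<open>close\<close>
  compares with \<open>X m n\<close>. The one-term sum and the exponent 1 in
  \<open>glt_approx\<close> match the shapes of \<open>GLT\<close> and
  \<open>lap_coeff 1\<close>.\<close>

lemma glt_approx_entry:
  assumes "i < n" "j < n"
  shows "glt_approx m n $$ (i, j) = of_real (\<alpha> m (real (i + 1) / real n)) * lap_coeff 1 (int i - int j)"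
proof -
  have T: "toeplitz n f \<in> carrier_mat n n" for f by (simp add: toeplitz_def)
  have "glt_approx m n $$ (i, j) = (diag_sampling n (\<lambda>x. complex_of_real (\<alpha> m x)) *
     toeplitz n (\<lambda>\<theta>. complex_of_real ((2 - 2 * cos \<theta>) ^ 1))) $$ (i, j)"
    using assms by (simp add: glt_approx_def)
  also have "\<dots> = of_real (\<alpha> m (real (i + 1) / real n)) * toeplitz n (\<lambda>\<theta>. complex_of_real ((2 - 2 * cos \<theta>) ^ 1)) $$ (i, j)"
    unfolding diag_sampling_def mat_diag_mult_left[OF T] using assms by (simp only: index_mat prod.case)
  also have "toeplitz n (\<lambda>\<theta>. complex_of_real ((2 - 2 * cos \<theta>) ^ 1)) $$ (i, j) = lap_coeff 1 (int i - int j)"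
    using assms by (simp only: toeplitz_def lap_coeff_def index_mat prod.case)
  finally show ?thesis .
qed

lemma glt_approx_carrier: "glt_approx m n \<in> carrier_mat n n"
  by (simp add: glt_approx_def)

text \<open>The comparison passes through \<open>X m n\<close>: with three entries per row, the
  entrywise error \<open>d n\<close> becomes \<open>3 * d n * n\<close>, eventually below
  \<open>n / (m + 1)\<close>.\<close>

lemma glt_approx_close: "\<forall>\<^sub>F n in sequentially. mat_l1 (A n - glt_approx m n) \<le> (err m + 1 / real (Suc m)) * real n"
proof -
  obtain d R where "hermitian_sampled_laplacian (\<alpha> m) (diffusion_matrix (\<alpha> m)) d R" using X_sampled by blast
  then interpret S: hermitian_sampled_laplacian "\<alpha> m" "diffusion_matrix (\<alpha> m)" d R .
  have "(\<lambda>n. 3 * d n) \<longlonglongrightarrow> 3 * 0" by (intro tendsto_mult tendsto_const S.d)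
  then have "\<forall>\<^sub>F n in sequentially. 3 * d n < 1 / real (Suc m)" by (intro order_tendstoD(2)[of _ 0]) auto
  with mat_l1_small[of m] show ?thesis
    using eventually_ge_at_top[of 1]
  proof eventually_elim
    case (elim n)
    have n: "0 < real n" using elim by simp
    have XG: "X m n - glt_approx m n \<in> carrier_mat n n" and AX: "A n - X m n \<in> carrier_mat n n"
      by (rule minus_carrier_mat[OF glt_approx_carrier], rule minus_carrier_mat[OF X_carrier])
    have "mat_l1 (X m n - glt_approx m n) = (\<Sum>i<n. \<Sum>j<n. cmod ((X m n - glt_approx m n) $$ (i, j)))"
      unfolding mat_l1_def by (simp only: carrier_matD[OF XG])
    also have "\<dots> \<le> (\<Sum>i<n. (2 * real 1 + 1) * d n)"
    proof (rule sum_mono)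
      fix i assume "i \<in> {..<n}"
      then have i: "i < n" by simp
      have entry: "(X m n - glt_approx m n) $$ (i, j) = X m n $$ (i, j) - glt_approx m n $$ (i, j)" if "j < n" for j
        using i that glt_approx_carrier[of m n] by simp
      show "(\<Sum>j<n. cmod ((X m n - glt_approx m n) $$ (i, j))) \<le> (2 * real 1 + 1) * d n"
      proof (rule sum_near_le[where c = "int i"])
        fix j assume j: "j < n"
        show "cmod ((X m n - glt_approx m n) $$ (i, j)) \<le> d n"
          unfolding entry[OF j] glt_approx_entry[OF i j] by (rule S.close[OF i j])
        show "cmod ((X m n - glt_approx m n) $$ (i, j)) = 0" if "int 1 < \<bar>int i - int j\<bar>"
          using that unfolding entry[OF j] glt_approx_entry[OF i j] using S.band[OF i j] lap_coeff_support[of 1 "int i - int j"] by simp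
      qed (rule S.d)
    qed
    also have "\<dots> = 3 * d n * real n" by simp
    also have "\<dots> \<le> 1 / real (Suc m) * real n" using elim by (intro mult_right_mono) auto
    finally have 1: "mat_l1 (X m n - glt_approx m n) \<le> 1 / real (Suc m) * real n" .
    have 2: "mat_l1 (A n - X m n) \<le> err m * real n" using elim n by (simp only: pos_divide_le_eq)
    have "mat_l1 (A n - glt_approx m n) \<le> mat_l1 (A n - X m n) + mat_l1 (X m n - glt_approx m n)"
      unfolding mat_minus_telescope[OF fem_matrix_carrier X_carrier glt_approx_carrier, of a b c n m m]
      by (rule mat_l1_triangle[OF AX XG])
    then show ?case using 1 2 by (simp only: distrib_right)
  qed
qed

lemma glt_approx_acs: "acs glt_approx (\<lambda>n. A n)"
proof -
  define \<eta> where "\<eta> m = err m + 1 / real (Suc m)" for m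
  have \<eta>: "\<eta> \<longlonglongrightarrow> 0"
    unfolding \<eta>_def[abs_def] using tendsto_add[OF err_tendsto LIMSEQ_inverse_real_of_nat] by (simp add: inverse_eq_divide)
  have \<eta>_pos: "0 < \<eta> m" for m using err_pos[of m] by (simp add: \<eta>_def add_pos_nonneg)
  have sq: "(\<lambda>m. sqrt (\<eta> m)) \<longlonglongrightarrow> 0" using tendsto_real_sqrt[OF \<eta>] by simp
  have "\<forall>m. \<exists>n0. \<forall>n\<ge>n0. mat_l1 (A n - glt_approx m n) \<le> \<eta> m * real n"
    using glt_approx_close unfolding eventually_sequentially \<eta>_def by blast
  then obtain n0 where n0: "\<And>m n. n0 m \<le> n \<Longrightarrow> mat_l1 (A n - glt_approx m n) \<le> \<eta> m * real n" by metis
  show ?thesis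
    unfolding acs_def
  proof (intro conjI allI impI, goal_cases)
    case 1
    show ?case by (simp add: matrix_seq_def)
  next
    case (2 m)
    show ?case by (simp add: matrix_seq_def glt_approx_carrier)
  next
    case 3
    show ?case
    proof (rule exI[of _ n0], rule exI[of _ "\<lambda>m. sqrt (\<eta> m)"], rule exI[of _ "\<lambda>m. 3 * sqrt (\<eta> m)"],
        intro conjI allI impI)
    show "(\<lambda>m. sqrt (\<eta> m)) \<longlonglongrightarrow> 0" by (rule sq)
    show "(\<lambda>m. 3 * sqrt (\<eta> m)) \<longlonglongrightarrow> 0" using tendsto_mult[OF tendsto_const sq, of 3] by simp
    fix m n :: nat assume n: "n0 m \<le> n"
    have E: "A n - glt_approx m n \<in> carrier_mat n n" by (rule minus_carrier_mat[OF glt_approx_carrier])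
    have "(A n - glt_approx m n) $$ (i, j) = 0" if "i < n" "j < n" "1 < \<bar>int i - int j\<bar>" for i j
    proof -
      have "(A n - glt_approx m n) $$ (i, j) = A n $$ (i, j) - glt_approx m n $$ (i, j)"
        using that glt_approx_carrier[of m n] by simp
      then show ?thesis
        using fem_matrix_band[OF that] glt_approx_entry[OF that(1,2)] lap_coeff_support[of 1 "int i - int j"] that(3) by simp
    qed
    from tridiagonal_acs_splitting[OF E this n0[OF n] \<eta>_pos]
    obtain R N where R: "R \<in> carrier_mat n n" and N: "N \<in> carrier_mat n n" and eq: "A n - glt_approx m n = R + N"
      and bounds: "real (vec_space.rank n R) \<le> sqrt (\<eta> m) * real n" "spectral_norm N \<le> 3 * sqrt (\<eta> m)" by blast
    have "A n = glt_approx m n + (A n - glt_approx m n)"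
      using glt_approx_carrier[of m n] carrier_matD[OF fem_matrix_carrier[of a b c n]] by (intro eq_matI) auto
    also have "\<dots> = glt_approx m n + R + N"
      unfolding eq using assoc_add_mat[OF glt_approx_carrier R N] by simp
    finally show "\<exists>R\<in>carrier_mat n n. \<exists>N\<in>carrier_mat n n. A n = glt_approx m n + R + N \<and>
        real (vec_space.rank n R) \<le> sqrt (\<eta> m) * real n \<and> spectral_norm N \<le> 3 * sqrt (\<eta> m)"
      using R N bounds by blast
    qed
  qed
qed

text \<open>One summand per \<open>m\<close> suffices because the symbol is a product of a function
  of \<open>x\<close> and a function of \<open>\<theta>\<close>. A.e. convergence of the
  coefficients gives convergence in measure on the domain of finite measure.\<close>

theorem A_GLT: "GLT (\<lambda>n. A n) (\<lambda>p. complex_of_real (fem_symbol p))"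
proof -
  have meas: "(\<lambda>p. complex_of_real (fem_symbol p)) \<in> borel_measurable (lebesgue_on glt_domain)"
    by (rule symbol_onD(4)[OF symbol_on_fem_symbol])
  have seq: "matrix_seq (\<lambda>n. A n)" by (simp add: matrix_seq_def)
  have eq: "(\<lambda>m (x, \<theta>). \<Sum>i = 1..1::nat. complex_of_real (\<alpha> m x) * complex_of_real ((2 - 2 * cos \<theta>) ^ 1)) =
      (\<lambda>m p. complex_of_real (approx_symbol m p))"
    by (auto simp: fun_eq_iff approx_symbol_def)
  show ?thesis
    unfolding GLT_def
  proof (rule conjI[OF seq conjI[OF meas]], rule exI[of _ "\<lambda>_. 1"],
      rule exI[of _ "\<lambda>_ m x. complex_of_real (\<alpha> m x)"],
      rule exI[of _ "\<lambda>_ _ \<theta>. complex_of_real ((2 - 2 * cos \<theta>) ^ 1)"], intro conjI allI impI ballI)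
  show "AE x in lebesgue_on {0..1}. continuous (at x within {0..1}) (\<lambda>x. complex_of_real (\<alpha> m x))" for m
  proof (rule AE_I2)
    fix x :: real assume "x \<in> space (lebesgue_on {0..1})"
    moreover have "continuous_on {0..1} (\<lambda>x. complex_of_real (\<alpha> m x))"
      by (intro continuous_intros continuous_on_subset[OF cont]) simp
    ultimately show "continuous (at x within {0..1}) (\<lambda>x. complex_of_real (\<alpha> m x))"
      unfolding continuous_on_eq_continuous_within by (metis space_lebesgue_on)
  qed
  show "complex_integrable (lebesgue_on {-pi..pi}) (\<lambda>\<theta>. complex_of_real ((2 - 2 * cos \<theta>) ^ 1))"
    by (intro continuous_imp_integrable_real continuous_intros)
  show "tendsto_in_measure_on glt_domain
      (\<lambda>m (x, \<theta>). \<Sum>i = 1..1::nat. complex_of_real (\<alpha> m x) * complex_of_real ((2 - 2 * cos \<theta>) ^ 1))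
      (\<lambda>p. complex_of_real (fem_symbol p))"
    unfolding eq
  proof (rule tendsto_in_measure_on_AE)
    show "emeasure lebesgue glt_domain < \<infinity>" by (simp add: emeasure_glt_domain del: emeasure_completion)
    show "(\<lambda>p. complex_of_real (approx_symbol m p)) \<in> borel_measurable (lebesgue_on glt_domain)" for m
      by (intro continuous_measurable_lebesgue_on continuous_intros approx_symbol_continuous)
    show "AE p in lebesgue_on glt_domain. (\<lambda>m. complex_of_real (approx_symbol m p)) \<longlonglongrightarrow> of_real (fem_symbol p)"
      using approx_symbol_tendsto by eventually_elim (rule tendsto_of_real)
  qed (use meas in simp_all)
  show "acs (\<lambda>m n. Matrix.mat n n (\<lambda>rs. \<Sum>i = 1..1::nat. (diag_sampling n (\<lambda>x. complex_of_real (\<alpha> m x)) *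
      toeplitz n (\<lambda>\<theta>. complex_of_real ((2 - 2 * cos \<theta>) ^ 1))) $$ rs)) (\<lambda>n. A n)"
    using glt_approx_acs unfolding glt_approx_def[abs_def] .
  qed
qed

end

theorem theorem3p11:
  fixes a b c :: "real \<Rightarrow> real"
  assumes "integrable (lebesgue_on {0..1}) a"
    and "integrable (lebesgue_on {0..1}) b"
    and "integrable (lebesgue_on {0..1}) c"
  defines "A \<equiv> \<lambda>n. map_mat complex_of_real ((1 / real (n + 1)) \<cdot>\<^sub>m stiffness_matrix a b c n)"
    and "\<kappa> \<equiv> \<lambda>(x, \<theta>). complex_of_real (a x * (2 - 2 * cos \<theta>))"
  shows "GLT A \<kappa> \<and>
    singular_value_distribution A ({0..1} \<times> {-pi..pi}) \<kappa> \<and>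
    eigenvalue_distribution A ({0..1} \<times> {-pi..pi}) \<kappa>"
proof -
  obtain \<alpha> :: "nat \<Rightarrow> real \<Rightarrow> real" where \<alpha>: "\<forall>m. continuous_on UNIV (\<alpha> m)"
    "(\<lambda>m. LINT x|lebesgue_on {0..1}. \<bar>a x - \<alpha> m x\<bar>) \<longlonglongrightarrow> 0"
    "AE x in lebesgue_on {0..1}. (\<lambda>m. \<alpha> m x) \<longlonglongrightarrow> a x"
    using integrable_continuous_approx[OF assms(1)] by blast
  interpret fem a b c \<alpha>
    by unfold_locales (use assms(1-3) \<alpha> in auto)
  have A: "A = (\<lambda>n. fem_matrix a b c n)" by (simp add: A_def fem_matrix_def)
  have \<kappa>: "\<kappa> = (\<lambda>p. complex_of_real (fem_symbol p))" by (auto simp: \<kappa>_def fem_symbol_def fun_eq_iff)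
  have seq: "matrix_seq (\<lambda>n. fem_matrix a b c n)" by (simp add: matrix_seq_def)
  have sv: "singular_value_distribution (\<lambda>n. fem_matrix a b c n) glt_domain (\<lambda>p. complex_of_real (fem_symbol p))"
    unfolding singular_value_distribution_def norm_of_real
    using seq symbol_on_fem_symbol A_singular_value_mean_tendsto unfolding symbol_mean_def by blast
  have ev: "eigenvalue_distribution (\<lambda>n. fem_matrix a b c n) glt_domain (\<lambda>p. complex_of_real (fem_symbol p))"
    unfolding eigenvalue_distribution_def
    using seq symbol_on_fem_symbol A_eigenvalue_mean_tendsto unfolding symbol_mean_def by blast
  show ?thesis unfolding A \<kappa> using A_GLT sv ev by blast
qed

end
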